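(* Let $(X,\mu)$ be an atomless standard (Lebesgue) probability space and let $S:X\to X$ be an ergodic invertible probability measure preserving transformation. Then there is a weak mixing invertible probability measure preserving transformation which is Shannon orbit equivalent to $S$. Explicitly: there is a weak mixing probability measure preserving transformation $T:X\to X$ with $\{T^n x : n\in\mathbb{Z}\}=\{S^n x : n\in\mathbb{Z}\}$ for $\mu$-a.e. $x\in X$, such that the orbit equivalence between $S$ and $T$ (given by the identity map of $X$) is Shannon.
   Context: Transformations are identified with actions of $\mathbb{Z}$. An ergodic transformation of an atomless space is essentially free. If $S,T$ are free p.m.p. transformations of $(X,\mu)$ with the same orbits almost everywhere, the orbit equivalence cocycles $\kappa,\lambda:X\times\mathbb{Z}\to\mathbb{Z}$ are defined for a.e. $x$ and all $n\in\mathbb{Z}$ by $T^{\kappa(x,n)}x=S^n x$ and $S^{\lambda(x,n)}x=T^n x$. The orbit equivalence is Shannon if, for every $n\in\mathbb{Z}$, the countable partitions $\{\{x:\kappa(x,n)=m\}\}_{m\in\mathbb{Z}}$ and $\{\{x:\lambda(x,n)=m\}\}_{m\in\mathbb{Z}}$ have finite Shannon entropy, where the Shannon entropy of a countable measurable partition $\mathscr{P}$ is $\sum_{P\in\mathscr{P}}-\mu(P)\log\mu(P)$ (with $0\log 0=0$). A p.m.p. transformation $T$ is weak mixing if for every finite collection $\mathscr{F}$ of measurable sets, $\liminf_{|n|\to\infty}\sum_{A,B\in\mathscr{F}}|\mu(A\cap T^nB)-\mu(A)\mu(B)|=0$. *)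

theory Defs
  imports "HOL-Probability.Probability"
begin

definition standard_borel :: "'a measure \<Rightarrow> bool" where
  "standard_borel N \<longleftrightarrow>
     (\<exists>X. topspace X = space N \<and> completely_metrizable_space X \<and> second_countable X \<and>
          sets N = sigma_sets (topspace X) {U. openin X U})"

(* Covers both customs: a Borel probability measure on a standard Borel space,
   and the completion of such a measure (a Lebesgue space). *)
definition standard_prob_space :: "'a measure \<Rightarrow> bool" where
  "standard_prob_space M \<longleftrightarrow>
     (\<exists>N. prob_space N \<and> standard_borel N \<and> (M = N \<or> M = completion N))"

definition atomless :: "'a measure \<Rightarrow> bool" where
  "atomless M \<longleftrightarrow>
     (\<forall>A\<in>sets M. 0 < emeasure M A \<longrightarrow>
        (\<exists>B\<in>sets M. B \<subseteq> A \<and> 0 < emeasure M B \<and> emeasure M B < emeasure M A))"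

(* Transformations act on space M only: the values of T outside space M are irrelevant. *)
definition pmp_transformation :: "'a measure \<Rightarrow> ('a \<Rightarrow> 'a) \<Rightarrow> bool" where
  "pmp_transformation M T \<longleftrightarrow>
     prob_space M \<and> bij_betw T (space M) (space M) \<and>
     T \<in> measurable M M \<and> inv_into (space M) T \<in> measurable M M \<and>
     distr M M T = M"

definition zpow :: "'a measure \<Rightarrow> ('a \<Rightarrow> 'a) \<Rightarrow> int \<Rightarrow> 'a \<Rightarrow> 'a" where
  "zpow M T n =
     (if 0 \<le> n then T ^^ nat n else inv_into (space M) T ^^ nat (- n))"

definition int_orbit :: "'a measure \<Rightarrow> ('a \<Rightarrow> 'a) \<Rightarrow> 'a \<Rightarrow> 'a set" where
  "int_orbit M T x = range (\<lambda>n. zpow M T n x)"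

definition ergodic :: "'a measure \<Rightarrow> ('a \<Rightarrow> 'a) \<Rightarrow> bool" where
  "ergodic M T \<longleftrightarrow>
     (\<forall>A\<in>sets M. T ` A = A \<longrightarrow> measure M A = 0 \<or> measure M A = 1)"

definition essentially_free :: "'a measure \<Rightarrow> ('a \<Rightarrow> 'a) \<Rightarrow> bool" where
  "essentially_free M T \<longleftrightarrow> (AE x in M. \<forall>n. n \<noteq> 0 \<longrightarrow> zpow M T n x \<noteq> x)"

definition weak_mixing :: "'a measure \<Rightarrow> ('a \<Rightarrow> 'a) \<Rightarrow> bool" where
  "weak_mixing M T \<longleftrightarrow>
     (\<forall>F. finite F \<and> F \<subseteq> sets M \<longrightarrow>
        Liminf (filtercomap abs at_top)
          (\<lambda>n::int. ereal (\<Sum>A\<in>F. \<Sum>B\<in>F.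
             \<bar>measure M (A \<inter> zpow M T n ` B) - measure M A * measure M B\<bar>)) = 0)"

definition orbit_equivalence :: "'a measure \<Rightarrow> ('a \<Rightarrow> 'a) \<Rightarrow> ('a \<Rightarrow> 'a) \<Rightarrow> bool" where
  "orbit_equivalence M S T \<longleftrightarrow> (AE x in M. int_orbit M T x = int_orbit M S x)"

(* For free S and T with the same orbits a.e. the integer m exists uniquely for a.e. x and
   all n; the default 0 is used on a null set only.  In the notation T^{kappa(x,n)} x = S^n x
   and S^{lambda(x,n)} x = T^n x this is kappa = oe_cocycle M S T, lambda = oe_cocycle M T S. *)
definition oe_cocycle ::
  "'a measure \<Rightarrow> ('a \<Rightarrow> 'a) \<Rightarrow> ('a \<Rightarrow> 'a) \<Rightarrow> 'a \<Rightarrow> int \<Rightarrow> int" where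
  "oe_cocycle M S T x n =
     (if \<exists>!m. zpow M T m x = zpow M S n x
      then THE m. zpow M T m x = zpow M S n x else 0)"

(* Empty members are allowed. *)
definition countable_measurable_partition :: "'a measure \<Rightarrow> 'a set set \<Rightarrow> bool" where
  "countable_measurable_partition M P \<longleftrightarrow>
     countable P \<and> P \<subseteq> sets M \<and> disjoint P \<and> \<Union>P = space M"

(* 0 * ln 0 = 0 holds in HOL.  The terms are nonnegative for a probability measure, so the
   sum makes sense in [0, infinity]. *)
definition shannon_entropy :: "'a measure \<Rightarrow> 'a set set \<Rightarrow> ennreal" where
  "shannon_entropy M P =
     (\<integral>\<^sup>+A. ennreal (- (measure M A * ln (measure M A))) \<partial>count_space P)"

definition cocycle_partition ::
  "'a measure \<Rightarrow> ('a \<Rightarrow> int \<Rightarrow> int) \<Rightarrow> int \<Rightarrow> 'a set set" where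
  "cocycle_partition M c n = range (\<lambda>m. {x \<in> space M. c x n = m})"

definition finite_entropy_cocycle :: "'a measure \<Rightarrow> ('a \<Rightarrow> int \<Rightarrow> int) \<Rightarrow> bool" where
  "finite_entropy_cocycle M c \<longleftrightarrow>
     (\<forall>n. countable_measurable_partition M (cocycle_partition M c n) \<and>
          shannon_entropy M (cocycle_partition M c n) < \<infinity>)"

definition shannon_orbit_equivalence ::
  "'a measure \<Rightarrow> ('a \<Rightarrow> 'a) \<Rightarrow> ('a \<Rightarrow> 'a) \<Rightarrow> bool" where
  "shannon_orbit_equivalence M S T \<longleftrightarrow>
     essentially_free M S \<and> essentially_free M T \<and> orbit_equivalence M S T \<and>
     finite_entropy_cocycle M (oe_cocycle M S T) \<and>
     finite_entropy_cocycle M (oe_cocycle M T S)"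

end

theory Submission
  imports Defs
begin

text \<open>
  The transformation \<open>T\<close> is a limit of conjugates of \<open>S\<close> by elements of its full group.  Given an
  ergodic \<open>T k\<close> and a large \<open>n\<close>, cut a Rokhlin tower of height proportional to \<open>n\<close> into finitely many
  columns, independent of the finitely many sets to be mixed, and rearrange the levels of column \<open>c\<close> so
  that every \<open>n\<close>-th step is stretched by \<open>c\<close>.  The conjugate \<open>T (Suc k)\<close> differs from \<open>T k\<close> on a set of
  measure \<open>O(1/n)\<close>, moves points by at most \<open>O(n)\<close> along orbits, and its \<open>n\<close>-th power acts on the columns as
  \<open>T k\<close> to the powers \<open>n + c\<close>; by the mean ergodic theorem, averaging over the columns mixes the given sets
  at time \<open>n\<close>.  Since \<open>ln n / n \<rightarrow> 0\<close>, the changes can be made summable even when weighted with the logarithm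
  of the cocycle bound.  Hence the sequence stabilises almost everywhere, and the cocycles have integrable
  logarithm, which forces finite entropy.
\<close>

text \<open>A conjugation that mixes at time \<open>n\<close> moves points by about \<open>n\<close>
  on a set of measure about \<open>1 / n\<close>, so the expected displacement does not become
  small, and the construction gives no L^1 control of the cocycles. Nor could it in general: by
  Belinskaya's theorem an integrable orbit equivalence makes \<open>T\<close> conjugate to
  \<open>S\<close> or to its inverse, which is impossible when \<open>S\<close> is not weak mixing.
  The logarithm of the displacement does make the cost of a step arbitrarily small, and a finite
  logarithmic moment is enough for finite entropy. Weak mixing is a lower limit, so one good time
  per stage suffices, for a growing finite part of a dense sequence of sets. Later stages must
  respect not only the map \<open>T k\<close> but a whole window of its powers, containing the
  mixing time and the exponents that express \<open>S\<close> by \<open>T k\<close>; hence changes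
  are measured by \<open>discrepancy\<close>. Conjugating within the full group retains orbits and
  ergodicity, so each stage can start from the map that the previous one produced.\<close>

section \<open>Automorphisms and their integer powers\<close>

text \<open>Automorphisms are bijections of the whole type, so that \<open>inv\<close> and preimages
  can be used without intersecting with \<open>space M\<close>; measurability in both directions
  makes them preserve \<open>space M\<close>.\<close>

definition aut :: "'a measure \<Rightarrow> ('a \<Rightarrow> 'a) \<Rightarrow> bool" where
  "aut M T \<longleftrightarrow> bij T \<and> T \<in> measurable M M \<and> inv T \<in> measurable M M \<and> distr M M T = M"

definition ipow :: "('a \<Rightarrow> 'a) \<Rightarrow> int \<Rightarrow> 'a \<Rightarrow> 'a" where
  "ipow T n = (if 0 \<le> n then T ^^ nat n else inv T ^^ nat (- n))"

lemma ipow_0 [simp]: "ipow T 0 x = x"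
  by (simp add: ipow_def)

lemma ipow_1 [simp]: "ipow T 1 x = T x"
  by (simp add: ipow_def)

lemma ipow_neg1 [simp]: "ipow T (-1) x = inv T x"
  by (simp add: ipow_def)

lemma ipow_of_nat: "ipow T (int n) = T ^^ n"
  by (simp add: ipow_def)

lemma ipow_plus1:
  assumes "bij T"
  shows "ipow T (n + 1) x = T (ipow T n x)"
proof -
  consider "n \<ge> 0" | "n = -1" | "n < -1" by linarith
  then show ?thesis
  proof cases
    case 1
    then have "nat (n + 1) = Suc (nat n)" by simp
    then show ?thesis using 1 by (simp add: ipow_def)
  next
    case 2
    then show ?thesis using assms by (simp add: bij_is_surj surj_f_inv_f)
  next
    case 3
    then have "nat (- n) = Suc (nat (- (n + 1)))" by simp
    then show ?thesis using 3 assms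
      by (simp add: ipow_def bij_is_surj surj_f_inv_f del: minus_add_distrib)
  qed
qed

lemma ipow_minus1:
  assumes "bij T"
  shows "ipow T (n - 1) x = inv T (ipow T n x)"
  using ipow_plus1[OF assms, of "n - 1" x] assms by (simp add: bij_is_inj)

lemma ipow_add:
  assumes "bij T"
  shows "ipow T (m + n) x = ipow T m (ipow T n x)"
proof (induction m rule: int_induct[where k = 0])
  case base
  then show ?case by simp
next
  case (step1 i)
  then show ?case using ipow_plus1[OF assms, of "i + n"] ipow_plus1[OF assms, of i]
    by (simp add: add.commute add.left_commute)
next
  case (step2 i)
  have "i - 1 + n = (i + n) - 1" by simp
  then show ?case using step2 by (simp only: ipow_minus1[OF assms])
qed

lemma ipow_cancel [simp]:
  assumes "bij T"
  shows "ipow T n (ipow T (-n) x) = x" "ipow T (-n) (ipow T n x) = x"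
  using ipow_add[OF assms, of n "-n" x] ipow_add[OF assms, of "-n" n x] by simp_all

lemma bij_ipow: "bij T \<Longrightarrow> bij (ipow T n)"
  by (rule o_bij[of "ipow T (-n)"]) (auto simp: fun_eq_iff)

lemma ipow_conj:
  fixes T U :: "'a \<Rightarrow> 'a"
  assumes "bij T" "bij U"
  shows "ipow (\<lambda>x. U (T (inv U x))) n x = U (ipow T n (inv U x))"
proof -
  let ?W = "\<lambda>x. U (T (inv U x))"
  have W: "bij ?W"
    using bij_comp[OF bij_comp[OF bij_imp_bij_inv[OF assms(2)] assms(1)] assms(2)]
    by (simp add: comp_def)
  have UU: "U (inv U y) = y" "inv U (U y) = y" for y
    using assms by (simp_all add: bij_is_surj surj_f_inv_f bij_is_inj)
  show ?thesis
  proof (induction n rule: int_induct[where k = 0])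
    case base
    then show ?case by (simp add: UU)
  next
    case (step1 i)
    then show ?case by (simp add: ipow_plus1[OF W] ipow_plus1[OF assms(1)] UU)
  next
    case (step2 i)
    have "inv ?W = (\<lambda>x. U (inv T (inv U x)))"
      using assms UU by (intro inv_equality) (auto simp: bij_is_surj surj_f_inv_f bij_is_inj)
    then show ?case using step2 by (simp add: ipow_minus1[OF W] ipow_minus1[OF assms(1)] UU)
  qed
qed

lemma autD:
  assumes "aut M T"
  shows "bij T" "T \<in> measurable M M" "inv T \<in> measurable M M" "distr M M T = M"
    "T (inv T x) = x" "inv T (T x) = x"
  using assms by (auto simp: aut_def bij_is_surj surj_f_inv_f bij_is_inj)

lemma aut_space:
  assumes "aut M T"
  shows "T x \<in> space M \<longleftrightarrow> x \<in> space M"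
  using autD[OF assms] by (metis measurable_space)

lemma aut_vimage:
  assumes "aut M T" "A \<in> sets M"
  shows "T -` A \<in> sets M" "emeasure M (T -` A) = emeasure M A" "measure M (T -` A) = measure M A"
proof -
  have *: "T -` A = T -` A \<inter> space M"
    using sets.sets_into_space[OF assms(2)] aut_space[OF assms(1)] by auto
  show "T -` A \<in> sets M" by (subst *) (rule measurable_sets[OF autD(2)[OF assms(1)] assms(2)])
  have "emeasure M A = emeasure (distr M M T) A" using autD(4)[OF assms(1)] by simp
  also have "\<dots> = emeasure M (T -` A)"
    using autD(2)[OF assms(1)] assms(2) * by (simp add: emeasure_distr)
  finally show "emeasure M (T -` A) = emeasure M A" by simp
  then show "measure M (T -` A) = measure M A" by (simp add: measure_def)
qed

lemma aut_inv:
  assumes "aut M T"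
  shows "aut M (inv T)"
proof -
  note T = autD[OF assms]
  have "distr M M (inv T) = distr (distr M M T) M (inv T)" by (simp add: T)
  also have "\<dots> = distr M M (inv T \<circ> T)" using T by (intro distr_distr) auto
  also have "inv T \<circ> T = (\<lambda>x. x)" using T by (simp add: fun_eq_iff)
  finally have "distr M M (inv T) = M" by (simp add: distr_id[unfolded id_def])
  then show ?thesis using T(1-3) by (simp add: aut_def bij_imp_bij_inv inv_inv_eq)
qed

lemma aut_image:
  assumes "aut M T" "A \<in> sets M"
  shows "T ` A \<in> sets M" "emeasure M (T ` A) = emeasure M A" "measure M (T ` A) = measure M A"
proof -
  have "T ` A = inv T -` A" using autD(1)[OF assms(1)] by (simp add: bij_vimage_eq_inv_image bij_imp_bij_inv inv_inv_eq)
  then show "T ` A \<in> sets M" "emeasure M (T ` A) = emeasure M A" "measure M (T ` A) = measure M A"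
    using aut_vimage[OF aut_inv[OF assms(1)] assms(2)] by simp_all
qed

lemma aut_comp:
  assumes "aut M T" "aut M U"
  shows "aut M (\<lambda>x. T (U x))"
proof -
  note T = autD[OF assms(1)] and U = autD[OF assms(2)]
  have i: "inv (\<lambda>x. T (U x)) = (\<lambda>x. inv U (inv T x))"
    using T(5,6) U(5,6) by (intro inv_equality) auto
  have b: "bij (\<lambda>x. T (U x))"
    using bij_comp[OF U(1) T(1)] by (simp add: comp_def)
  have "distr M M (\<lambda>x. T (U x)) = distr (distr M M U) M T"
    using T(2) U(2) by (simp add: distr_distr comp_def)
  then have "distr M M (\<lambda>x. T (U x)) = M" using T(4) U(4) by simp
  moreover have "(\<lambda>x. T (U x)) \<in> measurable M M" "(\<lambda>x. inv U (inv T x)) \<in> measurable M M"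
    using measurable_compose[OF U(2) T(2)] measurable_compose[OF T(3) U(3)] by simp_all
  ultimately show ?thesis using b i by (simp add: aut_def)
qed

lemma aut_id: "aut M (\<lambda>x. x)"
proof -
  have "inv (\<lambda>x::'a. x) = (\<lambda>x. x)" by (rule inv_equality) auto
  then show ?thesis by (simp add: aut_def bij_id[unfolded id_def] distr_id[unfolded id_def])
qed

lemma aut_funpow: "aut M T \<Longrightarrow> aut M (T ^^ n)"
proof (induction n)
  case 0
  then show ?case using aut_id by (simp add: id_def)
next
  case (Suc n)
  then show ?case using aut_comp[of M T "T ^^ n"] by (simp add: comp_def)
qed

lemma aut_ipow: "aut M T \<Longrightarrow> aut M (ipow T n)"
  by (simp add: ipow_def aut_funpow aut_inv)

lemma aut_AE:
  assumes "aut M T" "AE x in M. P x"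
  shows "AE x in M. P (T x)"
proof -
  obtain N where N: "N \<in> null_sets M" "{x \<in> space M. \<not> P x} \<subseteq> N"
    using assms(2) by (auto simp: eventually_ae_filter)
  have "T -` N \<in> null_sets M"
    using N(1) aut_vimage[OF assms(1)] by (auto simp: null_sets_def)
  moreover have "{x \<in> space M. \<not> P (T x)} \<subseteq> T -` N"
    using N(2) aut_space[OF assms(1)] by auto
  ultimately show ?thesis by (rule AE_I')
qed

lemma aut_nn_integral:
  assumes "aut M T" "f \<in> borel_measurable M"
  shows "(\<integral>\<^sup>+x. f (T x) \<partial>M) = (\<integral>\<^sup>+x. f x \<partial>M)"
  using nn_integral_distr[OF autD(2)[OF assms(1)], of f] assms autD(4)[OF assms(1)] by simp

lemma aut_integral:
  fixes f :: "'a \<Rightarrow> real"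
  assumes "aut M T" "f \<in> borel_measurable M"
  shows "(\<integral>x. f (T x) \<partial>M) = (\<integral>x. f x \<partial>M)"
  using integral_distr[OF autD(2)[OF assms(1)], of f] assms autD(4)[OF assms(1)] by simp

lemma aut_integrable:
  fixes f :: "'a \<Rightarrow> real"
  assumes "aut M T" "integrable M f"
  shows "integrable M (\<lambda>x. f (T x))"
  using integrable_distr[OF autD(2)[OF assms(1)], of f] assms autD(4)[OF assms(1)] by simp

section \<open>Separating and dense sequences of sets, and the full group\<close>

text \<open>
  The sequence \<open>C\<close> separates points, which makes coincidence sets of measurable maps
  measurable, and it is dense in the measure algebra.
\<close>

locale sep_prob = prob_space M for M :: "'a measure" +
  fixes C :: "nat \<Rightarrow> 'a set"
  assumes C_sets: "C i \<in> sets M"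
    and C_sep: "x \<in> space M \<Longrightarrow> y \<in> space M \<Longrightarrow> x \<noteq> y \<Longrightarrow> \<exists>i. (x \<in> C i) \<noteq> (y \<in> C i)"
    and C_dense: "A \<in> sets M \<Longrightarrow> e > 0 \<Longrightarrow> \<exists>i. measure M ((A - C i) \<union> (C i - A)) < e"
begin

lemma neq_set_measurable:
  assumes "V \<in> measurable M M" "W \<in> measurable M M"
  shows "{x \<in> space M. V x \<noteq> W x} \<in> sets M"
proof -
  define D where "D i = ((V -` C i \<inter> space M) - (W -` C i \<inter> space M)) \<union>
      ((W -` C i \<inter> space M) - (V -` C i \<inter> space M))" for i
  have D: "D i \<in> sets M" for i
    unfolding D_def
    by (intro sets.Diff sets.Un measurable_sets[OF assms(1) C_sets] measurable_sets[OF assms(2) C_sets])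
  have "{x \<in> space M. V x \<noteq> W x} = (\<Union>i. D i)"
  proof (intro set_eqI iffI)
    fix x assume "x \<in> {x \<in> space M. V x \<noteq> W x}"
    then have x: "x \<in> space M" "V x \<noteq> W x" by auto
    with C_sep[OF measurable_space[OF assms(1)] measurable_space[OF assms(2)], of x]
    obtain i where "(V x \<in> C i) \<noteq> (W x \<in> C i)" by auto
    then show "x \<in> (\<Union>i. D i)" using x by (auto simp: D_def)
  next
    fix x assume "x \<in> (\<Union>i. D i)"
    then obtain i where "x \<in> D i" by blast
    then show "x \<in> {x \<in> space M. V x \<noteq> W x}" unfolding D_def by auto
  qed
  with D show ?thesis by (simp add: sets.countable_UN')
qed

lemma eq_set_measurable:
  assumes "V \<in> measurable M M" "W \<in> measurable M M"
  shows "{x \<in> space M. V x = W x} \<in> sets M"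
proof -
  have "{x \<in> space M. V x = W x} = space M - {x \<in> space M. V x \<noteq> W x}" by blast
  with sets.compl_sets[OF neq_set_measurable[OF assms]] show ?thesis by metis
qed

text \<open>On countably many pieces \<open>V\<close> is a power of \<open>S\<close>, and
  injectivity keeps the images of disjoint pieces disjoint, so images of measurable sets are
  measurable and have the same measure. Maps built by rearranging orbits thus only need to be
  bijective and measurable.\<close>

lemma aut_full_group:
  assumes S: "aut M S" and V: "bij V" "V \<in> measurable M M"
    and orb: "\<And>x. \<exists>n. V x = ipow S n x"
  shows "aut M V"
proof -
  define E where "E n = {x \<in> space M. V x = ipow S n x}" for n
  have Es [measurable]: "E n \<in> sets M" for n
    unfolding E_def by (rule eq_set_measurable[OF V(2) autD(2)[OF aut_ipow[OF S]]])
  \<comment> \<open>The sets \<open>E n\<close> overlap at periodic points of \<open>S\<close>, so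
    they are made disjoint before measures are added.\<close>
  define F where "F n = disjointed (\<lambda>k. E (from_nat k)) n" for n
  have Fs: "F n \<in> sets M" for n
  proof -
    have "range (\<lambda>k. E (from_nat k)) \<subseteq> sets M" using Es by auto
    from sets.range_disjointed_sets[OF this] show ?thesis unfolding F_def by blast
  qed
  have FE: "F n \<subseteq> E (from_nat n)" for n unfolding F_def by (rule disjointed_subset)
  have dF: "disjoint_family F" unfolding F_def[abs_def] by (rule disjoint_family_disjointed)
  have "(\<Union>n. F n) = (\<Union>k. E (from_nat k))" unfolding F_def by (rule UN_disjointed_eq)
  also have "\<dots> = space M"
  proof
    show "(\<Union>k. E (from_nat k)) \<subseteq> space M" by (auto simp: E_def)
    show "space M \<subseteq> (\<Union>k. E (from_nat k))"
    proof
      fix x assume "x \<in> space M"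
      with orb[of x] obtain n where "x \<in> E n" by (auto simp: E_def)
      then have "x \<in> E (from_nat (to_nat n))" by simp
      then show "x \<in> (\<Union>k. E (from_nat k))" by blast
    qed
  qed
  finally have UF: "(\<Union>n. F n) = space M" .
  have im: "V ` (A \<inter> F n) = ipow S (from_nat n) ` (A \<inter> F n)" for A n
    by (rule image_cong) (use FE[of n] in \<open>auto simp: E_def\<close>)
  have VA: "V ` A = (\<Union>n. V ` (A \<inter> F n))" if "A \<in> sets M" for A
  proof -
    have "A = (\<Union>n. A \<inter> F n)" using UF sets.sets_into_space[OF that] by auto
    then show ?thesis by (metis image_UN)
  qed
  have img: "V ` A \<in> sets M \<and> emeasure M (V ` A) = emeasure M A" if A: "A \<in> sets M" for A
  proof
    have s: "V ` (A \<inter> F n) \<in> sets M" for n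
      unfolding im using aut_image(1)[OF aut_ipow[OF S]] A Fs by blast
    show "V ` A \<in> sets M" using s by (subst VA[OF A]) blast
    have "emeasure M (V ` A) = emeasure M (\<Union>n. V ` (A \<inter> F n))" using VA[OF A] by simp
    also have "\<dots> = (\<Sum>n. emeasure M (V ` (A \<inter> F n)))"
    proof (rule suminf_emeasure[symmetric])
      show "range (\<lambda>n. V ` (A \<inter> F n)) \<subseteq> sets M" using s by auto
      show "disjoint_family (\<lambda>n. V ` (A \<inter> F n))"
        using dF bij_is_inj[OF V(1)]
        by (auto simp: disjoint_family_on_def inj_eq) (metis IntI empty_iff)
    qed
    also have "\<dots> = (\<Sum>n. emeasure M (A \<inter> F n))"
      unfolding im using aut_image(2)[OF aut_ipow[OF S]] A Fs by simp
    also have "\<dots> = emeasure M (\<Union>n. A \<inter> F n)"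
    proof (rule suminf_emeasure)
      show "range (\<lambda>n. A \<inter> F n) \<subseteq> sets M" using A Fs by auto
      show "disjoint_family (\<lambda>n. A \<inter> F n)"
        using dF by (auto simp: disjoint_family_on_def)
    qed
    also have "(\<Union>n. A \<inter> F n) = A" using UF sets.sets_into_space[OF A] by auto
    finally show "emeasure M (V ` A) = emeasure M A" .
  qed
  have sp: "V x \<in> space M \<longleftrightarrow> x \<in> space M" for x
    using orb[of x] aut_space[OF aut_ipow[OF S]] by auto
  have iv: "inv V -` A \<inter> space M = V ` A" if "A \<in> sets M" for A
  proof -
    have "inv V -` A = V ` A"
      using bij_vimage_eq_inv_image[OF bij_imp_bij_inv[OF V(1)], of A] V(1) by (simp add: inv_inv_eq)
    moreover have "V ` A \<subseteq> space M" using sets.sets_into_space[OF that] sp by auto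
    ultimately show ?thesis by auto
  qed
  have "inv V \<in> measurable M M"
  proof (rule measurableI)
    show "inv V x \<in> space M" if "x \<in> space M" for x
      using sp[of "inv V x"] that V(1) by (simp add: bij_is_surj surj_f_inv_f)
    show "inv V -` A \<inter> space M \<in> sets M" if "A \<in> sets M" for A
      using iv[OF that] img[OF that] by simp
  qed
  moreover have "distr M M V = M"
  proof (rule measure_eqI)
    fix A assume "A \<in> sets (distr M M V)"
    then have A: "A \<in> sets M" by simp
    let ?B = "V -` A \<inter> space M"
    have B: "?B \<in> sets M" by (rule measurable_sets[OF V(2) A])
    have "V ` ?B = A"
    proof
      show "A \<subseteq> V ` ?B"
      proof
        fix y assume y: "y \<in> A"
        have "V (inv V y) = y" using V(1) by (simp add: bij_is_surj surj_f_inv_f)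
        then show "y \<in> V ` ?B" using sp[of "inv V y"] y sets.sets_into_space[OF A]
          by (intro image_eqI[of _ _ "inv V y"]) auto
      qed
    qed auto
    then show "emeasure (distr M M V) A = emeasure M A"
      using img[OF B] V(2) A by (simp add: emeasure_distr)
  qed simp
  ultimately show ?thesis using V by (simp add: aut_def)
qed

end

section \<open>Standard spaces have a dense separating sequence\<close>

text \<open>Codes for finite Boolean combinations of a sequence of sets. The type is countable, so
  \<open>from_nat\<close> enumerates the generated algebra.\<close>

datatype setform = Atom nat | Neg setform | Disj setform setform

instance setform :: countable by countable_datatype

primrec interp :: "'a set \<Rightarrow> (nat \<Rightarrow> 'a set) \<Rightarrow> setform \<Rightarrow> 'a set" where
  "interp X b (Atom n) = b n"
| "interp X b (Neg f) = X - interp X b f"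
| "interp X b (Disj f g) = interp X b f \<union> interp X b g"

lemma (in prob_space) interp_sets:
  "range b \<subseteq> sets M \<Longrightarrow> interp (space M) b f \<in> sets M"
  by (induction f) auto

text \<open>The sets that Boolean combinations of the \<open>b n\<close> approximate form a
  sigma-algebra. For a countable union, continuity from below reduces to a finite union at a cost of
  \<open>e / 2\<close>, and the errors of finite unions add up.\<close>

lemma (in prob_space) interp_dense:
  assumes gen: "sets M = sigma_sets (space M) (range b)" and A: "A \<in> sets M" and "e > 0"
  shows "\<exists>f. measure M (sym_diff A (interp (space M) b f)) < e"
proof -
  let ?I = "interp (space M) b"
  have b: "range b \<subseteq> sets M" unfolding gen by (auto intro: sigma_sets.Basic)
  have I: "?I f \<in> sets M" for f by (rule interp_sets[OF b])
  have "A \<in> sigma_sets (space M) (range b)" using A gen by simp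
  then have "\<forall>e>0. \<exists>f. measure M (sym_diff A (?I f)) < e"
  proof induction
    case (Basic a)
    then obtain i where "a = b i" by auto
    then have "sym_diff a (?I (Atom i)) = {}" by simp
    then show ?case by (metis measure_empty)
  next
    case Empty
    \<comment> \<open>An excluded middle serves as the code of the whole space; its negation is the
      code of the empty set.\<close>
    have "?I (Disj (Atom 0) (Neg (Atom 0))) = space M"
      using I[of "Atom 0", THEN sets.sets_into_space] by auto
    then have "sym_diff {} (?I (Neg (Disj (Atom 0) (Neg (Atom 0))))) = {}" by simp
    then show ?case by (metis measure_empty)
  next
    case (Compl a)
    have a: "a \<subseteq> space M" using Compl(1) gen sets.sets_into_space by blast
    show ?case
    proof (intro allI impI)
      fix e :: real assume "e > 0"
      with Compl(2) obtain f where f: "measure M (sym_diff a (?I f)) < e" by blast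
      have "sym_diff (space M - a) (?I (Neg f)) = sym_diff a (?I f)"
        using a I[THEN sets.sets_into_space, of f] by auto
      with f show "\<exists>f. measure M (sym_diff (space M - a) (?I f)) < e" by metis
    qed
  next
    case (Union a)
    have a: "a i \<in> sets M" for i using Union(1) gen by blast
    have fin: "\<exists>f. measure M (sym_diff (\<Union>i\<le>n. a i) (?I f)) < e" if "e > 0" for n e
      using that
    proof (induction n arbitrary: e)
      case 0
      then show ?case using Union(2)[of 0] by auto
    next
      case (Suc n)
      then have e2: "e / 2 > 0" by simp
      obtain f where f: "measure M (sym_diff (\<Union>i\<le>n. a i) (?I f)) < e / 2"
        using Suc.IH[OF e2] by blast
      obtain g where g: "measure M (sym_diff (a (Suc n)) (?I g)) < e / 2"
        using Union(2)[of "Suc n"] e2 by blast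
      have s: "sym_diff (\<Union>i\<le>n. a i) (?I f) \<in> sets M" "sym_diff (a (Suc n)) (?I g) \<in> sets M"
        using a I by (auto intro!: sets.Un sets.Diff sets.finite_UN)
      have "measure M (sym_diff (\<Union>i\<le>Suc n. a i) (?I (Disj f g)))
          \<le> measure M (sym_diff (\<Union>i\<le>n. a i) (?I f) \<union> sym_diff (a (Suc n)) (?I g))"
        using s by (intro finite_measure_mono) (auto simp: atMost_Suc)
      also have "\<dots> \<le> measure M (sym_diff (\<Union>i\<le>n. a i) (?I f)) + measure M (sym_diff (a (Suc n)) (?I g))"
        using s by (rule measure_Un_le)
      finally show ?case using f g by (intro exI[of _ "Disj f g"]) linarith
    qed
    show ?case
    proof (intro allI impI)
      fix e :: real assume e: "e > 0"
      have Us: "(\<Union>i\<le>n. a i) \<in> sets M" "(\<Union>i. a i) \<in> sets M" for n using a by auto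
      have "(\<lambda>n. measure M (\<Union>i\<le>n. a i)) \<longlonglongrightarrow> measure M (\<Union>n. \<Union>i\<le>n. a i)"
        using Us(1) by (intro finite_Lim_measure_incseq) (auto simp: incseq_def intro: order_trans)
      moreover have "(\<Union>n. \<Union>i\<le>n. a i) = (\<Union>i. a i)" by auto
      ultimately have "\<forall>\<^sub>F n in sequentially. measure M (\<Union>i\<le>n. a i) > measure M (\<Union>i. a i) - e / 2"
        using e by (intro order_tendstoD) auto
      then obtain n where n: "measure M (\<Union>i\<le>n. a i) > measure M (\<Union>i. a i) - e / 2"
        by (auto simp: eventually_sequentially)
      obtain f where f: "measure M (sym_diff (\<Union>i\<le>n. a i) (?I f)) < e / 2"
        using fin[of "e / 2" n] e by auto
      have d: "measure M ((\<Union>i. a i) - (\<Union>i\<le>n. a i)) < e / 2"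
      proof -
        have "(\<Union>i\<le>n. a i) \<subseteq> (\<Union>i. a i)" by blast
        from finite_measure_Diff[OF Us(2) Us(1)[of n] this] show ?thesis using n by linarith
      qed
      have s: "sym_diff (\<Union>i\<le>n. a i) (?I f) \<in> sets M" "(\<Union>i. a i) - (\<Union>i\<le>n. a i) \<in> sets M"
        using Us I by (auto intro!: sets.Un sets.Diff)
      have "measure M (sym_diff (\<Union>i. a i) (?I f))
          \<le> measure M (sym_diff (\<Union>i\<le>n. a i) (?I f) \<union> ((\<Union>i. a i) - (\<Union>i\<le>n. a i)))"
        by (rule finite_measure_mono[OF _ sets.Un[OF s]]) blast
      also have "\<dots> \<le> measure M (sym_diff (\<Union>i\<le>n. a i) (?I f)) + measure M ((\<Union>i. a i) - (\<Union>i\<le>n. a i))"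
        using s by (rule measure_Un_le)
      finally show "\<exists>f. measure M (sym_diff (\<Union>i. a i) (?I f)) < e"
        using f d by (intro exI[of _ f]) linarith
    qed
  qed
  with assms(3) show ?thesis by blast
qed

text \<open>A countable base generates the sigma-algebra, which gives density of its Boolean
  combinations, and it separates points because a metrizable space is Hausdorff.\<close>

lemma sep_prob_standard_borel:
  assumes "prob_space N" "standard_borel N"
  shows "\<exists>C. sep_prob N C"
proof -
  interpret prob_space N by fact
  obtain X where X: "topspace X = space N" "completely_metrizable_space X" "second_countable X"
    "sets N = sigma_sets (topspace X) {U. openin X U}"
    using assms(2) unfolding standard_borel_def by blast
  obtain B where B: "countable B" "\<And>V. V \<in> B \<Longrightarrow> openin X V"
    "\<And>U x. openin X U \<Longrightarrow> x \<in> U \<Longrightarrow> \<exists>V\<in>B. x \<in> V \<and> V \<subseteq> U"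
    using X(3) unfolding second_countable_def by meson
  \<comment> \<open>Adding the empty set makes the base nonempty, so that
    \<open>from_nat_into\<close> has exactly this set as its range.\<close>
  define b where "b = from_nat_into (insert {} B)"
  have rb: "range b = insert {} B"
    unfolding b_def using B(1) by (intro range_from_nat_into) auto
  have bs: "b n \<in> sets N" for n
  proof -
    have "b n \<in> insert {} B" using rb by auto
    then have "openin X (b n)" using B(2) by auto
    then show ?thesis using X(4) by (auto intro: sigma_sets.Basic)
  qed
  have gen: "sets N = sigma_sets (space N) (range b)"
  proof
    show "sigma_sets (space N) (range b) \<subseteq> sets N"
      using bs by (intro sets.sigma_sets_subset) auto
    have "U \<in> sigma_sets (space N) (range b)" if U: "openin X U" for U
    proof -
      have "U = \<Union>{V \<in> B. V \<subseteq> U}" using B(3)[OF U] by blast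
      moreover have "\<Union>{V \<in> B. V \<subseteq> U} \<in> sigma_sets (space N) (range b)"
      proof (rule sigma_sets_UNION)
        show "countable {V \<in> B. V \<subseteq> U}" using B(1) by auto
        show "V \<in> sigma_sets (space N) (range b)" if "V \<in> {V \<in> B. V \<subseteq> U}" for V
          using that rb by (intro sigma_sets.Basic) auto
      qed
      ultimately show ?thesis by simp
    qed
    then show "sets N \<subseteq> sigma_sets (space N) (range b)"
      unfolding X(4) X(1)[symmetric] by (intro sigma_sets_mono) auto
  qed
  define C where "C n = interp (space N) b (from_nat n)" for n
  have rbs: "range b \<subseteq> sets N" using bs by auto
  have "sep_prob N C"
  proof
    show "C i \<in> sets N" for i unfolding C_def by (rule interp_sets[OF rbs])
    show "\<exists>i. (x \<in> C i) \<noteq> (y \<in> C i)" if xy: "x \<in> space N" "y \<in> space N" "x \<noteq> y" for x y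
    proof -
      have "Hausdorff_space X"
        using X(2) completely_metrizable_imp_metrizable_space metrizable_imp_Hausdorff_space by blast
      then obtain U V where UV: "openin X U" "openin X V" "x \<in> U" "y \<in> V" "disjnt U V"
        using xy X(1) unfolding Hausdorff_space_def by metis
      obtain W where W: "W \<in> B" "x \<in> W" "W \<subseteq> U" using B(3)[OF UV(1,3)] by blast
      obtain n where "W = b n" using W(1) rb by (metis insertI2 rangeE)
      then have "C (to_nat (Atom n)) = W" by (simp add: C_def)
      moreover have "y \<notin> W" using W UV by (auto simp: disjnt_def)
      ultimately show ?thesis using W(2) by metis
    qed
    show "\<exists>i. measure N (sym_diff A (C i)) < e" if Ae: "A \<in> sets N" "e > 0" for A e
    proof -
      obtain f where "measure N (sym_diff A (interp (space N) b f)) < e"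
        using interp_dense[OF gen Ae] by blast
      then show ?thesis by (intro exI[of _ "to_nat f"]) (simp add: C_def)
    qed
  qed
  then show ?thesis by blast
qed

text \<open>A set of the completion differs from a measurable set by a null set, so the same
  sequence stays dense.\<close>

lemma sep_prob_completion:
  assumes "sep_prob N C"
  shows "sep_prob (completion N) C"
proof -
  interpret sep_prob N C by fact
  interpret c: prob_space "completion N" by (rule prob_space_completion)
  show ?thesis
  proof
    show "C i \<in> sets (completion N)" for i using C_sets by simp
    show "\<exists>i. (x \<in> C i) \<noteq> (y \<in> C i)"
      if "x \<in> space (completion N)" "y \<in> space (completion N)" "x \<noteq> y" for x y
      using C_sep that by simp
    show "\<exists>i. measure (completion N) (sym_diff A (C i)) < e"
      if A: "A \<in> sets (completion N)" and e: "e > 0" for A e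
    proof -
      let ?A = "main_part N A"
      obtain Z where Z: "Z \<in> null_sets N" "null_part N A \<subseteq> Z" using null_part[OF A] by blast
      have m: "?A \<in> sets N" using A by simp
      have eq: "A = ?A \<union> null_part N A" using A by simp
      obtain i where i: "measure N (sym_diff ?A (C i)) < e" using C_dense[OF m e] by blast
      have s: "sym_diff ?A (C i) \<in> sets N" using m C_sets by auto
      have "measure (completion N) (sym_diff A (C i)) \<le> measure (completion N) (sym_diff ?A (C i) \<union> Z)"
      proof (rule c.finite_measure_mono)
        show "sym_diff A (C i) \<subseteq> sym_diff ?A (C i) \<union> Z" using eq Z(2) by blast
        show "sym_diff ?A (C i) \<union> Z \<in> sets (completion N)" using s Z(1) by auto
      qed
      also have "\<dots> = measure N (sym_diff ?A (C i) \<union> Z)" using s Z(1) by (intro measure_completion) auto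
      also have "\<dots> = measure N (sym_diff ?A (C i))" using s Z(1) by (rule measure_Un_null_set)
      finally show ?thesis using i by (intro exI[of _ i]) linarith
    qed
  qed
qed

lemma sep_prob_standard:
  assumes "standard_prob_space M"
  shows "\<exists>C. sep_prob M C"
  using assms sep_prob_standard_borel sep_prob_completion
  unfolding standard_prob_space_def by metis

section \<open>Cutting sets of an atomless space into prescribed proportions\<close>

context sep_prob
begin

text \<open>A point is a countable intersection of sets \<open>C i\<close> and their complements,
  hence measurable. With positive measure it would be an atom, having only two subsets.\<close>

lemma atomless_point_null:
  assumes "atomless M" "x \<in> space M"
  shows "{x} \<in> sets M" "measure M {x} = 0"
proof -
  define D where "D i = (if x \<in> C i then C i else space M - C i)" for i
  have D: "D i \<in> sets M" for i unfolding D_def using C_sets by auto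
  have "(\<Inter>i. D i) = {x}"
  proof
    show "{x} \<subseteq> (\<Inter>i. D i)" using assms(2) by (auto simp: D_def)
    show "(\<Inter>i. D i) \<subseteq> {x}"
    proof
      fix y assume y: "y \<in> (\<Inter>i. D i)"
      then have "y \<in> space M" using D[THEN sets.sets_into_space, of 0] by blast
      moreover have "(x \<in> C i) = (y \<in> C i)" for i
      proof -
        have "y \<in> D i" using y by blast
        then show ?thesis by (cases "x \<in> C i") (simp_all add: D_def)
      qed
      ultimately show "y \<in> {x}" using C_sep[OF assms(2), of y] by blast
    qed
  qed
  moreover have "(\<Inter>i. D i) \<in> sets M" using D by (intro sets.countable_INT) auto
  ultimately show s: "{x} \<in> sets M" by simp
  show "measure M {x} = 0"
  proof (rule ccontr)
    assume "measure M {x} \<noteq> 0"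
    then have "0 < emeasure M {x}"
      by (simp add: emeasure_eq_measure zero_less_measure_iff)
    then obtain B where B: "B \<in> sets M" "B \<subseteq> {x}" "0 < emeasure M B" "emeasure M B < emeasure M {x}"
      using assms(1) s unfolding atomless_def by blast
    then have "B = {} \<or> B = {x}" by (simp add: subset_singleton_iff)
    then show False using B(3,4) by (elim disjE) simp_all
  qed
qed

fun greedy :: "'a set \<Rightarrow> real \<Rightarrow> nat \<Rightarrow> 'a set \<times> 'a set" where
  "greedy A r 0 = ({}, A)"
| "greedy A r (Suc n) =
    (let (B, D) = greedy A r n in
     if measure M (B \<union> (D \<inter> C n)) \<le> r then (B \<union> (D \<inter> C n), D - C n) else (B, D \<inter> C n))"

text \<open>
  \<open>greedy\<close> bisects \<open>A\<close>: the first set grows, has measure at most \<open>r\<close>, and together with the second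
  it has measure at least \<open>r\<close>.  The second sets shrink to at most one point, which is null.
\<close>

lemma sierpinski:
  assumes atl: "atomless M" and A: "A \<in> sets M" and r: "0 \<le> r" "r \<le> measure M A"
  shows "\<exists>B\<in>sets M. B \<subseteq> A \<and> measure M B = r"
proof -
  define B where "B n = fst (greedy A r n)" for n
  define D where "D n = snd (greedy A r n)" for n
  have BS: "B (Suc n) = (if measure M (B n \<union> (D n \<inter> C n)) \<le> r then B n \<union> (D n \<inter> C n) else B n)"
    and DS: "D (Suc n) = (if measure M (B n \<union> (D n \<inter> C n)) \<le> r then D n - C n else D n \<inter> C n)" for n
    by (simp_all add: B_def D_def case_prod_beta)
  have B0: "B 0 = {}" "D 0 = A" by (simp_all add: B_def D_def)
  have inv: "B n \<in> sets M \<and> D n \<in> sets M \<and> B n \<subseteq> A \<and> D n \<subseteq> A \<and> measure M (B n) \<le> r \<and> r \<le> measure M (B n \<union> D n)" for n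
  proof (induction n)
    case 0
    then show ?case using A r by (simp add: B0)
  next
    case (Suc n)
    have "B n \<union> (D n \<inter> C n) \<union> (D n - C n) = B n \<union> D n" by blast
    moreover have "B n \<union> (D n \<inter> C n) \<in> sets M" "D n - C n \<in> sets M" "D n \<inter> C n \<in> sets M"
      using Suc C_sets[of n] by auto
    ultimately show ?case
      using Suc by (cases "measure M (B n \<union> (D n \<inter> C n)) \<le> r") (auto simp only: BS DS if_True if_False)
  qed
  have incB: "incseq B" by (rule incseq_SucI) (simp add: BS)
  have decBD: "decseq (\<lambda>n. B n \<union> D n)" by (rule decseq_SucI) (auto simp add: BS DS)
  have Bs: "B n \<in> sets M" and Ds: "D n \<in> sets M" and BA: "B n \<subseteq> A"
    and Br: "measure M (B n) \<le> r" and rBD: "r \<le> measure M (B n \<union> D n)" for n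
    using inv[of n] by simp_all
  have Us: "(\<Union>n. B n) \<in> sets M" "(\<Inter>n. D n) \<in> sets M"
    using Bs Ds by (auto intro!: sets.countable_INT)
  have "(\<lambda>n. measure M (B n)) \<longlonglongrightarrow> measure M (\<Union>n. B n)"
    using Bs incB by (intro finite_Lim_measure_incseq) auto
  then have le: "measure M (\<Union>n. B n) \<le> r"
    by (rule LIMSEQ_le_const2) (use Br in blast)
  have "(\<lambda>n. measure M (B n \<union> D n)) \<longlonglongrightarrow> measure M (\<Inter>n. B n \<union> D n)"
    using Bs Ds decBD by (intro finite_Lim_measure_decseq) auto
  then have ge: "r \<le> measure M (\<Inter>n. B n \<union> D n)"
    by (rule LIMSEQ_le_const) (use rBD in blast)
  have D0: "measure M (\<Inter>n. D n) = 0"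
  proof (cases "(\<Inter>n. D n) = {}")
    case True
    then show ?thesis by simp
  next
    case False
    then obtain x where x: "x \<in> (\<Inter>n. D n)" by blast
    have sp: "y \<in> space M" if "y \<in> (\<Inter>n. D n)" for y
      using that Ds[THEN sets.sets_into_space, of 0] by blast
    \<comment> \<open>After step \<open>i\<close> the set \<open>D (Suc i)\<close> lies on one side
      of \<open>C i\<close>, so no \<open>C i\<close> separates two points of the
      intersection.\<close>
    have "y = x" if y: "y \<in> (\<Inter>n. D n)" for y
    proof (rule ccontr)
      assume "y \<noteq> x"
      then obtain i where i: "(y \<in> C i) \<noteq> (x \<in> C i)" using C_sep[OF sp[OF y] sp[OF x]] by blast
      have "y \<in> D (Suc i)" "x \<in> D (Suc i)" using x y by blast+
      then show False using i by (auto simp: DS split: if_splits)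
    qed
    then have "(\<Inter>n. D n) = {x}" using x by blast
    then show ?thesis using atomless_point_null[OF atl sp[OF x]] by simp
  qed
  have "measure M (\<Inter>n. B n \<union> D n) \<le> measure M ((\<Union>n. B n) \<union> (\<Inter>n. D n))"
    using Us by (intro finite_measure_mono sets.Un) auto
  also have "\<dots> \<le> measure M (\<Union>n. B n) + measure M (\<Inter>n. D n)"
    using Us by (rule measure_Un_le)
  finally have "measure M (\<Union>n. B n) = r" using le ge D0 by simp
  moreover have "(\<Union>n. B n) \<subseteq> A" using BA by blast
  ultimately show ?thesis using Us(1) by auto
qed

lemma equal_split:
  assumes atl: "atomless M" and A: "A \<in> sets M"
  shows "\<exists>P. (\<forall>c<Suc m. P c \<in> sets M \<and> measure M (P c) = measure M A / Suc m) \<and>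
    disjoint_family_on P {..<Suc m} \<and> (\<Union>c<Suc m. P c) = A"
  using A
proof (induction m arbitrary: A)
  case 0
  then show ?case by (intro exI[of _ "\<lambda>_. A"]) (auto simp: disjoint_family_on_def)
next
  case (Suc m)
  have "measure M A / Suc (Suc m) \<le> measure M A / 1" by (intro divide_left_mono) auto
  then obtain B where B: "B \<in> sets M" "B \<subseteq> A" "measure M B = measure M A / Suc (Suc m)"
    using sierpinski[OF atl Suc.prems, of "measure M A / Suc (Suc m)"] by auto
  have AB: "A - B \<in> sets M" using B Suc.prems by auto
  obtain P where P: "\<And>c. c < Suc m \<Longrightarrow> P c \<in> sets M" "\<And>c. c < Suc m \<Longrightarrow> measure M (P c) = measure M (A - B) / Suc m"
    "disjoint_family_on P {..<Suc m}" "(\<Union>c<Suc m. P c) = A - B"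
    using Suc.IH[OF AB] by blast
  have mAB: "measure M (A - B) / Suc m = measure M A / Suc (Suc m)"
    using finite_measure_Diff[OF Suc.prems B(1,2)] B(3) by (simp add: field_simps)
  define P' where "P' = P (Suc m := B)"
  have sub: "P c \<subseteq> A - B" if "c < Suc m" for c using that P(4) by blast
  show ?case
  proof (intro exI[of _ P'] conjI allI impI)
    fix c assume c: "c < Suc (Suc m)"
    show "P' c \<in> sets M" "measure M (P' c) = measure M A / Suc (Suc m)"
      using P(1,2)[of c] B mAB c by (cases "c = Suc m"; simp add: P'_def)+
  next
    show "disjoint_family_on P' {..<Suc (Suc m)}"
      unfolding disjoint_family_on_def
    proof (intro ballI impI)
      fix c d assume cd: "c \<in> {..<Suc (Suc m)}" "d \<in> {..<Suc (Suc m)}" "c \<noteq> d"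
      consider "c = Suc m" "d < Suc m" | "d = Suc m" "c < Suc m" | "c < Suc m" "d < Suc m"
        using cd by fastforce
      then show "P' c \<inter> P' d = {}"
      proof cases
        case 1 then show ?thesis using sub[of d] by (auto simp: P'_def)
      next
        case 2 then show ?thesis using sub[of c] by (auto simp: P'_def)
      next
        case 3 then show ?thesis using P(3) cd(3) by (simp add: P'_def disjoint_family_on_def)
      qed
    qed
  next
    have "(\<Union>c<Suc (Suc m). P' c) = B \<union> (\<Union>c<Suc m. P c)"
      unfolding lessThan_Suc[of "Suc m"] by (auto simp: P'_def)
    then show "(\<Union>c<Suc (Suc m). P' c) = A" using P(4) B(2) by auto
  qed
qed

text \<open>To add a set \<open>G\<close>, the parts of \<open>A\<close> inside and outside
  \<open>G\<close> are split separately and corresponding pieces are joined: independence of the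
  earlier sets holds in both parts and adds up, while on \<open>G\<close> only the first part
  counts. Having \<open>space M\<close> in the list carries the equality of the pieces' measures
  through the induction.\<close>

lemma independent_split:
  assumes atl: "atomless M" and F: "finite F" "F \<subseteq> sets M" and A: "A \<in> sets M"
  shows "\<exists>P. (\<forall>c<Suc m. P c \<in> sets M) \<and> disjoint_family_on P {..<Suc m} \<and> (\<Union>c<Suc m. P c) = A \<and>
    (\<forall>E\<in>insert (space M) F. \<forall>c<Suc m. measure M (P c \<inter> E) = measure M (A \<inter> E) / Suc m)"
  using F A
proof (induction F arbitrary: A rule: finite_induct)
  case empty
  obtain P where P: "\<And>c. c < Suc m \<Longrightarrow> P c \<in> sets M" "\<And>c. c < Suc m \<Longrightarrow> measure M (P c) = measure M A / Suc m"
    "disjoint_family_on P {..<Suc m}" "(\<Union>c<Suc m. P c) = A"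
    using equal_split[OF atl empty(2), of m] by blast
  have "P c \<inter> space M = P c" if "c < Suc m" for c
    using P(1)[OF that, THEN sets.sets_into_space] by blast
  moreover have "A \<inter> space M = A" using empty(2)[THEN sets.sets_into_space] by blast
  ultimately have "measure M (P c \<inter> E) = measure M (A \<inter> E) / Suc m"
    if "E \<in> insert (space M) {}" "c < Suc m" for E c
    using that P(2)[OF that(2)] by simp
  then show ?case using P(1,3,4) by blast
next
  case (insert G F)
  have s: "A \<inter> G \<in> sets M" "A - G \<in> sets M" and FM: "F \<subseteq> sets M" using insert.prems by auto
  obtain P where "(\<forall>c<Suc m. P c \<in> sets M) \<and> disjoint_family_on P {..<Suc m} \<and> (\<Union>c<Suc m. P c) = A \<inter> G \<and>
    (\<forall>E\<in>insert (space M) F. \<forall>c<Suc m. measure M (P c \<inter> E) = measure M (A \<inter> G \<inter> E) / Suc m)"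
    using insert.IH[OF FM s(1)] by (elim exE)
  then have P: "\<And>c. c < Suc m \<Longrightarrow> P c \<in> sets M" "disjoint_family_on P {..<Suc m}" "(\<Union>c<Suc m. P c) = A \<inter> G"
    "\<And>E c. E \<in> insert (space M) F \<Longrightarrow> c < Suc m \<Longrightarrow> measure M (P c \<inter> E) = measure M (A \<inter> G \<inter> E) / Suc m"
    by blast+
  obtain Q where "(\<forall>c<Suc m. Q c \<in> sets M) \<and> disjoint_family_on Q {..<Suc m} \<and> (\<Union>c<Suc m. Q c) = A - G \<and>
    (\<forall>E\<in>insert (space M) F. \<forall>c<Suc m. measure M (Q c \<inter> E) = measure M ((A - G) \<inter> E) / Suc m)"
    using insert.IH[OF FM s(2)] by (elim exE)
  then have Q: "\<And>c. c < Suc m \<Longrightarrow> Q c \<in> sets M" "disjoint_family_on Q {..<Suc m}" "(\<Union>c<Suc m. Q c) = A - G"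
    "\<And>E c. E \<in> insert (space M) F \<Longrightarrow> c < Suc m \<Longrightarrow> measure M (Q c \<inter> E) = measure M ((A - G) \<inter> E) / Suc m"
    by blast+
  have PG: "P c \<subseteq> A \<inter> G" if "c < Suc m" for c using that P(3) by blast
  have QG: "Q c \<subseteq> A - G" if "c < Suc m" for c using that Q(3) by blast
  have old: "measure M ((P c \<union> Q c) \<inter> E) = measure M (A \<inter> E) / Suc m"
    if E: "E \<in> insert (space M) F" and c: "c < Suc m" for E c
  proof -
    have Es: "E \<in> sets M" using E FM by auto
    have "measure M ((P c \<union> Q c) \<inter> E) = measure M ((P c \<inter> E) \<union> (Q c \<inter> E))"
      by (simp add: Int_Un_distrib2)
    also have "\<dots> = measure M (P c \<inter> E) + measure M (Q c \<inter> E)"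
    proof (rule finite_measure_Union)
      show "P c \<inter> E \<inter> (Q c \<inter> E) = {}" using PG[OF c] QG[OF c] by blast
    qed (intro sets.Int P(1)[OF c] Q(1)[OF c] Es)+
    also have "\<dots> = (measure M (A \<inter> G \<inter> E) + measure M ((A - G) \<inter> E)) / Suc m"
      unfolding P(4)[OF E c] Q(4)[OF E c] by (simp add: add_divide_distrib)
    also have "measure M (A \<inter> G \<inter> E) + measure M ((A - G) \<inter> E) = measure M (A \<inter> G \<inter> E \<union> (A - G) \<inter> E)"
      by (rule finite_measure_Union[symmetric]) (use s Es in blast)+
    also have "A \<inter> G \<inter> E \<union> (A - G) \<inter> E = A \<inter> E" by blast
    finally show ?thesis .
  qed
  have new: "measure M ((P c \<union> Q c) \<inter> G) = measure M (A \<inter> G) / Suc m" if c: "c < Suc m" for c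
  proof -
    have sp: "P c \<inter> space M = P c" "A \<inter> G \<inter> space M = A \<inter> G"
      using P(1)[OF c, THEN sets.sets_into_space] s(1)[THEN sets.sets_into_space] by auto
    have "(P c \<union> Q c) \<inter> G = P c" using PG[OF c] QG[OF c] by blast
    then show ?thesis using P(4)[of "space M" c] c sp by simp
  qed
  show ?case
  proof (intro exI[of _ "\<lambda>c. P c \<union> Q c"] conjI allI impI ballI)
    show "P c \<union> Q c \<in> sets M" if "c < Suc m" for c using P(1) Q(1) that by blast
    show "disjoint_family_on (\<lambda>c. P c \<union> Q c) {..<Suc m}"
      unfolding disjoint_family_on_def
    proof (intro ballI impI)
      fix c d assume cd: "c \<in> {..<Suc m}" "d \<in> {..<Suc m}" "c \<noteq> d"
      then have "P c \<inter> P d = {}" "Q c \<inter> Q d = {}"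
        using P(2) Q(2) by (auto simp: disjoint_family_on_def)
      moreover have "P c \<subseteq> G" "P d \<subseteq> G" "Q c \<inter> G = {}" "Q d \<inter> G = {}"
        using PG[of c] PG[of d] QG[of c] QG[of d] cd by auto
      ultimately show "(P c \<union> Q c) \<inter> (P d \<union> Q d) = {}" by blast
    qed
    have "(\<Union>c<Suc m. P c \<union> Q c) = (\<Union>c<Suc m. P c) \<union> (\<Union>c<Suc m. Q c)" by blast
    then show "(\<Union>c<Suc m. P c \<union> Q c) = A" unfolding P(3) Q(3) by blast
    show "measure M ((P c \<union> Q c) \<inter> E) = measure M (A \<inter> E) / Suc m"
      if "E \<in> insert (space M) (insert G F)" "c < Suc m" for E c
      using that old new by auto
  qed
qed

end

section \<open>Ergodic automorphisms and the mean ergodic theorem\<close>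

text \<open>Each stage of the construction is again an instance, with the same \<open>M\<close> and
  \<open>C\<close> and a new map, so that a step proved here can be iterated.\<close>

locale erg_aut = sep_prob M C for M :: "'a measure" and C +
  fixes S :: "'a \<Rightarrow> 'a"
  assumes aut: "aut M S" and erg: "ergodic M S" and atl: "atomless M"
begin

lemma bijS: "bij S"
  using autD(1)[OF aut] .

lemma ipowS_add: "ipow S (m + n) x = ipow S m (ipow S n x)"
  by (rule ipow_add[OF bijS])

lemma ipowS_space [simp]: "ipow S n x \<in> space M \<longleftrightarrow> x \<in> space M"
  by (rule aut_space[OF aut_ipow[OF aut]])

lemma ipowS_measurable [measurable]: "ipow S n \<in> measurable M M"
  by (rule autD(2)[OF aut_ipow[OF aut]])

lemma ipowS_inj: "ipow S n x = ipow S n y \<longleftrightarrow> x = y"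
  using bij_ipow[OF bijS, of n] by (simp add: bij_is_inj inj_eq)

lemma invariant_01:
  assumes A: "A \<in> sets M" and inv: "\<And>x. x \<in> space M \<Longrightarrow> S x \<in> A \<longleftrightarrow> x \<in> A"
  shows "measure M A = 0 \<or> measure M A = 1"
proof -
  have sp: "A \<subseteq> space M" by (rule sets.sets_into_space[OF A])
  have "S ` A = A"
  proof
    show "S ` A \<subseteq> A" using inv sp by auto
    show "A \<subseteq> S ` A"
    proof
      fix x assume x: "x \<in> A"
      let ?y = "inv S x"
      have y: "S ?y = x" by (rule autD(5)[OF aut])
      then have "?y \<in> space M" using aut_space[OF aut, of ?y] x sp by auto
      then have "?y \<in> A" using inv[of ?y] y x by simp
      then show "x \<in> S ` A" using y by (metis imageI)
    qed
  qed
  then show ?thesis using erg A unfolding ergodic_def by blast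
qed

text \<open>Birkhoff sums, kept undivided by \<open>n\<close> so that they are additive over
  consecutive orbit segments.\<close>

definition bsum :: "('a \<Rightarrow> real) \<Rightarrow> nat \<Rightarrow> 'a \<Rightarrow> real" where
  "bsum f n x = (\<Sum>i<n. f ((S ^^ i) x))"

lemma bsum_split: "bsum f (m + n) x = bsum f m x + bsum f n ((S ^^ m) x)"
proof -
  have "bsum f (m + n) x = (\<Sum>i\<in>{..<m}. f ((S ^^ i) x)) + (\<Sum>i\<in>{m..<m+n}. f ((S ^^ i) x))"
    unfolding bsum_def by (subst sum.union_disjoint[symmetric]) (auto intro!: sum.cong)
  also have "(\<Sum>i\<in>{m..<m+n}. f ((S ^^ i) x)) = (\<Sum>i\<in>{0..<n}. f ((S ^^ (i + m)) x))"
    using sum.shift_bounds_nat_ivl[of "\<lambda>i. f ((S ^^ i) x)" 0 m n] by (simp add: add.commute)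
  also have "\<dots> = bsum f n ((S ^^ m) x)"
    unfolding bsum_def by (simp add: funpow_add lessThan_atLeast0)
  finally show ?thesis by (simp add: bsum_def)
qed

lemma funpowS_measurable [measurable]: "S ^^ n \<in> measurable M M"
  by (rule autD(2)[OF aut_funpow[OF aut]])

lemma funpowS_space: "(S ^^ n) x \<in> space M \<longleftrightarrow> x \<in> space M"
  by (rule aut_space[OF aut_funpow[OF aut]])

lemma bsum_measurable [measurable]:
  assumes [measurable]: "f \<in> borel_measurable M"
  shows "bsum f n \<in> borel_measurable M"
proof -
  have "(\<lambda>x. \<Sum>i<n. f ((S ^^ i) x)) \<in> borel_measurable M"
    by (intro borel_measurable_sum measurable_compose[OF funpowS_measurable assms])
  then show ?thesis by (simp add: bsum_def[abs_def])
qed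

lemma bsum_le:
  assumes "\<And>x. f x \<le> (b::real)"
  shows "bsum f n x \<le> n * b"
  unfolding bsum_def using sum_bounded_above[of "{..<n}" "\<lambda>i. f ((S ^^ i) x)" b] assms by simp

lemma bsum_mono:
  assumes "\<And>x. f x \<le> (g x::real)"
  shows "bsum f n x \<le> bsum g n x"
  unfolding bsum_def by (intro sum_mono assms)

lemma integral_bsum:
  assumes "integrable M f"
  shows "(\<integral>x. bsum f n x \<partial>M) = n * (\<integral>x. f x \<partial>M)" "integrable M (bsum f n)"
proof -
  have i: "integrable M (\<lambda>x. f ((S ^^ i) x))" for i
    by (rule aut_integrable[OF aut_funpow[OF aut] assms])
  have e: "(\<integral>x. f ((S ^^ i) x) \<partial>M) = (\<integral>x. f x \<partial>M)" for i
    by (rule aut_integral[OF aut_funpow[OF aut]]) (use assms in auto)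
  have "(\<integral>x. (\<Sum>j<n. f ((S ^^ j) x)) \<partial>M) = (\<Sum>j<n. \<integral>x. f ((S ^^ j) x) \<partial>M)"
    by (rule Bochner_Integration.integral_sum[OF i])
  then show "(\<integral>x. bsum f n x \<partial>M) = n * (\<integral>x. f x \<partial>M)" by (simp add: bsum_def e)
  have "integrable M (\<lambda>x. \<Sum>j<n. f ((S ^^ j) x))" by (intro Bochner_Integration.integrable_sum i)
  then show "integrable M (bsum f n)" by (simp add: bsum_def[abs_def])
qed

text \<open>
  The argument of Katznelson and Weiss: an orbit segment is tiled by blocks of length at most \<open>N\<close>
  with average above \<open>c\<close>; at points where no such block starts, \<open>f\<close> is raised by 1.
\<close>

lemma tiling_bound:
  assumes f: "\<And>x. 0 \<le> f x" and c: "0 \<le> c" "c \<le> (1::real)"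
    and Bad: "\<And>x. x \<in> space M \<Longrightarrow> x \<notin> Bad \<Longrightarrow> \<exists>n\<in>{1..N}. c * n < bsum f n x"
    and x: "x \<in> space M"
  shows "c * (real L - real N) \<le> bsum (\<lambda>x. f x + indicator Bad x) L x"
  using x
proof (induction L arbitrary: x rule: less_induct)
  case (less L)
  let ?g = "\<lambda>x. f x + indicator Bad x"
  have g0: "0 \<le> ?g x" for x using f[of x] by simp
  show ?case
  proof (cases "L \<le> N")
    case True
    then have "c * (real L - real N) \<le> 0" using c by (simp add: mult_nonneg_nonpos)
    also have "0 \<le> bsum ?g L x" unfolding bsum_def using g0 by (intro sum_nonneg)
    finally show ?thesis .
  next
    case False
    obtain n where n: "1 \<le> n" "n \<le> L" "c * n \<le> bsum ?g n x"
    proof (cases "x \<in> Bad")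
      case True
      have "c * real 1 \<le> bsum ?g 1 x" using True c f[of x] by (simp add: bsum_def)
      then show ?thesis using that[of 1] False by simp
    next
      case nb: False
      obtain n where n: "n \<in> {1..N}" "c * n < bsum f n x" using Bad[OF less.prems nb] by blast
      moreover have "bsum f n x \<le> bsum ?g n x" by (rule bsum_mono) simp
      ultimately show ?thesis using that[of n] False by auto
    qed
    have "c * (real (L - n) - real N) \<le> bsum ?g (L - n) ((S ^^ n) x)"
      by (rule less.IH) (use n less.prems funpowS_space in auto)
    moreover have "bsum ?g L x = bsum ?g n x + bsum ?g (L - n) ((S ^^ n) x)"
      using bsum_split[of ?g n "L - n" x] n by simp
    moreover have "c * (real L - real N) = c * n + c * (real (L - n) - real N)"
      using n by (simp add: of_nat_diff algebra_simps)
    ultimately show ?thesis using n(3) by linarith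
  qed
qed

text \<open>The tiling bound is integrated and divided by \<open>L\<close>. Letting \<open>L\<close>
  grow removes the loss of \<open>N\<close> points at the end of the segment; letting
  \<open>N\<close> grow afterwards makes the measure of \<open>Bad N\<close> vanish, since almost
  every point starts some good block.\<close>

lemma maximal_inequality:
  assumes [measurable]: "f \<in> borel_measurable M" and f: "\<And>x. 0 \<le> f x" "\<And>x. f x \<le> 1"
    and c: "0 \<le> c" "c \<le> (1::real)" and ae: "AE x in M. \<exists>n\<ge>1. c * real n < bsum f n x"
  shows "c \<le> (\<integral>x. f x \<partial>M)"
proof -
  define Bad where "Bad N = {x \<in> space M. \<forall>n\<in>{1..N}. bsum f n x \<le> c * real n}" for N :: nat
  have Bad [measurable]: "Bad N \<in> sets M" for N unfolding Bad_def by measurable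
  have int_f: "integrable M f"
    using f by (intro integrable_const_bound[where B = 1]) auto
  have step: "c \<le> (\<integral>x. f x \<partial>M) + measure M (Bad N)" for N
  proof -
    let ?g = "\<lambda>x. f x + indicator (Bad N) x"
    have int_B: "integrable M (indicator (Bad N) :: 'a \<Rightarrow> real)"
      by (rule integrable_real_indicator) (auto simp: less_top[symmetric])
    have int_g: "integrable M ?g" by (rule Bochner_Integration.integrable_add[OF int_f int_B])
    have g: "(\<integral>x. ?g x \<partial>M) = (\<integral>x. f x \<partial>M) + measure M (Bad N)"
      using sets.sets_into_space[OF Bad[of N]]
      by (simp add: Bochner_Integration.integral_add[OF int_f int_B] Int_absorb2)
    have "c * (1 - real N / real L) \<le> (\<integral>x. ?g x \<partial>M)" if L: "L \<ge> 1" for L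
    proof -
      have "c * (real L - real N) \<le> bsum ?g L x" if "x \<in> space M" for x
        by (rule tiling_bound[OF f(1) c _ that]) (auto simp: Bad_def not_le)
      then have "(\<integral>x. c * (real L - real N) \<partial>M) \<le> (\<integral>x. bsum ?g L x \<partial>M)"
        by (intro integral_mono integral_bsum(2)[OF int_g]) auto
      then have "c * (real L - real N) \<le> L * (\<integral>x. ?g x \<partial>M)"
        using integral_bsum(1)[OF int_g] by (simp add: prob_space)
      then show ?thesis using L by (simp add: field_simps)
    qed
    then have *: "\<forall>\<^sub>F L in sequentially. c * (1 - real N / real L) \<le> (\<integral>x. ?g x \<partial>M)"
      by (auto simp: eventually_sequentially)
    have "(\<lambda>L. c * (1 - real N / real L)) \<longlonglongrightarrow> c * (1 - 0)"
      by (intro tendsto_intros lim_const_over_n)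
    from tendsto_upperbound[OF this *] show ?thesis using g by simp
  qed
  have "(\<lambda>N. measure M (Bad N)) \<longlonglongrightarrow> measure M (\<Inter>N. Bad N)"
    by (intro finite_Lim_measure_decseq) (auto simp: decseq_def Bad_def)
  moreover have "measure M (\<Inter>N. Bad N) = 0"
  proof -
    have "AE x in M. x \<notin> (\<Inter>N. Bad N)"
      using ae
    proof eventually_elim
      case (elim x)
      then obtain n where n: "n \<ge> 1" "c * real n < bsum f n x" by blast
      then have "x \<notin> Bad n" by (auto simp: Bad_def not_le intro!: bexI[of _ n])
      then show ?case by blast
    qed
    moreover have "(\<Inter>N. Bad N) \<in> sets M" by (intro sets.countable_INT) auto
    ultimately show ?thesis by (subst (asm) AE_iff_measurable[of "\<Inter>N. Bad N"]) (auto simp: measure_def Bad_def)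
  qed
  ultimately have "(\<lambda>N. (\<integral>x. f x \<partial>M) + measure M (Bad N)) \<longlonglongrightarrow> (\<integral>x. f x \<partial>M) + 0"
    by (intro tendsto_intros) simp
  then have "c \<le> (\<integral>x. f x \<partial>M) + 0"
    by (rule LIMSEQ_le_const) (use step in blast)
  then show ?thesis by simp
qed

text \<open>The sums at \<open>x\<close> and at \<open>S x\<close> differ by two boundary terms,
  which are bounded and vanish after division by \<open>n\<close>.\<close>

lemma limsup_bsum_invariant:
  assumes f: "\<And>x. \<bar>f x\<bar> \<le> (1::real)"
  shows "limsup (\<lambda>n. ereal (bsum f n (S x) / n)) = limsup (\<lambda>n. ereal (bsum f n x / n))"
proof -
  define u where "u n = bsum f n (S x) / n - bsum f n x / n" for n :: nat
  have "bsum f n (S x) - bsum f n x = f ((S ^^ n) x) - f x" for n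
    using bsum_split[of f n 1 x] bsum_split[of f 1 n x] by (simp add: bsum_def)
  then have u: "u n = (f ((S ^^ n) x) - f x) / n" for n by (simp add: u_def diff_divide_distrib[symmetric])
  have b: "\<bar>f y - f x\<bar> \<le> 2" for y using f[of y] f[of x] by linarith
  have "\<bar>u n\<bar> \<le> 2 / n" for n
    unfolding u abs_divide using b by (simp add: divide_right_mono)
  then have "u \<longlonglongrightarrow> 0"
    by (intro Lim_null_comparison[OF _ lim_const_over_n[of 2]]) auto
  then have "limsup (\<lambda>n. ereal (u n) + ereal (bsum f n x / n)) = 0 + limsup (\<lambda>n. ereal (bsum f n x / n))"
    by (intro ereal_limsup_lim_add) (auto simp: zero_ereal_def)
  then show ?thesis by (simp add: u_def)
qed

text \<open>The set where the upper average exceeds the mean by \<open>e / 2\<close> is invariant,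
  hence null or conull; being conull would contradict the maximal inequality.\<close>

lemma bsum_upper:
  assumes [measurable]: "f \<in> borel_measurable M" and f: "\<And>x. 0 \<le> f x" "\<And>x. f x \<le> 1" and e: "e > 0"
  shows "AE x in M. \<forall>\<^sub>F n in sequentially. bsum f n x / n < (\<integral>x. f x \<partial>M) + e"
proof -
  define c where "c = (\<integral>x. f x \<partial>M) + e / 2"
  have c0: "0 \<le> c" unfolding c_def using f e by (intro add_nonneg_nonneg integral_nonneg_AE) auto
  define E where "E = {x \<in> space M. ereal c < limsup (\<lambda>n. ereal (bsum f n x / n))}"
  have E: "E \<in> sets M" unfolding E_def by measurable
  have fa: "\<bar>f x\<bar> \<le> 1" for x using f[of x] by simp
  have "S x \<in> E \<longleftrightarrow> x \<in> E" if "x \<in> space M" for x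
    using that limsup_bsum_invariant[OF fa] aut_space[OF aut, of x] by (simp add: E_def)
  then have "measure M E = 0 \<or> measure M E = 1" by (rule invariant_01[OF E])
  moreover have "measure M E \<noteq> 1"
  proof
    assume E1: "measure M E = 1"
    have ex: "\<exists>n\<ge>1. c * real n < bsum f n x" if "x \<in> E" for x
    proof (rule ccontr)
      assume "\<not> ?thesis"
      then have "bsum f n x / n \<le> c" if "n \<ge> 1" for n using that by (force simp: field_simps not_less)
      then have "\<forall>\<^sub>F n in sequentially. ereal (bsum f n x / n) \<le> ereal c"
        by (auto simp: eventually_sequentially)
      then have "limsup (\<lambda>n. ereal (bsum f n x / n)) \<le> ereal c" by (rule Limsup_bounded)
      then show False using \<open>x \<in> E\<close> by (auto simp: E_def dest: leD)
    qed
    have ae: "AE x in M. x \<in> E" using E1 E by (simp add: AE_in_set_eq_1)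
    \<comment> \<open>The maximal inequality asks for \<open>c\<close> to be at most 1. One point of
      \<open>E\<close> shows this, since averages of \<open>f\<close> never exceed 1.\<close>
    have "E \<noteq> {}" using E1 by auto
    then obtain x n where xn: "n \<ge> 1" "c * real n < bsum f n x" using ex by blast
    have "bsum f n x \<le> real n * 1" by (rule bsum_le[OF f(2)])
    then have "c * n < 1 * n" using xn by linarith
    with xn(1) have "c \<le> 1" by (simp add: mult_less_cancel_right)
    then have "c \<le> (\<integral>x. f x \<partial>M)"
      by (intro maximal_inequality[OF assms(1) f c0]) (use ae ex in \<open>auto elim: AE_mp\<close>)
    then show False using e by (simp add: c_def)
  qed
  ultimately have "measure M E = 0" by blast
  then have "AE x in M. x \<notin> E" using E by (intro AE_not_in) (simp add: null_setsI emeasure_eq_measure)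
  with AE_space show ?thesis
  proof eventually_elim
    case (elim x)
    then have "limsup (\<lambda>n. ereal (bsum f n x / n)) \<le> ereal c" by (simp add: E_def not_less)
    also have "\<dots> < ereal ((\<integral>x. f x \<partial>M) + e)" using e by (simp add: c_def)
    finally show ?case using Limsup_lessD by fastforce
  qed
qed

text \<open>Upper bounds for the averages of \<open>A\<close> and of its complement together give
  pointwise convergence, and dominated convergence turns this into convergence in L^1.\<close>

lemma mean_ergodic:
  assumes A: "A \<in> sets M"
  shows "(\<lambda>n. \<integral>x. \<bar>bsum (indicator A) n x / n - measure M A\<bar> \<partial>M) \<longlonglongrightarrow> 0"
proof -
  note [measurable] = A
  let ?a = "\<lambda>n x. bsum (indicator A) n x / n"
  have ub: "AE x in M. \<forall>k. \<forall>\<^sub>F n in sequentially. ?a n x < measure M A + inverse (real (Suc k))"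
  proof (subst AE_all_countable, rule allI)
    show "AE x in M. \<forall>\<^sub>F n in sequentially. ?a n x < measure M A + inverse (real (Suc k))" for k
      using bsum_upper[of "indicator A" "inverse (real (Suc k))"] A by simp
  qed
  have cint: "(\<integral>x. indicator (space M - A) x \<partial>M) = 1 - measure M A"
    using A by (simp add: prob_compl)
  have lb: "AE x in M. \<forall>k. \<forall>\<^sub>F n in sequentially.
      bsum (indicator (space M - A)) n x / n < 1 - measure M A + inverse (real (Suc k))"
  proof (subst AE_all_countable, rule allI)
    show "AE x in M. \<forall>\<^sub>F n in sequentially.
        bsum (indicator (space M - A)) n x / n < 1 - measure M A + inverse (real (Suc k))" for k
      using bsum_upper[of "indicator (space M - A)" "inverse (real (Suc k))"] A cint by simp
  qed
  have comp: "bsum (indicator (space M - A)) n x = n - bsum (indicator A) n x" if "x \<in> space M" for n x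
  proof -
    have "bsum (indicator (space M - A)) n x = (\<Sum>i<n. 1 - indicator A ((S ^^ i) x))"
      unfolding bsum_def by (intro sum.cong refl) (use funpowS_space that in \<open>auto simp: indicator_def\<close>)
    then show ?thesis by (simp add: bsum_def sum_subtractf)
  qed
  have conv: "AE x in M. (\<lambda>n. \<bar>?a n x - measure M A\<bar>) \<longlonglongrightarrow> 0"
    using ub lb AE_space
  proof eventually_elim
    case (elim x)
    have "(\<lambda>n. ?a n x) \<longlonglongrightarrow> measure M A"
    proof (rule LIMSEQ_I)
      fix r :: real assume "r > 0"
      then obtain k where k: "inverse (real (Suc k)) < r" using reals_Archimedean by blast
      have "\<forall>\<^sub>F n in sequentially. ?a n x < measure M A + inverse (real (Suc k)) \<and>
        bsum (indicator (space M - A)) n x / n < 1 - measure M A + inverse (real (Suc k)) \<and> n \<ge> 1"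
        using elim(1,2) eventually_ge_at_top[of 1] by (intro eventually_conj) blast+
      then obtain N where N: "\<And>n. n \<ge> N \<Longrightarrow> ?a n x < measure M A + inverse (real (Suc k)) \<and>
        bsum (indicator (space M - A)) n x / n < 1 - measure M A + inverse (real (Suc k)) \<and> n \<ge> 1"
        unfolding eventually_sequentially by blast
      have "norm (?a n x - measure M A) < r" if "n \<ge> N" for n
      proof -
        have "bsum (indicator (space M - A)) n x / n = 1 - ?a n x"
          using N[OF that] comp[OF elim(3)] by (simp add: diff_divide_distrib)
        then show ?thesis using N[OF that] k by (auto simp: abs_if)
      qed
      then show "\<exists>no. \<forall>n\<ge>no. norm (?a n x - measure M A) < r" by blast
    qed
    then have "(\<lambda>n. \<bar>?a n x - measure M A\<bar>) \<longlonglongrightarrow> \<bar>measure M A - measure M A\<bar>" by (intro tendsto_intros)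
    then show ?case by simp
  qed
  have "(\<lambda>n. \<integral>x. \<bar>?a n x - measure M A\<bar> \<partial>M) \<longlonglongrightarrow> (\<integral>x. 0 \<partial>M)"
  proof (rule integral_dominated_convergence[where w = "\<lambda>_. 2"])
    show "AE x in M. norm \<bar>?a n x - measure M A\<bar> \<le> 2" for n
    proof (rule AE_I2)
      fix x
      have "bsum (indicator A) n x \<le> real n * 1" by (rule bsum_le) (auto simp: indicator_def)
      then have "?a n x \<le> 1" by (simp add: divide_le_eq)
      moreover have "0 \<le> ?a n x" unfolding bsum_def by (intro divide_nonneg_nonneg sum_nonneg) auto
      moreover have "0 \<le> measure M A" "measure M A \<le> 1" by auto
      ultimately show "norm \<bar>?a n x - measure M A\<bar> \<le> 2"
        by (simp only: real_norm_def abs_abs abs_le_iff) linarith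
    qed
  qed (use conv in auto)
  then show ?thesis by simp
qed

section \<open>Freeness, recurrence and the Rokhlin lemma\<close>

text \<open>The points of period \<open>p\<close> form an invariant set. If it had full measure, the
  \<open>p\<close> translates of a subset of measure \<open>1 / (2 * p)\<close> would form an
  invariant set of positive measure at most \<open>1 / 2\<close>, against ergodicity.\<close>

lemma free:
  assumes "n \<noteq> 0"
  shows "AE x in M. ipow S n x \<noteq> x"
proof -
  define p where "p = nat \<bar>n\<bar>"
  have p: "p > 0" using assms by (simp add: p_def)
  define E where "E = {x \<in> space M. ipow S (int p) x = x}"
  have E: "E \<in> sets M" unfolding E_def
    using eq_set_measurable[OF ipowS_measurable[of "int p"] measurable_ident] by simp
  have comm: "ipow S i (ipow S j x) = ipow S j (ipow S i x)" for i j x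
    using ipowS_add[of i j x] ipowS_add[of j i x] by (simp add: add.commute)
  have "measure M E = 0 \<or> measure M E = 1"
  proof (rule invariant_01[OF E])
    fix x assume "x \<in> space M"
    have "ipow S (int p) (ipow S 1 x) = ipow S 1 x \<longleftrightarrow> ipow S 1 (ipow S (int p) x) = ipow S 1 x"
      by (simp only: comm[of "int p" 1])
    also have "\<dots> \<longleftrightarrow> ipow S (int p) x = x" by (rule ipowS_inj)
    finally have "ipow S (int p) (S x) = S x \<longleftrightarrow> ipow S (int p) x = x" by simp
    then show "S x \<in> E \<longleftrightarrow> x \<in> E" using aut_space[OF aut] by (simp add: E_def)
  qed
  moreover have "measure M E \<noteq> 1"
  proof
    assume "measure M E = 1"
    then obtain B where B: "B \<in> sets M" "B \<subseteq> E" "measure M B = 1 / (2 * real p)"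
      using sierpinski[OF atl E, of "1 / (2 * real p)"] p by (auto simp: field_simps)
    define W where "W = (\<Union>k<p. ipow S (int k) ` B)"
    have W: "W \<in> sets M" unfolding W_def using aut_image(1)[OF aut_ipow[OF aut] B(1)] by auto
    have Sb: "ipow S (int p) b = b" if "b \<in> B" for b using that B(2) by (auto simp: E_def)
    have "measure M W = 0 \<or> measure M W = 1"
    proof (rule invariant_01[OF W], rule iffI)
      fix x assume "S x \<in> W"
      then obtain k b where kb: "k < p" "b \<in> B" "S x = ipow S (int k) b" by (auto simp: W_def)
      \<comment> \<open>The predecessor of \<open>k\<close> in a cycle of length \<open>p\<close>:
        level 0 follows level \<open>p - 1\<close>, because the power \<open>p\<close> of
        \<open>S\<close> fixes \<open>B\<close> pointwise.\<close>
      define j where "j = (if k = 0 then p - 1 else k - 1)"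
      have "ipow S 1 x = ipow S 1 (ipow S (int j) b)"
      proof (cases "k = 0")
        case True
        then have "ipow S 1 (ipow S (int j) b) = b"
          using Sb[OF kb(2)] p ipowS_add[of 1 "int j" b] by (simp add: j_def of_nat_diff)
        then show ?thesis using kb True by simp
      next
        case False
        then show ?thesis using kb ipowS_add[of 1 "int j" b] by (simp add: j_def of_nat_diff)
      qed
      then have "x = ipow S (int j) b" by (simp only: ipowS_inj)
      moreover have "j < p" using kb(1) p by (auto simp: j_def)
      ultimately show "x \<in> W" using kb(2) by (auto simp: W_def)
    next
      fix x assume "x \<in> W"
      then obtain k b where kb: "k < p" "b \<in> B" "x = ipow S (int k) b" by (auto simp: W_def)
      have s: "S x = ipow S (int (Suc k)) b" using kb(3) ipowS_add[of 1 "int k" b] by simp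
      show "S x \<in> W"
      proof (cases "Suc k = p")
        case True
        then have "S x = ipow S (int 0) b" using s Sb[OF kb(2)] by simp
        then show ?thesis using kb(2) p unfolding W_def by blast
      next
        case False
        then have "Suc k < p" using kb(1) by simp
        then show ?thesis using kb(2) s unfolding W_def by blast
      qed
    qed
    moreover have "measure M W \<le> 1 / 2"
    proof -
      have "measure M W \<le> (\<Sum>k<p. measure M (ipow S (int k) ` B))"
        unfolding W_def using aut_image(1)[OF aut_ipow[OF aut] B(1)]
        by (intro finite_measure_subadditive_finite) auto
      also have "\<dots> = p * measure M B" using aut_image(3)[OF aut_ipow[OF aut] B(1)] by simp
      also have "\<dots> = 1 / 2" using B(3) p by simp
      finally show ?thesis .
    qed
    moreover have "measure M B \<le> measure M W"
    proof (rule finite_measure_mono[OF _ W])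
      show "B \<subseteq> W" unfolding W_def using p by (intro subsetI UN_I[of 0]) auto
    qed
    ultimately show False using B(3) p by (simp add: divide_le_eq)
  qed
  ultimately have "measure M E = 0" by blast
  then have "AE x in M. x \<notin> E" using E by (intro AE_not_in) (simp add: null_setsI emeasure_eq_measure)
  with AE_space show ?thesis
  proof eventually_elim
    case (elim x)
    show ?case
    proof
      assume nx: "ipow S n x = x"
      then have "ipow S (- n) x = x" using ipow_cancel(2)[OF bijS, of n x] by simp
      then have "ipow S (int p) x = x" using nx by (cases "n \<ge> 0") (simp_all add: p_def)
      then show False using elim by (simp add: E_def)
    qed
  qed
qed

text \<open>The set of points whose past meets \<open>A\<close> is only mapped into itself, so
  ergodicity does not apply directly. Its preimages under the powers of \<open>S\<close> increase
  and all have the same measure; their union is invariant, of positive measure, and therefore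
  conull.\<close>

lemma recurrent_past:
  assumes A: "A \<in> sets M" "measure M A > 0"
  shows "{x \<in> space M. \<exists>k::nat. ipow S (- int k) x \<in> A} \<in> sets M" (is "?W \<in> _")
    and "measure M {x \<in> space M. \<exists>k::nat. ipow S (- int k) x \<in> A} = 1"
proof -
  note [measurable] = A(1)
  show W: "?W \<in> sets M" by measurable
  have SW: "S x \<in> ?W" if x: "x \<in> ?W" for x
  proof -
    obtain k :: nat where k: "ipow S (- int k) x \<in> A" using x by blast
    have "ipow S (- int (Suc k)) (ipow S 1 x) = ipow S (- int k) x"
      unfolding ipowS_add[symmetric] by simp
    then show ?thesis using k x aut_space[OF aut, of x] by (auto intro!: exI[of _ "Suc k"])
  qed
  define G where "G n = ipow S (int n) -` ?W" for n
  have G: "G n \<in> sets M" "measure M (G n) = measure M ?W" for n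
    unfolding G_def using aut_vimage[OF aut_ipow[OF aut] W] by simp_all
  have inc: "incseq G"
  proof (rule incseq_SucI, rule subsetI)
    fix n x assume "x \<in> G n"
    then have "S (ipow S (int n) x) \<in> ?W" using SW by (simp add: G_def)
    then have "ipow S (int (Suc n)) x \<in> ?W" using ipowS_add[of 1 "int n" x] by simp
    then show "x \<in> G (Suc n)" unfolding G_def by (rule vimageI2)
  qed
  have UG: "(\<Union>n. G n) \<in> sets M" using G by auto
  have "(\<lambda>n. measure M (G n)) \<longlonglongrightarrow> measure M (\<Union>n. G n)"
    using G inc by (intro finite_Lim_measure_incseq) auto
  then have m: "measure M (\<Union>n. G n) = measure M ?W"
    unfolding G(2) by (simp add: LIMSEQ_const_iff)
  have "measure M (\<Union>n. G n) = 0 \<or> measure M (\<Union>n. G n) = 1"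
  proof (rule invariant_01[OF UG], rule iffI)
    fix x assume "S x \<in> (\<Union>n. G n)"
    then obtain n where "ipow S (int n) (ipow S 1 x) \<in> ?W" by (auto simp: G_def)
    then have "x \<in> G (Suc n)" unfolding ipowS_add[symmetric] G_def by (simp add: add.commute)
    then show "x \<in> (\<Union>n. G n)" by blast
  next
    fix x assume "x \<in> (\<Union>n. G n)"
    then obtain n where "x \<in> G n" by blast
    then have "x \<in> G (Suc n)" using inc by (auto simp: incseq_Suc_iff)
    then have "ipow S (int n + 1) x \<in> ?W" by (simp add: G_def add.commute)
    then have "ipow S (int n) (S x) \<in> ?W" unfolding ipowS_add by simp
    then have "S x \<in> G n" unfolding G_def by blast
    then show "S x \<in> (\<Union>n. G n)" by blast
  qed
  moreover have "measure M A \<le> measure M ?W"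
  proof (rule finite_measure_mono[OF _ W])
    show "A \<subseteq> ?W" using sets.sets_into_space[OF A(1)] by (auto intro!: exI[of _ 0])
  qed
  ultimately show "measure M ?W = 1" using m A(2) by linarith
qed

text \<open>
  \<open>H q\<close> is the set where the last visit to a small set \<open>A\<close> was \<open>q\<close> steps ago, and the levels of
  the tower consist of the blocks \<open>H (q * N), \<dots>, H (q * N + N - 1)\<close> which are not cut short by a
  return to \<open>A\<close>.
\<close>

lemma rokhlin:
  fixes N :: nat and d :: real
  assumes N: "N \<ge> 1" and d: "d > 0"
  shows "\<exists>B\<in>sets M. (\<forall>i<N. \<forall>j<N. i \<noteq> j \<longrightarrow> ipow S (int i) ` B \<inter> ipow S (int j) ` B = {}) \<and>
    1 - d \<le> N * measure M B"
proof -
  \<comment> \<open>Up to a null set, the part missed by the tower lies in the preimages of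
    \<open>A\<close> under \<open>N - 1\<close> powers of \<open>S\<close>, so measure
    \<open>d / N\<close> keeps it below \<open>d\<close>. The minimum with 1 makes such a set
    exist.\<close>
  obtain A where A: "A \<in> sets M" "measure M A = min 1 (d / N)"
    using sierpinski[OF atl sets.top, of "min 1 (d / N)"] N d by (auto simp: prob_space)
  have A0: "measure M A > 0" using A(2) N d by simp
  note [measurable] = A(1)
  define H where "H q = {x \<in> space M. ipow S (- int q) x \<in> A \<and> (\<forall>k<q. ipow S (- int k) x \<notin> A)}" for q
  have H [measurable]: "H q \<in> sets M" for q unfolding H_def by measurable
  have Hd: "p = q" if "x \<in> H p" "x \<in> H q" for p q x
    using that by (auto simp: H_def) (metis linorder_neqE_nat)
  define R where "R = (\<Union>q. H (q * N + (N - 1)))"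
  have R: "R \<in> sets M" unfolding R_def by auto
  \<comment> \<open>\<open>R\<close> is the top level and is reached only by blocks of full length;
    the base lies \<open>N - 1\<close> steps below it.\<close>
  define B where "B = ipow S (int (N - 1)) -` R"
  have B: "B \<in> sets M" unfolding B_def by (rule aut_vimage(1)[OF aut_ipow[OF aut] R])
  have level: "\<exists>q. y \<in> H (q * N + j)" if y: "y \<in> ipow S (int j) ` B" and j: "j < N" for y j
  proof -
    obtain b where b: "b \<in> B" "y = ipow S (int j) b" using y by blast
    then obtain q where q: "ipow S (int (N - 1)) b \<in> H (q * N + (N - 1))" by (auto simp: B_def R_def)
    have eq: "ipow S (- int k) y = ipow S (- int (k + (N - 1 - j))) (ipow S (int (N - 1)) b)" for k
      unfolding b(2) ipowS_add[symmetric] using j by (intro arg_cong[of _ _ "\<lambda>i. ipow S i b"]) (simp add: of_nat_diff)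
    have "y \<in> H (q * N + j)"
      unfolding H_def
    proof (intro CollectI conjI allI impI)
      have "b \<in> space M" using b(1) sets.sets_into_space[OF B] by blast
      then show "y \<in> space M" using b(2) by simp
      have "q * N + j + (N - 1 - j) = q * N + (N - 1)" using j by simp
      then show "ipow S (- int (q * N + j)) y \<in> A" unfolding eq using q by (simp only: H_def mem_Collect_eq)
      fix k assume "k < q * N + j"
      then have "k + (N - 1 - j) < q * N + (N - 1)" using j by simp
      moreover have "\<forall>k<q * N + (N - 1). ipow S (- int k) (ipow S (int (N - 1)) b) \<notin> A"
        using q unfolding H_def by blast
      ultimately show "ipow S (- int k) y \<notin> A" unfolding eq by blast
    qed
    then show ?thesis ..
  qed
  have disj: "ipow S (int i) ` B \<inter> ipow S (int j) ` B = {}" if ij: "i < N" "j < N" "i \<noteq> j" for i j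
  proof (rule equals0I)
    fix y assume "y \<in> ipow S (int i) ` B \<inter> ipow S (int j) ` B"
    then obtain p q where "y \<in> H (p * N + i)" "y \<in> H (q * N + j)" using level ij by blast
    then have "p * N + i = q * N + j" by (rule Hd)
    then have "(p * N + i) mod N = (q * N + j) mod N" by simp
    then show False using ij by simp
  qed
  define W where "W = {x \<in> space M. \<exists>k::nat. ipow S (- int k) x \<in> A}"
  have W: "W \<in> sets M" "measure M W = 1"
    unfolding W_def using recurrent_past[OF A(1) A0] by simp_all
  \<comment> \<open>\<open>?L\<close> is the tower, and \<open>?K\<close> consists of the points
    that enter \<open>A\<close> within the next \<open>N - 1\<close> steps. Outside
    \<open>?K\<close> the current block is completed before the next visit to
    \<open>A\<close>.\<close>
  let ?L = "\<Union>j<N. ipow S (int j) ` B" and ?K = "\<Union>i\<in>{1..<N}. ipow S (int i) -` A"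
  have L: "ipow S (int j) ` B \<in> sets M" "measure M (ipow S (int j) ` B) = measure M B" for j
    using aut_image[OF aut_ipow[OF aut] B] by simp_all
  have K: "ipow S (int j) -` A \<in> sets M" "measure M (ipow S (int j) -` A) = measure M A" for j
    using aut_vimage[OF aut_ipow[OF aut] A(1)] by simp_all
  have "W \<subseteq> ?L \<union> ?K"
  proof
    fix x assume x: "x \<in> W"
    show "x \<in> ?L \<union> ?K"
    proof (cases "x \<in> ?K")
      case False
      define p where "p = (LEAST k. ipow S (- int k) x \<in> A)"
      have ex: "\<exists>k. ipow S (- int k) x \<in> A" using x by (simp add: W_def)
      have p: "ipow S (- int p) x \<in> A" unfolding p_def by (rule LeastI_ex[OF ex])
      have np: "ipow S (- int k) x \<notin> A" if "k < p" for k using not_less_Least[of k] that by (simp add: p_def)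
      define j where "j = p mod N" define q where "q = p div N"
      have pj: "p = q * N + j" by (simp add: j_def q_def)
      have j: "j < N" using N by (simp add: j_def)
      have "ipow S (int (N - 1 - j)) x \<in> H (q * N + (N - 1))"
        unfolding H_def
      proof (intro CollectI conjI allI impI)
        show "ipow S (int (N - 1 - j)) x \<in> space M" using x by (simp add: W_def)
        have "ipow S (- int (q * N + (N - 1))) (ipow S (int (N - 1 - j)) x) = ipow S (- int p) x"
          unfolding ipowS_add[symmetric] using j pj
          by (intro arg_cong[of _ _ "\<lambda>i. ipow S i x"]) (simp add: of_nat_diff)
        then show "ipow S (- int (q * N + (N - 1))) (ipow S (int (N - 1 - j)) x) \<in> A" using p by simp
        fix k assume k: "k < q * N + (N - 1)"
        have "ipow S (- int k + int (N - 1 - j)) x \<notin> A"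
        proof (cases "k < N - 1 - j")
          case True
          then have "N - 1 - j - k \<in> {1..<N}" using j by auto
          then have "ipow S (int (N - 1 - j - k)) x \<notin> A" using False by blast
          moreover have "- int k + int (N - 1 - j) = int (N - 1 - j - k)" using True by (simp add: of_nat_diff)
          ultimately show ?thesis by simp
        next
          case False
          then have "- int k + int (N - 1 - j) = - int (k - (N - 1 - j))" by (simp add: of_nat_diff)
          moreover have "k - (N - 1 - j) < p" using k pj False j by linarith
          ultimately show ?thesis using np by (simp only: not_False_eq_True)
        qed
        then show "ipow S (- int k) (ipow S (int (N - 1 - j)) x) \<notin> A" unfolding ipowS_add .
      qed
      then have "ipow S (int (N - 1 - j)) x \<in> R" by (unfold R_def, blast)
      moreover have "ipow S (int (N - 1)) (ipow S (- int j) x) = ipow S (int (N - 1 - j)) x"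
        unfolding ipowS_add[symmetric] using j
        by (intro arg_cong[of _ _ "\<lambda>i. ipow S i x"]) (simp add: of_nat_diff)
      ultimately have "ipow S (- int j) x \<in> B" by (simp add: B_def)
      then have "x \<in> ipow S (int j) ` B" by (intro image_eqI[of _ _ "ipow S (- int j) x"]) (simp_all add: bijS)
      then show ?thesis using j by blast
    qed blast
  qed
  then have "measure M W \<le> measure M (?L \<union> ?K)"
    using L K by (intro finite_measure_mono sets.Un sets.finite_UN) auto
  also have "\<dots> \<le> measure M ?L + measure M ?K"
    using L K by (intro measure_Un_le sets.finite_UN) auto
  also have "measure M ?L \<le> (\<Sum>j<N. measure M (ipow S (int j) ` B))"
    using L by (intro finite_measure_subadditive_finite) auto
  also have "\<dots> = N * measure M B" using L by simp
  also have "measure M ?K \<le> (\<Sum>i\<in>{1..<N}. measure M (ipow S (int i) -` A))"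
    using K by (intro finite_measure_subadditive_finite) auto
  also have "\<dots> = (N - 1) * measure M A" using K by simp
  also have "\<dots> \<le> N * (d / N)"
    using A(2) d by (intro mult_mono) auto
  also have "\<dots> = d" using N by simp
  finally show ?thesis using W(2) B disj by (intro bexI[of _ B]) auto
qed

end

section \<open>Mixing finitely many sets by rearranging a tower\<close>

text \<open>Completes the stretched order of a column to a permutation of all its levels; what
  happens on the remaining levels is absorbed in error terms.\<close>

lemma bij_extend_lessThan:
  assumes f: "inj_on f {..<k}" "f ` {..<k} \<subseteq> {..<N::nat}" and kN: "k \<le> N"
  shows "\<exists>r. bij_betw r {..<N} {..<N} \<and> (\<forall>i<k. r i = f i)"
proof -
  have fb: "bij_betw f {..<k} (f ` {..<k})" using f(1) by (simp add: bij_betw_def)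
  have "card ({..<N} - f ` {..<k}) = N - k"
    using f by (simp add: card_Diff_subset card_image)
  then have "card {k..<N} = card ({..<N} - f ` {..<k})" by simp
  then obtain g where g: "bij_betw g {k..<N} ({..<N} - f ` {..<k})"
    using finite_same_card_bij[of "{k..<N}" "{..<N} - f ` {..<k}"] by auto
  let ?r = "\<lambda>i. if i < k then f i else g i"
  have "bij_betw ?r {..<k} (f ` {..<k})" using fb by (subst bij_betw_cong[of _ _ f]) auto
  moreover have "bij_betw ?r {k..<N} ({..<N} - f ` {..<k})" using g by (subst bij_betw_cong[of _ _ g]) auto
  ultimately have "bij_betw ?r ({..<k} \<union> {k..<N}) (f ` {..<k} \<union> ({..<N} - f ` {..<k}))"
    by (rule bij_betw_combine) auto
  moreover have "{..<k} \<union> {k..<N} = {..<N}" using kN by auto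
  moreover have "f ` {..<k} \<union> ({..<N} - f ` {..<k}) = {..<N}" using f(2) by auto
  ultimately have "bij_betw ?r {..<N} {..<N}" by simp
  then show ?thesis by (intro exI[of _ ?r]) simp
qed

context erg_aut
begin

text \<open>Since \<open>S\<close> preserves the measure, starting the average at time
  \<open>k\<close> does not change its L^1 distance from the mean, and this distance bounds the
  error for every \<open>B\<close>. Uniformity in \<open>k\<close> is what matters: the number of
  columns has to be fixed before the mixing time \<open>n\<close>, which is used as
  \<open>k\<close>.\<close>

lemma uniform_average:
  assumes G: "finite G" "G \<subseteq> sets M" and e: "e > 0"
  shows "\<exists>m. \<forall>k. \<forall>A\<in>G. \<forall>B\<in>sets M.
    \<bar>(\<Sum>c<Suc m. measure M (B \<inter> ipow S (int (k + c)) -` A)) / Suc m - measure M A * measure M B\<bar> < e"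
proof -
  have "\<forall>\<^sub>F n in sequentially. \<forall>A\<in>G. (\<integral>x. \<bar>bsum (indicator A) n x / n - measure M A\<bar> \<partial>M) < e"
    using G e mean_ergodic by (intro eventually_ball_finite ballI order_tendstoD(2)[OF mean_ergodic]) auto
  then obtain m where m: "\<And>A. A \<in> G \<Longrightarrow> (\<integral>x. \<bar>bsum (indicator A) (Suc m) x / Suc m - measure M A\<bar> \<partial>M) < e"
    unfolding eventually_sequentially by (metis le_Suc_eq order_refl)
  have "\<bar>(\<Sum>c<Suc m. measure M (B \<inter> ipow S (int (k + c)) -` A)) / Suc m - measure M A * measure M B\<bar> < e"
    if A: "A \<in> G" and B: "B \<in> sets M" for k A B
  proof -
    have As: "A \<in> sets M" using A G(2) by blast
    note [measurable] = As B
    let ?a = "\<lambda>x. bsum (indicator A) (Suc m) x / Suc m"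
    have ia: "integrable M (indicator A :: 'a \<Rightarrow> real)" "integrable M (indicator B :: 'a \<Rightarrow> real)"
      using As B by (auto intro!: integrable_real_indicator simp: less_top[symmetric])
    have ints: "integrable M ?a"
      using integral_bsum(2)[OF ia(1), of "Suc m"] by (rule integrable_divide)
    have intk: "integrable M (\<lambda>x. ?a ((S ^^ k) x))"
      by (rule aut_integrable[OF aut_funpow[OF aut] ints])
    have term_eq: "measure M (B \<inter> ipow S (int (k + c)) -` A)
        = (\<integral>x. indicator B x * indicator A ((S ^^ c) ((S ^^ k) x)) \<partial>M)"
      and term_int: "integrable M (\<lambda>x. indicator B x * indicator A ((S ^^ c) ((S ^^ k) x)) :: real)" for c
    proof -
      let ?E = "B \<inter> ipow S (int (k + c)) -` A"
      have E: "?E \<in> sets M" using B aut_vimage(1)[OF aut_ipow[OF aut] As] by blast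
      have fp: "ipow S (int (k + c)) x = (S ^^ c) ((S ^^ k) x)" for x
        by (simp only: ipow_of_nat add.commute[of k c] funpow_add comp_apply)
      have eq: "(\<lambda>x. indicator B x * indicator A ((S ^^ c) ((S ^^ k) x))) = (indicator ?E :: 'a \<Rightarrow> real)"
        by (auto simp: fun_eq_iff indicator_def fp simp del: of_nat_add)
      show "measure M ?E = (\<integral>x. indicator B x * indicator A ((S ^^ c) ((S ^^ k) x)) \<partial>M)"
        unfolding eq using sets.sets_into_space[OF E] by (simp add: Int_absorb2)
      show "integrable M (\<lambda>x. indicator B x * indicator A ((S ^^ c) ((S ^^ k) x)) :: real)"
        unfolding eq using E by (auto intro!: integrable_real_indicator simp: less_top[symmetric])
    qed
    have "(\<Sum>c<Suc m. measure M (B \<inter> ipow S (int (k + c)) -` A))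
        = (\<integral>x. (\<Sum>c<Suc m. indicator B x * indicator A ((S ^^ c) ((S ^^ k) x))) \<partial>M)"
      unfolding term_eq by (rule Bochner_Integration.integral_sum[symmetric, OF term_int])
    also have "\<dots> = (\<integral>x. Suc m * (indicator B x * ?a ((S ^^ k) x)) \<partial>M)"
      unfolding bsum_def sum_distrib_left[symmetric] by (intro Bochner_Integration.integral_cong refl) (simp only: of_nat_Suc, simp)
    also have "\<dots> = Suc m * (\<integral>x. indicator B x * ?a ((S ^^ k) x) \<partial>M)" by (rule integral_mult_right_zero)
    finally have 1: "(\<Sum>c<Suc m. measure M (B \<inter> ipow S (int (k + c)) -` A)) / Suc m
        = (\<integral>x. indicator B x * ?a ((S ^^ k) x) \<partial>M)" by (simp only: of_nat_Suc) simp
    have 2: "measure M A * measure M B = (\<integral>x. indicator B x * measure M A \<partial>M)"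
      using sets.sets_into_space[OF B] by (simp add: Int_absorb2)
    have i1: "integrable M (\<lambda>x. indicator B x * ?a ((S ^^ k) x))"
      using integrable_mult_indicator[OF B intk] by simp
    have i2: "integrable M (\<lambda>x. indicator B x * measure M A)" using ia(2) by simp
    have i3: "integrable M (\<lambda>x. \<bar>?a ((S ^^ k) x) - measure M A\<bar>)" using intk by simp
    have "\<bar>(\<integral>x. indicator B x * ?a ((S ^^ k) x) \<partial>M) - (\<integral>x. indicator B x * measure M A \<partial>M)\<bar>
        = \<bar>\<integral>x. indicator B x * ?a ((S ^^ k) x) - indicator B x * measure M A \<partial>M\<bar>"
      using Bochner_Integration.integral_diff[OF i1 i2] by simp
    also have "\<dots> \<le> (\<integral>x. \<bar>indicator B x * ?a ((S ^^ k) x) - indicator B x * measure M A\<bar> \<partial>M)"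
      by (rule integral_abs_bound)
    also have "\<dots> \<le> (\<integral>x. \<bar>?a ((S ^^ k) x) - measure M A\<bar> \<partial>M)"
    proof (rule integral_mono[OF _ i3])
      show "integrable M (\<lambda>x. \<bar>indicator B x * ?a ((S ^^ k) x) - indicator B x * measure M A\<bar>)"
        using i1 i2 by simp
      show "\<bar>indicator B x * ?a ((S ^^ k) x) - indicator B x * measure M A\<bar> \<le> \<bar>?a ((S ^^ k) x) - measure M A\<bar>" for x
        by (simp add: indicator_def)
    qed
    also have "\<dots> = (\<integral>x. \<bar>?a x - measure M A\<bar> \<partial>M)"
      using ints by (intro aut_integral[OF aut_funpow[OF aut], of "\<lambda>x. \<bar>?a x - measure M A\<bar>"]) auto
    also have "\<dots> < e" by (rule m[OF A])
    finally show ?thesis unfolding 1 2 .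
  qed
  then show ?thesis by blast
qed

text \<open>Disjointness of the levels determines the column and the level of a point, so permuting
  the levels of each column is well defined and bijective; it moves points along orbits, and
  \<open>aut_full_group\<close> applies.\<close>

lemma castle_aut:
  fixes m N :: nat
  assumes B: "\<And>c. c < m \<Longrightarrow> P c \<in> sets M"
    and disj: "\<And>c d i j b b'. c < m \<Longrightarrow> d < m \<Longrightarrow> i < N \<Longrightarrow> j < N \<Longrightarrow> b \<in> P c \<Longrightarrow> b' \<in> P d \<Longrightarrow>
      ipow S (int i) b = ipow S (int j) b' \<Longrightarrow> c = d \<and> i = j"
    and r: "\<And>c. c < m \<Longrightarrow> bij_betw (r c) {..<N} {..<N}"
  shows "\<exists>U. aut M U \<and> (\<forall>x. \<exists>k. U x = ipow S k x \<and> \<bar>k\<bar> \<le> int N) \<and>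
    (\<forall>c<m. \<forall>i<N. \<forall>b\<in>P c. U (ipow S (int i) b) = ipow S (int (r c i)) b)"
proof -
  define pos where "pos x c i \<longleftrightarrow> c < m \<and> i < N \<and> x \<in> ipow S (int i) ` P c" for x c i
  have pos_unique: "c = d \<and> i = j" if "pos x c i" "pos x d j" for x c d i j
    using that disj unfolding pos_def by blast
  \<comment> \<open>Passing from level \<open>i\<close> to level \<open>r c i\<close> is a power of
    \<open>S\<close> with exponent \<open>r c i - i\<close>, so the base point need not be
    recovered. Off the castle \<open>U\<close> is the identity.\<close>
  define U where "U x = (if \<exists>c i. pos x c i
    then THE y. \<exists>c i. pos x c i \<and> y = ipow S (int (r c i) - int i) x else x)" for x
  have U_in: "U x = ipow S (int (r c i) - int i) x" if p: "pos x c i" for x c i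
  proof -
    have "(THE y. \<exists>c i. pos x c i \<and> y = ipow S (int (r c i) - int i) x) = ipow S (int (r c i) - int i) x"
    proof (rule the_equality)
      show "\<exists>c' i'. pos x c' i' \<and> ipow S (int (r c i) - int i) x = ipow S (int (r c' i') - int i') x"
        using p by blast
      show "y = ipow S (int (r c i) - int i) x"
        if "\<exists>c i. pos x c i \<and> y = ipow S (int (r c i) - int i) x" for y
        using that pos_unique[OF p] by blast
    qed
    then show ?thesis using p unfolding U_def by auto
  qed
  have U_out: "U x = x" if "\<not> (\<exists>c i. pos x c i)" for x using that by (simp add: U_def)
  have rN: "r c i < N" if "c < m" "i < N" for c i
    using r[OF that(1)] that(2) by (auto simp: bij_betw_def)
  have U_level: "U (ipow S (int i) b) = ipow S (int (r c i)) b" if "c < m" "i < N" "b \<in> P c" for c i b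
  proof -
    have "pos (ipow S (int i) b) c i" using that by (auto simp: pos_def)
    from U_in[OF this] show ?thesis unfolding ipowS_add[symmetric] by simp
  qed
  have U_pos: "pos (U x) c (r c i)" if p: "pos x c i" for x c i
  proof -
    obtain b where b: "b \<in> P c" "x = ipow S (int i) b" "c < m" "i < N" using p by (auto simp: pos_def)
    then show ?thesis using U_level[of c i b] rN[of c i] by (simp add: pos_def)
  qed
  have "inj U"
  proof (rule injI)
    fix x y assume eq: "U x = U y"
    consider (out) "\<not> (\<exists>c i. pos x c i)" "\<not> (\<exists>c i. pos y c i)"
      | (both) c i d j where "pos x c i" "pos y d j"
      | (xin) c i where "pos x c i" "\<not> (\<exists>c i. pos y c i)"
      | (yin) d j where "pos y d j" "\<not> (\<exists>c i. pos x c i)" by blast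
    then show "x = y"
    proof cases
      case out
      then show ?thesis using eq U_out by metis
    next
      case both
      from U_pos[OF both(1)] U_pos[OF both(2)] have "c = d \<and> r c i = r d j"
        unfolding eq by (rule pos_unique)
      moreover have "i < N" "j < N" "c < m" using both by (auto simp: pos_def)
      ultimately have cd: "c = d" "i = j" using r[of c] by (auto simp: bij_betw_def inj_on_def)
      have "ipow S (int (r c i) - int i) x = ipow S (int (r c i) - int i) y"
        using eq U_in[OF both(1)] U_in[OF both(2)] cd by simp
      then show ?thesis by (simp only: ipowS_inj)
    next
      case xin
      then show ?thesis using U_pos[OF xin(1)] U_out[OF xin(2)] eq by auto
    next
      case yin
      then show ?thesis using U_pos[OF yin(1)] U_out[OF yin(2)] eq by auto
    qed
  qed
  moreover have "surj U"
    unfolding surj_def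
  proof (rule allI)
    fix y
    show "\<exists>x. y = U x"
    proof (cases "\<exists>c i. pos y c i")
      case True
      then obtain c j b where b: "b \<in> P c" "y = ipow S (int j) b" "c < m" "j < N" by (auto simp: pos_def)
      then have "j \<in> r c ` {..<N}" using r[of c] by (simp add: bij_betw_def)
      then obtain i where "i < N" "r c i = j" by auto
      then have "U (ipow S (int i) b) = y" using U_level[of c i b] b by simp
      then show ?thesis by blast
    next
      case False
      then show ?thesis using U_out[OF False] by metis
    qed
  qed
  ultimately have bijU: "bij U" by (simp add: bij_def)
  have orb: "\<exists>k. U x = ipow S k x \<and> \<bar>k\<bar> \<le> int N" for x
  proof (cases "\<exists>c i. pos x c i")
    case True
    then obtain c i where p: "pos x c i" by blast
    then have "i < N" "r c i < N" using rN by (auto simp: pos_def)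
    then show ?thesis using U_in[OF p] by (intro exI[of _ "int (r c i) - int i"]) auto
  next
    case False
    then show ?thesis using U_out by (intro exI[of _ 0]) simp
  qed
  have lev: "ipow S (int i) ` P c \<in> sets M" if "c < m" for c i
    using aut_image(1)[OF aut_ipow[OF aut] B[OF that]] .
  have "U \<in> measurable M M"
  proof (rule measurableI)
    show "U x \<in> space M" if "x \<in> space M" for x using orb[of x] that by auto
    fix A assume A: "A \<in> sets M"
    let ?T = "\<Union>c<m. \<Union>i<N. ipow S (int i) ` P c"
    have "U -` A \<inter> space M = (\<Union>c<m. \<Union>i<N. ipow S (int i) ` P c \<inter> ipow S (int (r c i) - int i) -` A) \<union> (A - ?T)"
      (is "_ = ?R")
    proof (intro set_eqI)
      fix x
      show "x \<in> U -` A \<inter> space M \<longleftrightarrow> x \<in> ?R"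
      proof (cases "\<exists>c i. pos x c i")
        case True
        then obtain c i where p: "pos x c i" by blast
        have p': "c < m" "i < N" "x \<in> ipow S (int i) ` P c" using p by (auto simp: pos_def)
        have xs: "x \<in> space M" using p' lev[OF p'(1), THEN sets.sets_into_space] by blast
        have "x \<in> ?R \<longleftrightarrow> U x \<in> A"
        proof
          assume "x \<in> ?R"
          moreover have "x \<in> ?T" using p' by blast
          ultimately obtain d j where q: "d < m" "j < N" "x \<in> ipow S (int j) ` P d" "ipow S (int (r d j) - int j) x \<in> A"
            by blast
          then have "pos x d j" by (simp add: pos_def)
          from U_in[OF this] q(4) show "U x \<in> A" by simp
        next
          assume "U x \<in> A"
          then show "x \<in> ?R" using U_in[OF p] p' by auto
        qed
        then show ?thesis using xs by simp
      next
        case False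
        then have "x \<notin> ?T" by (auto simp: pos_def)
        then show ?thesis using U_out[OF False] sets.sets_into_space[OF A] by auto
      qed
    qed
    also have "?R \<in> sets M"
    proof (intro sets.Un sets.finite_UN sets.Diff A)
      fix c i assume "c \<in> {..<m}"
      then show "ipow S (int i) ` P c \<in> sets M" "ipow S (int i) ` P c \<inter> ipow S (int (r c i) - int i) -` A \<in> sets M"
        using lev[of c i] aut_vimage(1)[OF aut_ipow[OF aut] A] by auto
    qed auto
    finally show "U -` A \<inter> space M \<in> sets M" .
  qed
  with bijU have "aut M U" using orb by (intro aut_full_group[OF aut]) blast+
  then show ?thesis using orb U_level by blast
qed

text \<open>The selected \<open>K\<close> levels are disjoint and miss only measure
  \<open>1 - K * measure M B\<close>, so a set is recovered from its traces on them up to that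
  error. The enumeration \<open>g\<close> allows both the original and the stretched order of the
  levels.\<close>

lemma level_sum:
  fixes N K :: nat
  assumes B: "B \<in> sets M" and disj: "\<forall>i<N. \<forall>j<N. i \<noteq> j \<longrightarrow> ipow S (int i) ` B \<inter> ipow S (int j) ` B = {}"
    and g: "inj_on g {..<K}" "\<forall>i<K. g i < N" and E: "E \<in> sets M"
  shows "(\<Sum>i<K. measure M (ipow S (int (g i)) ` B \<inter> E)) \<le> measure M E"
    and "measure M E - (1 - K * measure M B) \<le> (\<Sum>i<K. measure M (ipow S (int (g i)) ` B \<inter> E))"
proof -
  let ?L = "\<lambda>i. ipow S (int (g i)) ` B"
  have L: "?L i \<in> sets M" "measure M (?L i) = measure M B" for i
    using aut_image[OF aut_ipow[OF aut] B] by simp_all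
  have dL: "?L i \<inter> ?L j = {}" if "i < K" "j < K" "i \<noteq> j" for i j
    using that g by (intro disj[rule_format]) (auto simp: inj_on_def)
  have eq: "(\<Sum>i<K. measure M (?L i \<inter> E)) = measure M (\<Union>i<K. ?L i \<inter> E)"
  proof (rule finite_measure_finite_Union[symmetric])
    show "(\<lambda>i. ?L i \<inter> E) ` {..<K} \<subseteq> sets M" using L E by blast
    show "disjoint_family_on (\<lambda>i. ?L i \<inter> E) {..<K}"
      using dL unfolding disjoint_family_on_def by blast
  qed simp
  have U: "(\<Union>i<K. ?L i) \<in> sets M" using L by blast
  have UE: "(\<Union>i<K. ?L i \<inter> E) = (\<Union>i<K. ?L i) \<inter> E" by blast
  have "measure M (\<Union>i<K. ?L i) = (\<Sum>i<K. measure M (?L i))"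
  proof (rule finite_measure_finite_Union)
    show "?L ` {..<K} \<subseteq> sets M" using L by blast
    show "disjoint_family_on ?L {..<K}" using dL unfolding disjoint_family_on_def by blast
  qed simp
  then have mU: "measure M (\<Union>i<K. ?L i) = K * measure M B" using L by simp
  have UEs: "(\<Union>i<K. ?L i) \<inter> E \<in> sets M" by (rule sets.Int[OF U E])
  show "(\<Sum>i<K. measure M (?L i \<inter> E)) \<le> measure M E"
    unfolding eq UE by (rule finite_measure_mono[OF _ E]) blast
  have "measure M E \<le> measure M ((\<Union>i<K. ?L i) \<inter> E \<union> (space M - (\<Union>i<K. ?L i)))"
    using UEs U sets.sets_into_space[OF E] by (intro finite_measure_mono sets.Un sets.compl_sets) blast+
  also have "\<dots> \<le> measure M ((\<Union>i<K. ?L i) \<inter> E) + measure M (space M - (\<Union>i<K. ?L i))"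
    using UEs U by (intro measure_Un_le sets.compl_sets)
  also have "measure M (space M - (\<Union>i<K. ?L i)) = 1 - K * measure M B"
    using prob_compl[OF U] mU by simp
  finally show "measure M E - (1 - K * measure M B) \<le> (\<Sum>i<K. measure M (?L i \<inter> E))"
    unfolding eq UE by linarith
qed

text \<open>
  A tower over \<open>B0\<close> is cut into columns, and in column \<open>c\<close> every \<open>n\<close>-th step is stretched by \<open>c\<close>.
  After conjugation the \<open>n\<close>-th power thus acts as \<open>S ^ (n + c)\<close> on column \<open>c\<close>, and averaging over
  the columns gives mixing by the mean ergodic theorem.
\<close>

lemma tower_step:
  fixes n Q m :: nat
  assumes G: "finite G" "G \<subseteq> sets M" and n: "n \<ge> 1" and Q: "Q \<ge> 1"
  shows "\<exists>U \<beta>. aut M U \<and> (\<forall>x. \<exists>k. U x = ipow S k x \<and> \<bar>k\<bar> \<le> int (Q * (n + Suc m))) \<and>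
    measure M {x \<in> space M. U (S x) \<noteq> S (U x)} \<le> (Q * Suc m + Q + 2) / n \<and>
    1 - 1 / n \<le> real (Q * (n + Suc m)) * \<beta> \<and>
    (\<forall>A\<in>G. \<forall>B\<in>G. \<bar>measure M {x \<in> space M. U x \<in> B \<and> U (ipow S (int n) x) \<in> A} -
      (\<Sum>c<Suc m. measure M (B \<inter> ipow S (int (n + c)) -` A)) / Suc m\<bar> \<le> 1 - real ((Q - 1) * n) * \<beta>)"
proof -
  \<comment> \<open>Room for \<open>Q\<close> blocks of \<open>n\<close> levels, each lengthened by
    at most \<open>m\<close> when it is stretched.\<close>
  define N where "N = Q * (n + Suc m)"
  have N1: "N \<ge> 1" using n Q by (simp add: N_def)
  define f where "f c i = i + c * (i div n)" for c i :: nat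
  have f_mono: "f c i < f c j" if "i < j" for c i j
    using that mult_le_mono2[OF div_le_mono[OF less_imp_le[OF that]], of c n] unfolding f_def by linarith
  have f_inj: "inj_on (f c) X" for c X
    by (rule inj_onI) (metis f_mono less_irrefl linorder_neqE_nat)
  have f_lt: "f c i < N" if "c < Suc m" "i < Q * n" for c i
  proof -
    have "i div n < Q" using that(2) by (rule less_mult_imp_div_less)
    then have "c * (i div n) \<le> Suc m * Q" using that(1) by (intro mult_le_mono) auto
    then show ?thesis using that(2) by (simp add: f_def N_def algebra_simps)
  qed
  \<comment> \<open>The identity behind the mixing: going up \<open>n\<close> levels in the old
    order means going up \<open>n + c\<close> levels in the new one.\<close>
  have f_add: "f c (i + n) = f c i + n + c" for c i
    using n by (simp add: f_def algebra_simps)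
  have QnN: "Q * n \<le> N" unfolding N_def by (intro mult_le_mono2) simp
  have "\<exists>r. bij_betw r {..<N} {..<N} \<and> (\<forall>i<Q * n. r i = f c i)" if "c < Suc m" for c
    using f_inj f_lt[OF that] QnN by (intro bij_extend_lessThan) auto
  then obtain r where r: "\<And>c. c < Suc m \<Longrightarrow> bij_betw (r c) {..<N} {..<N}"
    and rf: "\<And>c i. c < Suc m \<Longrightarrow> i < Q * n \<Longrightarrow> r c i = f c i" by metis
  have "1 / real n > 0" using n by simp
  from rokhlin[OF N1 this] obtain B0 where B0: "B0 \<in> sets M"
    "\<forall>i<N. \<forall>j<N. i \<noteq> j \<longrightarrow> ipow S (int i) ` B0 \<inter> ipow S (int j) ` B0 = {}"
    "1 - 1 / n \<le> N * measure M B0" by metis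
  define \<beta> where "\<beta> = measure M B0"
  \<comment> \<open>All events to be tested at any level, pulled back to the base. Columns that are
    independent of this finite family inherit the proportions of the whole tower at every
    level.\<close>
  define F where "F = (\<lambda>(p, c, A, B). ipow S (int p) -` (B \<inter> ipow S (int (n + c)) -` A)) ` ({..<N} \<times> {..<Suc m} \<times> G \<times> G)"
  have Ec: "B \<inter> ipow S k -` A \<in> sets M" if "A \<in> G" "B \<in> G" for A B k
    using that G(2) aut_vimage(1)[OF aut_ipow[OF aut]] by (metis sets.Int subsetD)
  have F: "finite F" "F \<subseteq> sets M"
  proof -
    show "finite F" using G(1) by (simp add: F_def)
    show "F \<subseteq> sets M"
      unfolding F_def
    proof (intro image_subsetI)
      fix t assume "t \<in> {..<N} \<times> {..<Suc m} \<times> G \<times> G"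
      then obtain p c A B where "t = (p, c, A, B)" "A \<in> G" "B \<in> G" by auto
      then show "(\<lambda>(p, c, A, B). ipow S (int p) -` (B \<inter> ipow S (int (n + c)) -` A)) t \<in> sets M"
        using aut_vimage(1)[OF aut_ipow[OF aut] Ec] by (simp del: vimage_Int of_nat_add)
    qed
  qed
  obtain P where Pall: "(\<forall>c<Suc m. P c \<in> sets M) \<and> disjoint_family_on P {..<Suc m} \<and> (\<Union>c<Suc m. P c) = B0 \<and>
    (\<forall>E\<in>insert (space M) F. \<forall>c<Suc m. measure M (P c \<inter> E) = measure M (B0 \<inter> E) / Suc m)"
    using independent_split[OF atl F B0(1), of m] by (elim exE)
  then have P: "\<And>c. c < Suc m \<Longrightarrow> P c \<in> sets M" "disjoint_family_on P {..<Suc m}" "(\<Union>c<Suc m. P c) = B0"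
    "\<And>E c. E \<in> F \<Longrightarrow> c < Suc m \<Longrightarrow> measure M (P c \<inter> E) = measure M (B0 \<inter> E) / Suc m" by blast+
  have PB: "b \<in> B0" if "b \<in> P c" "c < Suc m" for b c using P(3) that by blast
  have disj: "c = d \<and> i = j" if h: "c < Suc m" "d < Suc m" "i < N" "j < N" "b \<in> P c" "b' \<in> P d"
    "ipow S (int i) b = ipow S (int j) b'" for c d i j b b'
  proof -
    have "i = j"
    proof (rule ccontr)
      assume "i \<noteq> j"
      moreover have "ipow S (int i) b \<in> ipow S (int i) ` B0 \<inter> ipow S (int j) ` B0"
        using PB[OF h(5,1)] PB[OF h(6,2)] h(7) by blast
      ultimately show False using B0(2)[rule_format, OF h(3,4)] by blast
    qed
    then have "b = b'" using h(7) by (simp only: ipowS_inj)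
    then show ?thesis using h(1,2,5,6) P(2) \<open>i = j\<close> unfolding disjoint_family_on_def by blast
  qed
  have "\<exists>U. aut M U \<and> (\<forall>x. \<exists>k. U x = ipow S k x \<and> \<bar>k\<bar> \<le> int N) \<and>
    (\<forall>c<Suc m. \<forall>i<N. \<forall>b\<in>P c. U (ipow S (int i) b) = ipow S (int (r c i)) b)"
    by (rule castle_aut; (rule P(1) | rule disj | rule r); assumption)
  then obtain U where "aut M U \<and> (\<forall>x. \<exists>k. U x = ipow S k x \<and> \<bar>k\<bar> \<le> int N) \<and>
    (\<forall>c<Suc m. \<forall>i<N. \<forall>b\<in>P c. U (ipow S (int i) b) = ipow S (int (r c i)) b)" by (elim exE)
  then have U: "aut M U" "\<And>x. \<exists>k. U x = ipow S k x \<and> \<bar>k\<bar> \<le> int N"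
    "\<And>c i b. c < Suc m \<Longrightarrow> i < N \<Longrightarrow> b \<in> P c \<Longrightarrow> U (ipow S (int i) b) = ipow S (int (r c i)) b" by blast+
  have Uf: "U (ipow S (int i) b) = ipow S (int (f c i)) b" if "c < Suc m" "i < Q * n" "b \<in> P c" for c i b
    using U(3)[of c i b] rf[of c i] that QnN by simp
  have lev: "ipow S k ` B0 \<in> sets M" "measure M (ipow S k ` B0) = \<beta>" for k
    using aut_image[OF aut_ipow[OF aut] B0(1)] by (simp_all add: \<beta>_def)
  have N\<beta>: "N * \<beta> \<le> 1"
  proof -
    have e: "ipow S (int i) ` B0 \<inter> space M = ipow S (int i) ` B0" for i
      using sets.sets_into_space[OF lev(1)[of "int i"]] by blast
    have "(\<Sum>i<N. measure M (ipow S (int i) ` B0 \<inter> space M)) \<le> measure M (space M)"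
      by (rule level_sum(1)[OF B0(1,2)]) auto
    then show ?thesis by (simp add: e lev(2) prob_space)
  qed
  have \<beta>: "0 \<le> \<beta>" "\<beta> \<le> 1 / n"
  proof -
    show "0 \<le> \<beta>" by (simp add: \<beta>_def)
    have "1 * n \<le> Q * n" using Q by (intro mult_le_mono) auto
    then have "n \<le> N" using QnN by linarith
    then have "n * \<beta> \<le> N * \<beta>" using \<open>0 \<le> \<beta>\<close> by (intro mult_right_mono) auto
    then show "\<beta> \<le> 1 / n" using N\<beta> n by (simp add: field_simps)
  qed
  \<comment> \<open>The levels where \<open>U\<close> may fail to commute with \<open>S\<close>:
    those whose successor has no prescribed place, from \<open>Q * n - 1\<close> on, and the last
    level of each block, where the gap of length \<open>c\<close> is inserted. They number at most
    \<open>Q * Suc m + 1\<close> and \<open>Q\<close>; the part outside the tower adds one more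
    \<open>1 / n\<close> to the final bound.\<close>
  define I where "I = {Q * n - 1..<N} \<union> (\<lambda>k. n * k - 1) ` {1..Q}"
  have cardI: "card I \<le> Q * Suc m + Q + 1"
  proof -
    have "card I \<le> card {Q * n - 1..<N} + card ((\<lambda>k. n * k - 1) ` {1..Q})"
      unfolding I_def by (rule card_Un_le)
    also have "\<dots> \<le> (N - (Q * n - 1)) + Q"
      using card_image_le[of "{1..Q}" "\<lambda>k. n * k - 1"] by simp
    also have "\<dots> \<le> Q * Suc m + Q + 1" by (simp add: N_def algebra_simps)
    finally show ?thesis .
  qed
  define T where "T = (\<Union>i<N. ipow S (int i) ` B0)"
  have T: "T \<in> sets M" unfolding T_def using lev by blast
  have mT: "measure M (space M - T) \<le> 1 / n"
  proof -
    have "T \<inter> (space M - T) = {}" by blast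
    then have z: "ipow S (int i) ` B0 \<inter> (space M - T) = {}" if "i < N" for i using that unfolding T_def by blast
    have cT: "space M - T \<in> sets M" using T by blast
    have "measure M (space M - T) - (1 - N * \<beta>) \<le> (\<Sum>i<N. measure M (ipow S (int i) ` B0 \<inter> (space M - T)))"
      unfolding \<beta>_def by (rule level_sum(2)[OF B0(1,2) _ _ cT]) auto
    also have "\<dots> = 0" using z by simp
    finally show ?thesis using B0(3) by (simp add: \<beta>_def)
  qed
  have sub: "{x \<in> space M. U (S x) \<noteq> S (U x)} \<subseteq> (space M - T) \<union> (\<Union>i\<in>I. ipow S (int i) ` B0)"
  proof
    fix x assume x: "x \<in> {x \<in> space M. U (S x) \<noteq> S (U x)}"
    show "x \<in> (space M - T) \<union> (\<Union>i\<in>I. ipow S (int i) ` B0)"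
    proof (rule ccontr)
      assume n1: "\<not> ?thesis"
      then have "x \<in> T" using x by blast
      then obtain i b where ib: "i < N" "b \<in> B0" "x = ipow S (int i) b" by (auto simp: T_def)
      then have "i \<notin> I" using n1 by blast
      then have i1: "i < Q * n - 1" "i \<notin> (\<lambda>k. n * k - 1) ` {1..Q}" using ib(1) by (auto simp: I_def)
      obtain c where c: "c < Suc m" "b \<in> P c" using ib(2) P(3) by blast
      have "Suc i mod n \<noteq> 0"
      proof
        assume "Suc i mod n = 0"
        then obtain k where k: "Suc i = n * k" by (auto simp: mod_eq_0_iff_dvd)
        then have "k \<noteq> 0" by (intro notI) simp
        moreover have "k \<le> Q"
        proof -
          have "n * k \<le> Q * n" using i1(1) k by linarith
          then have "n * k \<le> n * Q" by (simp only: mult.commute)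
          then show ?thesis using n by simp
        qed
        moreover have "i = n * k - 1" using k by simp
        ultimately have "i \<in> (\<lambda>k. n * k - 1) ` {1..Q}" by (intro image_eqI[of _ _ k]) auto
        then show False using i1(2) by blast
      qed
      then have "Suc i div n = i div n" by (simp add: div_Suc)
      then have fS: "f c (Suc i) = Suc (f c i)" by (simp add: f_def)
      have "S x = ipow S (int (Suc i)) b" using ib(3) ipowS_add[of 1 "int i" b] by simp
      moreover have "Suc i < Q * n" using i1(1) by simp
      ultimately have "U (S x) = ipow S (int (f c (Suc i))) b" using Uf[OF c(1) _ c(2), of "Suc i"] by (simp del: of_nat_Suc)
      also have "\<dots> = S (ipow S (int (f c i)) b)" unfolding fS using ipowS_add[of 1 "int (f c i)" b] by simp
      also have "\<dots> = S (U x)" using Uf[OF c(1) _ c(2), of i] ib(3) i1(1) by simp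
      finally show False using x by simp
    qed
  qed
  have finI: "finite I" by (simp add: I_def)
  have UI: "(\<Union>i\<in>I. ipow S (int i) ` B0) \<in> sets M" using finI lev by (intro sets.finite_UN) auto
  have "measure M {x \<in> space M. U (S x) \<noteq> S (U x)} \<le> measure M ((space M - T) \<union> (\<Union>i\<in>I. ipow S (int i) ` B0))"
    using T UI by (intro finite_measure_mono[OF sub] sets.Un sets.compl_sets)
  also have "\<dots> \<le> measure M (space M - T) + measure M (\<Union>i\<in>I. ipow S (int i) ` B0)"
    using T UI by (intro measure_Un_le sets.compl_sets)
  also have "measure M (\<Union>i\<in>I. ipow S (int i) ` B0) \<le> (\<Sum>i\<in>I. measure M (ipow S (int i) ` B0))"
    using finI lev by (intro finite_measure_subadditive_finite) auto
  also have "\<dots> = card I * \<beta>" using lev by simp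
  also have "\<dots> \<le> (Q * Suc m + Q + 1) * (1 / n)"
    using cardI \<beta> by (intro mult_mono of_nat_mono) (simp_all only: of_nat_le_iff of_nat_0_le_iff)
  also have "measure M (space M - T) + (Q * Suc m + Q + 1) * (1 / n) \<le> 1 / n + (Q * Suc m + Q + 1) * (1 / n)"
    using mT by simp
  also have "\<dots> = (Q * Suc m + Q + 2) / n" by (simp add: add_divide_distrib)
  finally have small: "measure M {x \<in> space M. U (S x) \<noteq> S (U x)} \<le> (Q * Suc m + Q + 2) / n" by simp
  have mixing: "\<bar>measure M {x \<in> space M. U x \<in> B \<and> U (ipow S (int n) x) \<in> A} -
      (\<Sum>c<Suc m. measure M (B \<inter> ipow S (int (n + c)) -` A)) / Suc m\<bar> \<le> 1 - real ((Q - 1) * n) * \<beta>"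
    if A: "A \<in> G" and B: "B \<in> G" for A B
  proof -
    \<comment> \<open>Both level \<open>i\<close> and level \<open>i + n\<close> must have a
      prescribed place, so the last block is given up.\<close>
    define K where "K = (Q - 1) * n"
    have KQ: "i + n < Q * n" if "i < K" for i
    proof -
      have "K + n = Q * n" using Q by (cases Q) (simp_all add: K_def)
      then show ?thesis using that by simp
    qed
    define X where "X = {x \<in> space M. U x \<in> B \<and> U (ipow S (int n) x) \<in> A}"
    have As: "A \<in> sets M" and Bs: "B \<in> sets M" using A B G(2) by blast+
    have X: "X \<in> sets M"
    proof -
      have "X = U -` B \<inter> ipow S (int n) -` (U -` A)"
        using sets.sets_into_space[OF aut_vimage(1)[OF U(1) Bs]] by (auto simp: X_def)
      then show ?thesis
        using aut_vimage(1)[OF U(1)] aut_vimage(1)[OF aut_ipow[OF aut]] As Bs by simp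
    qed
    define E where "E c = B \<inter> ipow S (int (n + c)) -` A" for c
    have E: "E c \<in> sets M" for c unfolding E_def by (rule Ec[OF A B])
    \<comment> \<open>On column \<open>c\<close> the event \<open>X\<close> at level
      \<open>i\<close> becomes \<open>E c\<close> at level \<open>f c i\<close>; independence then
      replaces the column by the whole base, divided by the number of columns.\<close>
    have piece: "measure M (ipow S (int i) ` P c \<inter> X) = measure M (ipow S (int (f c i)) ` B0 \<inter> E c) / Suc m"
      if c: "c < Suc m" and i: "i < K" for c i
    proof -
      let ?V = "ipow S (int (f c i)) -` E c"
      have fi: "f c i < N" using f_lt[OF c] KQ[OF i] by simp
      have VF: "?V \<in> F" unfolding F_def E_def using fi c A B
        by (intro image_eqI[of _ _ "(f c i, c, A, B)"]) simp_all
      have Vs: "?V \<in> sets M" using VF F(2) by blast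
      have "ipow S (int i) ` P c \<inter> X = ipow S (int i) ` (P c \<inter> ?V)"
      proof -
        have "ipow S (int i) b \<in> X \<longleftrightarrow> b \<in> ?V" if b: "b \<in> P c" for b
        proof -
          have bs: "b \<in> space M" using sets.sets_into_space[OF P(1)[OF c]] b by blast
          have 1: "U (ipow S (int i) b) = ipow S (int (f c i)) b" using Uf[OF c _ b, of i] KQ[OF i] by simp
          have "ipow S (int n) (ipow S (int i) b) = ipow S (int (i + n)) b"
            unfolding ipowS_add[symmetric] by (simp add: add.commute)
          then have "U (ipow S (int n) (ipow S (int i) b)) = ipow S (int (f c (i + n))) b"
            using Uf[OF c KQ[OF i] b] by simp
          also have "\<dots> = ipow S (int (n + c)) (ipow S (int (f c i)) b)"
            unfolding ipowS_add[symmetric] f_add by (simp add: ac_simps)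
          finally show ?thesis using 1 bs by (simp add: X_def E_def)
        qed
        then show ?thesis by blast
      qed
      then have "measure M (ipow S (int i) ` P c \<inter> X) = measure M (ipow S (int i) ` (P c \<inter> ?V))" by simp
      also have "\<dots> = measure M (P c \<inter> ?V)"
        using P(1)[OF c] Vs by (intro aut_image(3)[OF aut_ipow[OF aut]] sets.Int)
      also have "\<dots> = measure M (B0 \<inter> ?V) / Suc m" by (rule P(4)[OF VF c])
      also have "measure M (B0 \<inter> ?V) = measure M (ipow S (int (f c i)) ` (B0 \<inter> ?V))"
        using B0(1) Vs by (intro aut_image(3)[OF aut_ipow[OF aut], symmetric] sets.Int)
      also have "ipow S (int (f c i)) ` (B0 \<inter> ?V) = ipow S (int (f c i)) ` B0 \<inter> E c" by blast
      finally show ?thesis .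
    qed
    have split: "measure M (ipow S (int i) ` B0 \<inter> X) = (\<Sum>c<Suc m. measure M (ipow S (int i) ` P c \<inter> X))" for i
    proof -
      have "ipow S (int i) ` B0 \<inter> X = (\<Union>c<Suc m. ipow S (int i) ` P c \<inter> X)"
        unfolding P(3)[symmetric] by blast
      also have "measure M \<dots> = (\<Sum>c<Suc m. measure M (ipow S (int i) ` P c \<inter> X))"
      proof (rule finite_measure_finite_Union)
        show "(\<lambda>c. ipow S (int i) ` P c \<inter> X) ` {..<Suc m} \<subseteq> sets M"
          using aut_image(1)[OF aut_ipow[OF aut] P(1)] X by blast
        show "disjoint_family_on (\<lambda>c. ipow S (int i) ` P c \<inter> X) {..<Suc m}"
          unfolding disjoint_family_on_def
        proof (intro ballI impI)
          fix c d assume cd: "c \<in> {..<Suc m}" "d \<in> {..<Suc m}" "c \<noteq> d"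
          then have "P c \<inter> P d = {}" using P(2) by (simp add: disjoint_family_on_def)
          then show "(ipow S (int i) ` P c \<inter> X) \<inter> (ipow S (int i) ` P d \<inter> X) = {}"
            using image_Int[OF bij_is_inj[OF bij_ipow[OF bijS]], of "int i" "P c" "P d"] by auto
        qed
      qed simp
      finally show ?thesis .
    qed
    \<comment> \<open>\<open>s\<close> lies below both the measure of \<open>X\<close> and the
      average of the measures of the \<open>E c\<close>, each time by at most
      \<open>1 - K * \<beta>\<close>, so these two differ by no more than that.\<close>
    define s where "s = (\<Sum>i<K. measure M (ipow S (int i) ` B0 \<inter> X))"
    have "s = (\<Sum>i<K. \<Sum>c<Suc m. measure M (ipow S (int (f c i)) ` B0 \<inter> E c) / Suc m)"
      unfolding s_def split by (intro sum.cong refl piece) auto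
    also have "\<dots> = (\<Sum>c<Suc m. \<Sum>i<K. measure M (ipow S (int (f c i)) ` B0 \<inter> E c) / Suc m)"
      by (rule sum.swap)
    also have "\<dots> = (\<Sum>c<Suc m. (\<Sum>i<K. measure M (ipow S (int (f c i)) ` B0 \<inter> E c)) / Suc m)"
      by (simp only: sum_divide_distrib)
    finally have s: "s = (\<Sum>c<Suc m. (\<Sum>i<K. measure M (ipow S (int (f c i)) ` B0 \<inter> E c)) / Suc m)" .
    have KN: "i < N" if "i < K" for i using KQ[OF that] QnN by simp
    have sX: "s \<le> measure M X" "measure M X - (1 - K * \<beta>) \<le> s"
      unfolding s_def \<beta>_def using KN by (intro level_sum[OF B0(1,2) _ _ X]; simp)+
    have fK: "f c i < N" if "c < Suc m" "i < K" for c i using f_lt[OF that(1)] KQ[OF that(2)] by simp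
    have sE: "(\<Sum>i<K. measure M (ipow S (int (f c i)) ` B0 \<inter> E c)) \<le> measure M (E c)"
      "measure M (E c) - (1 - K * \<beta>) \<le> (\<Sum>i<K. measure M (ipow S (int (f c i)) ` B0 \<inter> E c))" if "c < Suc m" for c
      unfolding \<beta>_def using fK[OF that] by (intro level_sum[OF B0(1,2) f_inj _ E]; blast)+
    have "s \<le> (\<Sum>c<Suc m. measure M (E c) / Suc m)"
      unfolding s by (intro sum_mono divide_right_mono sE) auto
    moreover have "(\<Sum>c<Suc m. (measure M (E c) - (1 - K * \<beta>)) / Suc m) \<le> s"
      unfolding s by (intro sum_mono divide_right_mono sE) auto
    moreover have "(\<Sum>c<Suc m. (measure M (E c) - (1 - K * \<beta>)) / Suc m)
        = (\<Sum>c<Suc m. measure M (E c)) / Suc m - (1 - K * \<beta>)"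
    proof -
      have "(\<Sum>c<Suc m. (h c - t) / Suc m) = (\<Sum>c<Suc m. h c) / Suc m - t" for h :: "nat \<Rightarrow> real" and t
        by (simp add: sum_divide_distrib[symmetric] sum_subtractf diff_divide_distrib del: sum.lessThan_Suc)
      then show ?thesis .
    qed
    ultimately have "s \<le> (\<Sum>c<Suc m. measure M (E c)) / Suc m"
      "(\<Sum>c<Suc m. measure M (E c)) / Suc m - (1 - K * \<beta>) \<le> s"
      by (simp_all only: sum_divide_distrib)
    then have "\<bar>measure M X - (\<Sum>c<Suc m. measure M (E c)) / Suc m\<bar> \<le> 1 - K * \<beta>"
      using sX unfolding abs_le_iff by linarith
    then show ?thesis unfolding X_def E_def K_def .
  qed
  show ?thesis
    using U(1,2) small B0(3) mixing unfolding \<beta>_def N_def by blast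
qed

text \<open>The number of columns \<open>Suc m\<close> is dictated by the averaging error and the
  number of blocks \<open>Q\<close> by the loss of one block in \<open>Q\<close>. Both depend only
  on \<open>G\<close> and \<open>e\<close>, so the constant is fixed before \<open>n\<close> tends
  to infinity.\<close>

lemma step:
  assumes G: "finite G" "G \<subseteq> sets M" and e: "e > 0"
  shows "\<exists>C::nat. C \<ge> 1 \<and> (\<forall>\<^sub>F n in sequentially. \<exists>U. aut M U \<and>
    (\<forall>x. \<exists>k. U x = ipow S k x \<and> \<bar>k\<bar> \<le> int (C * n)) \<and>
    measure M {x \<in> space M. U (S x) \<noteq> S (U x)} \<le> C / n \<and>
    (\<forall>A\<in>G. \<forall>B\<in>G. \<bar>measure M {x \<in> space M. U x \<in> B \<and> U (ipow S (int n) x) \<in> A} - measure M A * measure M B\<bar> < e))"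
proof -
  obtain m where m: "\<forall>k. \<forall>A\<in>G. \<forall>B\<in>sets M.
    \<bar>(\<Sum>c<Suc m. measure M (B \<inter> ipow S (int (k + c)) -` A)) / Suc m - measure M A * measure M B\<bar> < e / 2"
    using uniform_average[OF G, of "e / 2"] e by auto
  obtain q where q: "inverse (real (Suc q)) < e / 2" using reals_Archimedean[of "e / 2"] e by auto
  define Q where "Q = Suc q"
  \<comment> \<open>Dominates both the constant of the commutation error and, for
    \<open>n \<ge> 1\<close>, the tower height divided by \<open>n\<close>.\<close>
  define C where "C = Q * Suc m + Q + 2"
  \<comment> \<open>The sequence is an upper bound for the mixing error of
    \<open>tower_step\<close>, obtained from the lower bound on \<open>\<beta>\<close>; its limit
    \<open>1 / Q\<close> is the share of the block given up.\<close>
  have lim: "(\<lambda>n. 1 - (real q / real Q) * (1 / (1 + real (Suc m) * (1 / n))) * (1 - 1 / n)) \<longlonglongrightarrow>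
    1 - (real q / real Q) * (1 / (1 + real (Suc m) * 0)) * (1 - 0)"
    by (intro tendsto_intros lim_1_over_n) simp
  have "1 - (real q / real Q) * (1 / (1 + real (Suc m) * 0)) * (1 - 0) = inverse (real Q)"
    by (simp add: Q_def field_simps)
  then have "\<forall>\<^sub>F n in sequentially. 1 - (real q / real Q) * (1 / (1 + real (Suc m) * (1 / n))) * (1 - 1 / n) < e / 2"
    using order_tendstoD(2)[OF lim, of "e / 2"] q by (simp add: Q_def)
  then have "\<forall>\<^sub>F n in sequentially. \<exists>U. aut M U \<and>
    (\<forall>x. \<exists>k. U x = ipow S k x \<and> \<bar>k\<bar> \<le> int (C * n)) \<and>
    measure M {x \<in> space M. U (S x) \<noteq> S (U x)} \<le> C / n \<and>
    (\<forall>A\<in>G. \<forall>B\<in>G. \<bar>measure M {x \<in> space M. U x \<in> B \<and> U (ipow S (int n) x) \<in> A} - measure M A * measure M B\<bar> < e)"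
    using eventually_ge_at_top[of 1]
  proof eventually_elim
    case (elim n)
    have Q1: "Q \<ge> 1" by (simp add: Q_def)
    define X where "X U A B = {x \<in> space M. U x \<in> B \<and> U (ipow S (int n) x) \<in> A}" for U :: "'a \<Rightarrow> 'a" and A B
    obtain U \<beta> where "aut M U \<and> (\<forall>x. \<exists>k. U x = ipow S k x \<and> \<bar>k\<bar> \<le> int (Q * (n + Suc m))) \<and>
      measure M {x \<in> space M. U (S x) \<noteq> S (U x)} \<le> (Q * Suc m + Q + 2) / n \<and>
      1 - 1 / n \<le> real (Q * (n + Suc m)) * \<beta> \<and>
      (\<forall>A\<in>G. \<forall>B\<in>G. \<bar>measure M (X U A B) -
        (\<Sum>c<Suc m. measure M (B \<inter> ipow S (int (n + c)) -` A)) / Suc m\<bar> \<le> 1 - real ((Q - 1) * n) * \<beta>)"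
      using tower_step[OF G elim(2) Q1, of m] unfolding X_def by (elim exE)
    then have U: "aut M U" "\<And>x. \<exists>k. U x = ipow S k x \<and> \<bar>k\<bar> \<le> int (Q * (n + Suc m))"
      "measure M {x \<in> space M. U (S x) \<noteq> S (U x)} \<le> (Q * Suc m + Q + 2) / n"
      "1 - 1 / n \<le> real (Q * (n + Suc m)) * \<beta>"
      "\<And>A B. A \<in> G \<Longrightarrow> B \<in> G \<Longrightarrow> \<bar>measure M (X U A B) -
        (\<Sum>c<Suc m. measure M (B \<inter> ipow S (int (n + c)) -` A)) / Suc m\<bar> \<le> 1 - real ((Q - 1) * n) * \<beta>"
      by blast+
    have "Q * Suc m * 1 \<le> Q * Suc m * n" using elim(2) by (intro mult_le_mono2)
    then have le: "Q * (n + Suc m) \<le> C * n" by (simp add: C_def algebra_simps)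
    have eta: "1 - real ((Q - 1) * n) * \<beta> < e / 2"
    proof -
      let ?d = "real Q * (real n + real (Suc m))"
      have d: "?d > 0" using elim(2) by (simp add: Q_def)
      have "real (Q * (n + Suc m)) = ?d" by (simp only: of_nat_mult of_nat_add)
      then have "(1 - 1 / n) / ?d \<le> \<beta>" using U(4) d by (simp add: divide_le_eq mult.commute)
      then have "real q * n * ((1 - 1 / n) / ?d) \<le> real q * n * \<beta>" by (intro mult_left_mono) simp_all
      moreover have "real q * n * ((1 - 1 / n) / ?d) = (real q / real Q) * (1 / (1 + real (Suc m) * (1 / n))) * (1 - 1 / n)"
      proof -
        have n0: "real n > 0" using elim(2) by simp
        have "1 / (1 + real (Suc m) * (1 / n)) = n / (real n + real (Suc m))"
          using n0 by (simp add: field_simps)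
        then show ?thesis by simp
      qed
      moreover have "real ((Q - 1) * n) = real q * n" by (simp add: Q_def)
      ultimately have "(real q / real Q) * (1 / (1 + real (Suc m) * (1 / n))) * (1 - 1 / n) \<le> real ((Q - 1) * n) * \<beta>"
        by (simp only:)
      then have "1 - real ((Q - 1) * n) * \<beta> \<le> 1 - (real q / real Q) * (1 / (1 + real (Suc m) * (1 / n))) * (1 - 1 / n)"
        by (rule diff_left_mono)
      also have "\<dots> < e / 2" by (rule elim(1))
      finally show ?thesis .
    qed
    have "\<bar>measure M (X U A B) - measure M A * measure M B\<bar> < e" if A: "A \<in> G" and B: "B \<in> G" for A B
    proof -
      define a where "a = (\<Sum>c<Suc m. measure M (B \<inter> ipow S (int (n + c)) -` A)) / Suc m"
      have "\<bar>a - measure M A * measure M B\<bar> < e / 2" unfolding a_def using m A B G(2) by blast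
      moreover have "\<bar>measure M (X U A B) - a\<bar> \<le> 1 - real ((Q - 1) * n) * \<beta>" unfolding a_def by (rule U(5)[OF A B])
      ultimately show ?thesis using eta by linarith
    qed
    moreover have "\<exists>k. U x = ipow S k x \<and> \<bar>k\<bar> \<le> int (C * n)" for x
      using U(2)[of x] le by (meson of_nat_mono order_trans)
    ultimately show ?case using U(1,3) unfolding X_def C_def by blast
  qed
  moreover have "C \<ge> 1" by (simp add: C_def)
  ultimately show ?thesis by blast
qed

end

section \<open>Conjugates with bounded cocycles and the sequence of stages\<close>

lemma bij_image_eq_iff:
  assumes "bij T"
  shows "T ` A = A \<longleftrightarrow> (\<forall>x. T x \<in> A \<longleftrightarrow> x \<in> A)"
proof
  assume eq: "T ` A = A"
  show "\<forall>x. T x \<in> A \<longleftrightarrow> x \<in> A"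
    using inj_image_mem_iff[OF bij_is_inj[OF assms]] eq by metis
next
  assume h: "\<forall>x. T x \<in> A \<longleftrightarrow> x \<in> A"
  have "x \<in> T ` A" if "x \<in> A" for x
  proof -
    have "T (inv T x) = x" using assms by (simp add: bij_is_surj surj_f_inv_f)
    then show ?thesis using h that by (metis imageI)
  qed
  then show "T ` A = A" using h by blast
qed

text \<open>Boundedness of both cocycles at time 1, at every point. In this form the relation
  composes, and the bounds multiply.\<close>

definition orbit_link :: "('a \<Rightarrow> 'a) \<Rightarrow> ('a \<Rightarrow> 'a) \<Rightarrow> nat \<Rightarrow> bool" where
  "orbit_link S T L \<longleftrightarrow> (\<forall>x. \<exists>k. T x = ipow S k x \<and> \<bar>k\<bar> \<le> int L) \<and> (\<forall>x. \<exists>k. S x = ipow T k x \<and> \<bar>k\<bar> \<le> int L)"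

lemma ipow_orbit_bound:
  assumes "bij S" "bij T" and TS: "\<And>x. \<exists>k. T x = ipow S k x \<and> \<bar>k\<bar> \<le> int L"
  shows "\<exists>k. ipow T n x = ipow S k x \<and> \<bar>k\<bar> \<le> \<bar>n\<bar> * int L"
proof -
  have pos: "\<exists>k. ipow T (int m) x = ipow S k x \<and> \<bar>k\<bar> \<le> int m * int L" for m x
  proof (induction m)
    case 0
    then show ?case by (intro exI[of _ 0]) simp
  next
    case (Suc m)
    then obtain k where k: "ipow T (int m) x = ipow S k x" "\<bar>k\<bar> \<le> int m * int L" by blast
    obtain j where j: "T (ipow S k x) = ipow S j (ipow S k x)" "\<bar>j\<bar> \<le> int L" using TS by blast
    have "ipow T (int (Suc m)) x = T (ipow T (int m) x)"
      using ipow_plus1[OF assms(2), of "int m" x] by (simp add: add.commute)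
    also have "\<dots> = ipow S (j + k) x" using k j by (simp add: ipow_add[OF assms(1)])
    finally have "ipow T (int (Suc m)) x = ipow S (j + k) x" .
    moreover have "\<bar>j + k\<bar> \<le> int (Suc m) * int L" using k(2) j(2) by (simp add: algebra_simps)
    ultimately show ?case by blast
  qed
  show ?thesis
  proof (cases "n \<ge> 0")
    case True
    then show ?thesis using pos[of "nat n" x] by simp
  next
    case False
    \<comment> \<open>A negative power is a positive power read backwards from its endpoint
      \<open>?y\<close>.\<close>
    let ?y = "ipow T n x"
    obtain k where k: "ipow T (int (nat (- n))) ?y = ipow S k ?y" "\<bar>k\<bar> \<le> int (nat (- n)) * int L"
      using pos by blast
    then have "x = ipow S k ?y" using False assms(2) by simp
    then have "?y = ipow S (- k) x" using assms(1) by (metis ipow_cancel(2))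
    then show ?thesis using k(2) False by (intro exI[of _ "- k"]) simp
  qed
qed

lemma orbit_link_trans:
  assumes "bij R" "bij S" "bij T" "orbit_link R S K" "orbit_link S T L"
  shows "orbit_link R T (K * L)"
proof -
  have "\<exists>k. T x = ipow R k x \<and> \<bar>k\<bar> \<le> int (K * L)" for x
  proof -
    obtain k where k: "T x = ipow S k x" "\<bar>k\<bar> \<le> int L" using assms(5) by (auto simp: orbit_link_def)
    obtain j where "ipow S k x = ipow R j x" "\<bar>j\<bar> \<le> \<bar>k\<bar> * int K"
      using ipow_orbit_bound[OF assms(1,2), of K k x] assms(4) by (auto simp: orbit_link_def)
    moreover have "\<bar>k\<bar> * int K \<le> int L * int K" using k(2) by (intro mult_right_mono) auto
    ultimately show ?thesis using k(1) by (intro exI[of _ j]) (auto simp: mult.commute)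
  qed
  moreover have "\<exists>k. R x = ipow T k x \<and> \<bar>k\<bar> \<le> int (K * L)" for x
  proof -
    obtain k where k: "R x = ipow S k x" "\<bar>k\<bar> \<le> int K" using assms(4) by (auto simp: orbit_link_def)
    obtain j where "ipow S k x = ipow T j x" "\<bar>j\<bar> \<le> \<bar>k\<bar> * int L"
      using ipow_orbit_bound[OF assms(3,2), of L k x] assms(5) by (auto simp: orbit_link_def)
    moreover have "\<bar>k\<bar> * int L \<le> int K * int L" using k(2) by (intro mult_right_mono) auto
    ultimately show ?thesis using k(1) by (intro exI[of _ j]) auto
  qed
  ultimately show ?thesis by (simp add: orbit_link_def)
qed

definition mixes_at :: "'a measure \<Rightarrow> ('a \<Rightarrow> 'a) \<Rightarrow> nat \<Rightarrow> 'a set set \<Rightarrow> real \<Rightarrow> bool" where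
  "mixes_at M T n G e \<longleftrightarrow>
    (\<forall>A\<in>G. \<forall>B\<in>G. \<bar>measure M (B \<inter> ipow T (int n) -` A) - measure M A * measure M B\<bar> < e)"

context erg_aut
begin

text \<open>For \<open>T = U S U^-1\<close> everything is pulled back along \<open>U\<close>:
  invariant sets of \<open>T\<close> become invariant sets of \<open>S\<close>, the set where
  \<open>T\<close> and \<open>S\<close> differ becomes the set where \<open>U\<close> and
  \<open>S\<close> do not commute, and the event tested for \<open>T\<close> becomes the one tested
  in \<open>step\<close>. A step of \<open>T\<close> is at most one displacement by \<open>U\<close>
  back, one step of \<open>S\<close> and one displacement forth, whence
  \<open>2 * K * n + 1\<close>.\<close>

lemma conj_step:
  assumes G: "finite G" "G \<subseteq> sets M" and e: "e > 0"
  shows "\<exists>K::nat. K \<ge> 1 \<and> (\<forall>\<^sub>F n in sequentially. \<exists>T. erg_aut M C T \<and> orbit_link S T (2 * K * n + 1) \<and>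
    measure M {x \<in> space M. T x \<noteq> S x} \<le> K / n \<and> mixes_at M T n G e)"
proof -
  obtain K :: nat where K: "K \<ge> 1" "\<forall>\<^sub>F n in sequentially. \<exists>U. aut M U \<and>
    (\<forall>x. \<exists>k. U x = ipow S k x \<and> \<bar>k\<bar> \<le> int (K * n)) \<and>
    measure M {x \<in> space M. U (S x) \<noteq> S (U x)} \<le> K / n \<and>
    (\<forall>A\<in>G. \<forall>B\<in>G. \<bar>measure M {x \<in> space M. U x \<in> B \<and> U (ipow S (int n) x) \<in> A} - measure M A * measure M B\<bar> < e)"
    using step[OF G e] by blast
  have "\<forall>\<^sub>F n in sequentially. \<exists>T. erg_aut M C T \<and> orbit_link S T (2 * K * n + 1) \<and>
    measure M {x \<in> space M. T x \<noteq> S x} \<le> K / n \<and> mixes_at M T n G e"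
    using K(2)
  proof eventually_elim
    case (elim n)
    then obtain U where U: "aut M U" and Uk: "\<And>x. \<exists>k. U x = ipow S k x \<and> \<bar>k\<bar> \<le> int (K * n)"
      and Us: "measure M {x \<in> space M. U (S x) \<noteq> S (U x)} \<le> K / n"
      and Um: "\<And>A B. A \<in> G \<Longrightarrow> B \<in> G \<Longrightarrow> \<bar>measure M {x \<in> space M. U x \<in> B \<and> U (ipow S (int n) x) \<in> A} - measure M A * measure M B\<bar> < e"
      by blast
    note bU = autD(1)[OF U] and UU = autD(5,6)[OF U]
    define T where "T x = U (S (inv U x))" for x
    have T: "aut M T" unfolding T_def[abs_def] by (rule aut_comp[OF U aut_comp[OF aut aut_inv[OF U]]])
    note bT = autD(1)[OF T]
    have pT: "ipow T k x = U (ipow S k (inv U x))" for k x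
      unfolding T_def[abs_def] by (rule ipow_conj[OF bijS bU])
    have TU: "T (U x) = U (S x)" for x by (simp add: T_def UU)
    have "ergodic M T"
      unfolding ergodic_def
    proof (intro ballI impI)
      fix A assume A: "A \<in> sets M" "T ` A = A"
      have "T (U x) \<in> A \<longleftrightarrow> U x \<in> A" for x using A(2) bij_image_eq_iff[OF bT] by blast
      then have "S ` (U -` A) = U -` A" unfolding bij_image_eq_iff[OF bijS] TU by simp
      then have "measure M (U -` A) = 0 \<or> measure M (U -` A) = 1"
        using erg aut_vimage(1)[OF U A(1)] unfolding ergodic_def by blast
      then show "measure M A = 0 \<or> measure M A = 1" using aut_vimage(3)[OF U A(1)] by simp
    qed
    then have "erg_aut M C T"
      by (intro erg_aut.intro erg_aut_axioms.intro sep_prob_axioms T atl)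
    moreover have "orbit_link S T (2 * K * n + 1)"
      unfolding orbit_link_def
    proof (intro conjI allI)
      fix x
      obtain j where j: "U (inv U x) = ipow S j (inv U x)" "\<bar>j\<bar> \<le> int (K * n)" using Uk by blast
      obtain k where k: "U (S (inv U x)) = ipow S k (S (inv U x))" "\<bar>k\<bar> \<le> int (K * n)" using Uk by blast
      have "inv U x = ipow S (- j) x" using j(1) bijS UU by (metis ipow_cancel(2))
      then have "T x = ipow S k (ipow S 1 (ipow S (- j) x))" using k(1) by (simp add: T_def)
      then have "T x = ipow S (k + (1 + - j)) x" unfolding ipowS_add[symmetric] .
      moreover have "\<bar>k + (1 + - j)\<bar> \<le> int (2 * K * n + 1)" using j(2) k(2) by simp
      ultimately show "\<exists>k. T x = ipow S k x \<and> \<bar>k\<bar> \<le> int (2 * K * n + 1)" by blast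
    next
      fix x
      \<comment> \<open>Conjugation transports the orbit bound: \<open>U\<close> moves
        \<open>z\<close> along the \<open>T\<close>-orbit by the exponent by which it moves
        \<open>inv U z\<close> along the \<open>S\<close>-orbit.\<close>
      have hU: "\<exists>j. U z = ipow T j z \<and> \<bar>j\<bar> \<le> int (K * n)" for z
      proof -
        obtain j where j: "U (inv U z) = ipow S j (inv U z)" "\<bar>j\<bar> \<le> int (K * n)" using Uk by blast
        then have "U z = ipow T j z" unfolding pT by (simp add: UU)
        then show ?thesis using j(2) by blast
      qed
      obtain j where j: "U x = ipow T j x" "\<bar>j\<bar> \<le> int (K * n)" using hU by blast
      obtain k where k: "U (S x) = ipow T k (S x)" "\<bar>k\<bar> \<le> int (K * n)" using hU by blast
      have "ipow T k (S x) = ipow T 1 (ipow T j x)" using TU[of x] j(1) k(1) by simp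
      then have "S x = ipow T (- k) (ipow T 1 (ipow T j x))" using bT by (metis ipow_cancel(2))
      then have "S x = ipow T (- k + (1 + j)) x" unfolding ipow_add[OF bT] .
      moreover have "\<bar>- k + (1 + j)\<bar> \<le> int (2 * K * n + 1)" using j(2) k(2) by simp
      ultimately show "\<exists>k. S x = ipow T k x \<and> \<bar>k\<bar> \<le> int (2 * K * n + 1)" by blast
    qed
    moreover have "measure M {x \<in> space M. T x \<noteq> S x} \<le> K / n"
    proof -
      have "{x \<in> space M. T x \<noteq> S x} \<in> sets M" by (rule neq_set_measurable[OF autD(2)[OF T] autD(2)[OF aut]])
      moreover have "U -` {x \<in> space M. T x \<noteq> S x} = {x \<in> space M. U (S x) \<noteq> S (U x)}"
        using TU aut_space[OF U] by auto
      ultimately show ?thesis using aut_vimage(3)[OF U] Us by metis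
    qed
    moreover have "mixes_at M T n G e"
      unfolding mixes_at_def
    proof (intro ballI)
      fix A B assume AB: "A \<in> G" "B \<in> G"
      then have s: "A \<in> sets M" "B \<in> sets M" using G(2) by blast+
      have "B \<inter> ipow T (int n) -` A \<in> sets M" using s aut_vimage(1)[OF aut_ipow[OF T]] by blast
      moreover have "U -` (B \<inter> ipow T (int n) -` A) = {x \<in> space M. U x \<in> B \<and> U (ipow S (int n) x) \<in> A}"
        using sets.sets_into_space[OF aut_vimage(1)[OF U s(2)]] by (auto simp: pT UU)
      ultimately show "\<bar>measure M (B \<inter> ipow T (int n) -` A) - measure M A * measure M B\<bar> < e"
        using aut_vimage(3)[OF U] Um[OF AB] by metis
    qed
    ultimately show ?case by blast
  qed
  then show ?thesis using K(1) by blast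
qed

text \<open>A window of powers of both signs is compared, not just the two maps: orbit segments that
  carry the mixing time, the cocycle bounds and the inverse have to survive the later
  stages.\<close>

definition discrepancy :: "('a \<Rightarrow> 'a) \<Rightarrow> ('a \<Rightarrow> 'a) \<Rightarrow> nat \<Rightarrow> 'a set" where
  "discrepancy T T' L = {x \<in> space M. \<exists>i. \<bar>i\<bar> \<le> int L \<and> ipow T' i x \<noteq> ipow T i x}"

text \<open>If the orbit segment of \<open>x\<close> under \<open>T\<close> from \<open>- L\<close>
  to \<open>L\<close> avoids the set where the maps differ, then \<open>T'\<close> follows the same
  path in both directions; the rest is a union bound over \<open>2 * L + 1\<close>
  preimages.\<close>

lemma discrepancy_bound:
  assumes T: "aut M T" "aut M T'"
  shows "discrepancy T T' L \<in> sets M"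
    and "measure M (discrepancy T T' L) \<le> real (2 * L + 1) * measure M {x \<in> space M. T' x \<noteq> T x}"
proof -
  note bT = autD(1)[OF T(1)] and bT' = autD(1)[OF T(2)]
  have eq: "discrepancy T T' L = (\<Union>i\<in>{- int L..int L}. {x \<in> space M. ipow T' i x \<noteq> ipow T i x})"
    unfolding discrepancy_def by force
  show D: "discrepancy T T' L \<in> sets M"
    unfolding eq by (intro sets.finite_UN neq_set_measurable autD(2)[OF aut_ipow[OF T(1)]] autD(2)[OF aut_ipow[OF T(2)]]) auto
  define E where "E = {x \<in> space M. T' x \<noteq> T x}"
  have E: "E \<in> sets M" unfolding E_def by (rule neq_set_measurable[OF autD(2)[OF T(2)] autD(2)[OF T(1)]])
  have sub: "discrepancy T T' L \<subseteq> (\<Union>j\<in>{- int L..int L}. ipow T j -` E)"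
  proof (rule subsetI, rule ccontr)
    fix x assume x: "x \<in> discrepancy T T' L" and nx: "x \<notin> (\<Union>j\<in>{- int L..int L}. ipow T j -` E)"
    have xs: "x \<in> space M" using x by (simp add: discrepancy_def)
    have same: "T' (ipow T j x) = T (ipow T j x)" if "\<bar>j\<bar> \<le> int L" for j
    proof -
      have "j \<in> {- int L..int L}" using that by auto
      then have "ipow T j x \<notin> E" using nx by blast
      then show ?thesis using xs aut_space[OF aut_ipow[OF T(1)], of j x] by (simp add: E_def)
    qed
    have pos: "ipow T' (int i) x = ipow T (int i) x" if "i \<le> L" for i
      using that
    proof (induction i)
      case (Suc i)
      then show ?case
        using ipow_plus1[OF bT, of "int i" x] ipow_plus1[OF bT', of "int i" x] same[of "int i"]
        by (simp add: add.commute)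
    qed simp
    have neg: "ipow T' (- int i) x = ipow T (- int i) x" if "i \<le> L" for i
      using that
    proof (induction i)
      case (Suc i)
      let ?z = "ipow T (- int i - 1) x"
      have Tz: "T ?z = ipow T (- int i) x" using ipow_plus1[OF bT, of "- int i - 1" x] by simp
      have "T' ?z = T ?z" by (rule same) (use Suc.prems in simp)
      then have "T' ?z = ipow T' (- int i) x" using Tz Suc by simp
      then have "inv T' (ipow T' (- int i) x) = ?z" using autD(6)[OF T(2)] by metis
      then have "ipow T' (- int i - 1) x = ?z" by (simp add: ipow_minus1[OF bT'])
      moreover have "- int (Suc i) = - int i - 1" by simp
      ultimately show ?case by (simp only:)
    qed simp
    obtain i where i: "\<bar>i\<bar> \<le> int L" "ipow T' i x \<noteq> ipow T i x" using x by (auto simp: discrepancy_def)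
    have "i = int (nat i) \<or> i = - int (nat (- i))" by auto
    moreover have "nat i \<le> L" "nat (- i) \<le> L" using i(1) by auto
    ultimately show False using pos neg i(2) by metis
  qed
  have s: "ipow T j -` E \<in> sets M" "measure M (ipow T j -` E) = measure M E" for j
    using aut_vimage[OF aut_ipow[OF T(1)] E] by simp_all
  have "measure M (discrepancy T T' L) \<le> measure M (\<Union>j\<in>{- int L..int L}. ipow T j -` E)"
    using s by (intro finite_measure_mono[OF sub] sets.finite_UN) auto
  also have "\<dots> \<le> (\<Sum>j\<in>{- int L..int L}. measure M (ipow T j -` E))"
    using s by (intro finite_measure_subadditive_finite) auto
  also have "\<dots> = real (2 * L + 1) * measure M E" using s by simp
  finally show "measure M (discrepancy T T' L) \<le> real (2 * L + 1) * measure M {x \<in> space M. T' x \<noteq> T x}"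
    unfolding E_def .
qed

text \<open>The factor \<open>ln L\<close> grows like \<open>ln n\<close>, while the measure of the discrepancy decays like \<open>1 / n\<close>.\<close>

lemma next_step:
  assumes L: "L \<ge> 1" and G: "finite G" "G \<subseteq> sets M" and e: "e > 0"
  shows "\<exists>T n L'. erg_aut M C T \<and> orbit_link S T L' \<and> N < n \<and> n \<le> L * L' \<and> L \<le> L * L' \<and>
    measure M (discrepancy S T L) * (1 + ln (1 + real (L * L'))) \<le> e \<and> mixes_at M T n G e"
proof -
  obtain K :: nat where K: "K \<ge> 1" "\<forall>\<^sub>F n in sequentially. \<exists>T. erg_aut M C T \<and> orbit_link S T (2 * K * n + 1) \<and>
    measure M {x \<in> space M. T x \<noteq> S x} \<le> K / n \<and> mixes_at M T n G e"
    using conj_step[OF G e] by blast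
  \<comment> \<open>Chosen so that the new bound \<open>L * L'\<close> satisfies
    \<open>1 + L * L' \<le> H * n\<close>, because \<open>2 * K * n + 1 \<le> 3 * K * n\<close>; its
    logarithm is then at most \<open>ln H + ln n\<close>.\<close>
  define H where "H = real (1 + L * (3 * K))"
  have H: "H > 0" unfolding H_def of_nat_0_less_iff by simp
  have "(\<lambda>n. real ((2 * L + 1) * K) * ((1 + ln H) * (1 / real n) + ln (real n) / real n)) \<longlonglongrightarrow>
      real ((2 * L + 1) * K) * ((1 + ln H) * 0 + 0)"
    by (intro tendsto_intros lim_1_over_n lim_ln_over_n)
  then have "\<forall>\<^sub>F n in sequentially. real ((2 * L + 1) * K) * ((1 + ln H) * (1 / real n) + ln (real n) / real n) < e"
    using e by (intro order_tendstoD(2)) simp_all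
  then have "\<forall>\<^sub>F n in sequentially. (\<exists>T. erg_aut M C T \<and> orbit_link S T (2 * K * n + 1) \<and>
    measure M {x \<in> space M. T x \<noteq> S x} \<le> K / n \<and> mixes_at M T n G e) \<and>
    real ((2 * L + 1) * K) * ((1 + ln H) * (1 / real n) + ln (real n) / real n) < e \<and> N < n"
    using K(2) eventually_gt_at_top[of N] by (intro eventually_conj)
  then obtain n where n: "\<exists>T. erg_aut M C T \<and> orbit_link S T (2 * K * n + 1) \<and>
    measure M {x \<in> space M. T x \<noteq> S x} \<le> K / n \<and> mixes_at M T n G e"
    "real ((2 * L + 1) * K) * ((1 + ln H) * (1 / real n) + ln (real n) / real n) < e" "N < n"
    using eventually_happens'[OF sequentially_bot] by blast
  then obtain T where T: "erg_aut M C T" "orbit_link S T (2 * K * n + 1)"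
    "measure M {x \<in> space M. T x \<noteq> S x} \<le> K / n" "mixes_at M T n G e" by blast
  define L' where "L' = 2 * K * n + 1"
  have n1: "n \<ge> 1" using n(3) by simp
  have LL: "1 + L * L' \<le> (1 + L * (3 * K)) * n"
  proof -
    have "1 \<le> K * n" using K(1) n1 by simp
    then have "L' \<le> 3 * K * n" by (simp add: L'_def)
    then have "L * L' \<le> L * (3 * K * n)" by (rule mult_le_mono2)
    moreover have "(1 + L * (3 * K)) * n = n + L * (3 * K * n)" by (simp add: algebra_simps)
    ultimately show ?thesis using n1 by linarith
  qed
  have "1 + real (L * L') \<le> H * real n"
    using LL unfolding H_def of_nat_mult[symmetric] by linarith
  then have "ln (1 + real (L * L')) \<le> ln (H * real n)" by (rule ln_mono) (intro add_pos_nonneg, simp_all)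
  also have "\<dots> = ln H + ln (real n)" using H n1 by (simp add: ln_mult)
  finally have lnb: "ln (1 + real (L * L')) \<le> ln H + ln (real n)" .
  have "measure M (discrepancy S T L) \<le> real (2 * L + 1) * measure M {x \<in> space M. T x \<noteq> S x}"
    by (rule discrepancy_bound(2)[OF aut]) (rule erg_aut.aut[OF T(1)])
  also have "\<dots> \<le> real (2 * L + 1) * (K / n)" using T(3) by (intro mult_left_mono) auto
  finally have "measure M (discrepancy S T L) * (1 + ln (1 + real (L * L'))) \<le>
      real (2 * L + 1) * (K / n) * (1 + ln (1 + real (L * L')))"
    by (rule mult_right_mono) simp
  also have "\<dots> \<le> real (2 * L + 1) * (K / n) * (1 + (ln H + ln (real n)))"
    using lnb by (intro mult_left_mono) auto
  also have "\<dots> = real ((2 * L + 1) * K) * ((1 + ln H) * (1 / real n) + ln (real n) / real n)"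
    using n1 by (simp add: field_simps)
  also have "\<dots> \<le> e" using n(2) by simp
  finally have "measure M (discrepancy S T L) * (1 + ln (1 + real (L * L'))) \<le> e" .
  moreover have "n \<le> L * L'"
  proof -
    have "1 * n \<le> K * n" using K(1) by (intro mult_le_mono) auto
    then have "n \<le> L'" unfolding L'_def by linarith
    moreover have "1 * L' \<le> L * L'" using L by (intro mult_le_mono) auto
    ultimately show ?thesis by linarith
  qed
  moreover have "L \<le> L * L'" by (simp add: L'_def)
  ultimately show ?thesis using T(1,2,4) n(3) unfolding L'_def by blast
qed

text \<open>The bound \<open>n k \<le> L (Suc k)\<close> places the mixing time in the window that
  later discrepancies protect. The weight contains \<open>L (Suc k)\<close>, the cocycle bound valid
  once step \<open>k\<close> is the last one to affect a point, and its summand 1 makes the measures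
  of the discrepancies summable as well.\<close>

lemma sequence_exists:
  "\<exists>(T :: nat \<Rightarrow> 'a \<Rightarrow> 'a) (L :: nat \<Rightarrow> nat) (n :: nat \<Rightarrow> nat).
    (\<forall>k. aut M (T k) \<and> orbit_link S (T k) (L k) \<and> 1 \<le> L k) \<and>
    (\<forall>k. k < n k \<and> n k \<le> L (Suc k) \<and> L k \<le> L (Suc k) \<and>
      measure M (discrepancy (T k) (T (Suc k)) (L k)) * (1 + ln (1 + real (L (Suc k)))) \<le> (1/2) ^ k \<and>
      mixes_at M (T (Suc k)) (n k) (C ` {..<k}) ((1/2) ^ k))"
proof -
  define P where "P k s = (case s of (T, L, n) \<Rightarrow> erg_aut M C T \<and> orbit_link S T L \<and> 1 \<le> L)"
    for k :: nat and s :: "('a \<Rightarrow> 'a) \<times> nat \<times> nat"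
  define R where "R k s t = (case s of (T, L, n) \<Rightarrow> case t of (T', L', n') \<Rightarrow> k < n' \<and> n' \<le> L' \<and> L \<le> L' \<and>
    measure M (discrepancy T T' L) * (1 + ln (1 + real L')) \<le> (1/2) ^ k \<and>
    mixes_at M T' n' (C ` {..<k}) ((1/2) ^ k))" for k and s t :: "('a \<Rightarrow> 'a) \<times> nat \<times> nat"
  have "\<exists>f. \<forall>k. P k (f k) \<and> R k (f k) (f (Suc k))"
  proof (rule dependent_nat_choice)
    have "orbit_link S S 1" unfolding orbit_link_def by (intro conjI allI exI[of _ 1]) auto
    then have "P 0 (S, 1, 0)" using erg_aut_axioms by (simp add: P_def)
    then show "\<exists>s. P 0 s" by blast
  next
    fix s k assume "P k s"
    then obtain T L n where s: "s = (T, L, n)" "erg_aut M C T" "orbit_link S T L" "1 \<le> L"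
      by (cases s) (auto simp: P_def)
    interpret T: erg_aut M C T by fact
    have G: "finite (C ` {..<k})" "C ` {..<k} \<subseteq> sets M" using C_sets by auto
    have e: "(1/2::real) ^ k > 0" by simp
    obtain T' n' L' where T': "erg_aut M C T'" "orbit_link T T' L'" "k < n'" "n' \<le> L * L'" "L \<le> L * L'"
      "measure M (discrepancy T T' L) * (1 + ln (1 + real (L * L'))) \<le> (1/2) ^ k"
      "mixes_at M T' n' (C ` {..<k}) ((1/2) ^ k)"
      using T.next_step[OF s(4) G e] by blast
    have "orbit_link S T' (L * L')"
      using orbit_link_trans[OF bijS T.bijS erg_aut.bijS[OF T'(1)] s(3) T'(2)] .
    then have "P (Suc k) (T', L * L', n')" using T'(1,5) s(4) by (simp add: P_def)
    moreover have "R k s (T', L * L', n')" using T'(3-7) s(1) by (simp add: R_def)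
    ultimately show "\<exists>t. P (Suc k) t \<and> R k s t" by blast
  qed
  then obtain f where f: "\<And>k. P k (f k)" "\<And>k. R k (f k) (f (Suc k))" by blast
  define T where "T k = fst (f k)" for k
  define L where "L k = fst (snd (f k))" for k
  \<comment> \<open>The time at which step \<open>k\<close> mixes is stored with the map that the
    step produces, hence the shift.\<close>
  define n where "n k = snd (snd (f (Suc k)))" for k
  show ?thesis
  proof (rule exI[of _ T], rule exI[of _ L], rule exI[of _ n], intro conjI allI)
    fix k
    show "aut M (T k)" "orbit_link S (T k) (L k)" "1 \<le> L k"
      using f(1)[of k] erg_aut.aut by (auto simp: P_def T_def L_def case_prod_beta)
  qed (use f(2) in \<open>simp_all add: R_def T_def L_def n_def case_prod_beta\<close>)
qed

end

section \<open>The limit transformation and its weak mixing\<close>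

lemma (in prob_space) measure_le_Un:
  assumes "A \<subseteq> B \<union> W" "B \<in> sets M" "W \<in> sets M"
  shows "measure M A \<le> measure M B + measure M W"
  using finite_measure_mono[OF assms(1) sets.Un[OF assms(2,3)]] measure_Un_le[OF assms(2,3)] by linarith

context erg_aut
begin

text \<open>By Borel-Cantelli along whole orbits, the maps \<open>T k\<close> are eventually
  constant at almost every point. The inverses stabilise too, as the windows contain the exponent
  -1, so the limit is bijective; \<open>aut_full_group\<close> then gives measure preservation. The
  sets \<open>D k\<close> stay in the conclusion for the entropy estimate.\<close>

lemma limit_exists:
  "\<exists>T D L. aut M T \<and> (\<forall>x. \<exists>i. T x = ipow S i x) \<and> (\<forall>x. \<exists>i. S x = ipow T i x) \<and>
    (\<forall>k. D k \<in> sets M \<and> measure M (D k) * (1 + ln (1 + real (L (Suc k)))) \<le> (1/2) ^ k) \<and>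
    (AE x in M. \<exists>k. \<forall>j\<ge>k. x \<notin> D j) \<and>
    (AE x in M. \<forall>k. (\<forall>j\<ge>k. x \<notin> D j) \<longrightarrow>
      (\<exists>i. T x = ipow S i x \<and> \<bar>i\<bar> \<le> int (L k)) \<and> (\<exists>i. S x = ipow T i x \<and> \<bar>i\<bar> \<le> int (L k))) \<and>
    (\<forall>k. \<exists>n>k. mixes_at M T n (C ` {..<k}) (2 * (1/2) ^ k))"
proof -
  obtain T L n where seq: "(\<forall>k. aut M (T k) \<and> orbit_link S (T k) (L k) \<and> 1 \<le> L k) \<and>
    (\<forall>k. k < n k \<and> n k \<le> L (Suc k) \<and> L k \<le> L (Suc k) \<and>
      measure M (discrepancy (T k) (T (Suc k)) (L k)) * (1 + ln (1 + real (L (Suc k)))) \<le> (1/2) ^ k \<and>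
      mixes_at M (T (Suc k)) (n k) (C ` {..<k}) ((1/2) ^ k))"
    using sequence_exists by (elim exE)
  define D where "D k = discrepancy (T k) (T (Suc k)) (L k)" for k
  have T: "\<And>k. aut M (T k)" "\<And>k. orbit_link S (T k) (L k)" "\<And>k. 1 \<le> L k" using seq by blast+
  have nk: "\<And>k. k < n k" "\<And>k. n k \<le> L (Suc k)" "\<And>k. L k \<le> L (Suc k)"
    "\<And>k. mixes_at M (T (Suc k)) (n k) (C ` {..<k}) ((1/2) ^ k)" using seq by blast+
  have DL: "measure M (D k) * (1 + ln (1 + real (L (Suc k)))) \<le> (1/2) ^ k" for k
    using seq unfolding D_def by blast
  note bT = autD(1)[OF T(1)]
  have Torb: "\<exists>i. T k x = ipow S i x" for k x using T(2)[of k] unfolding orbit_link_def by blast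
  have Lmono: "L j \<le> L k" if "j \<le> k" for j k using nk(3) that by (rule lift_Suc_mono_le)
  have D [measurable]: "D k \<in> sets M" for k unfolding D_def by (rule discrepancy_bound(1)[OF T(1) T(1)])
  have Dm: "measure M (D k) \<le> (1/2) ^ k" for k
  proof -
    have "measure M (D k) * 1 \<le> measure M (D k) * (1 + ln (1 + real (L (Suc k))))"
      by (intro mult_left_mono) auto
    then show ?thesis using DL[of k] by simp
  qed
  have sumD: "summable (\<lambda>k. measure M (D k))"
    by (rule summable_comparison_test_ev[OF _ summable_geometric[of "1/2 :: real"]]) (use Dm in auto)
  have ev: "AE x in M. \<forall>\<^sub>F k in sequentially. x \<in> space M - D k"
    using D sumD by (intro borel_cantelli_AE1) (auto simp: less_top[symmetric])
  \<comment> \<open>\<open>X0\<close> is conull and \<open>S\<close>-invariant, and \<open>T k\<close> stabilises along the whole orbit of each of its points.\<close>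
  define X0 where "X0 = {x \<in> space M. \<forall>i. \<exists>K. \<forall>k\<ge>K. ipow S i x \<notin> D k}"
  have X0: "X0 \<in> sets M" unfolding X0_def by measurable
  have X0_inv: "ipow S j x \<in> X0" if "x \<in> X0" for j x
    using that unfolding X0_def by (simp add: ipowS_add[symmetric])
  have "AE x in M. \<forall>i. \<forall>\<^sub>F k in sequentially. ipow S i x \<in> space M - D k"
    unfolding AE_all_countable using aut_AE[OF aut_ipow[OF aut] ev] by blast
  then have aeX0: "AE x in M. x \<in> X0"
    using AE_space by eventually_elim (auto simp: X0_def eventually_sequentially)
  have ex0: "\<exists>K. \<forall>k\<ge>K. x \<notin> D k" if "x \<in> X0" for x
  proof -
    have "\<forall>i. \<exists>K. \<forall>k\<ge>K. ipow S i x \<notin> D k" using that by (simp add: X0_def)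
    from spec[OF this, of 0] show ?thesis by simp
  qed
  have stab: "ipow (T j) i x = ipow (T k) i x"
    if x: "x \<in> space M" "\<forall>j\<ge>k. x \<notin> D j" and i: "\<bar>i\<bar> \<le> int (L k)" and j: "k \<le> j" for x i j k
    using j
  proof (induction j rule: dec_induct)
    case (step j)
    have "\<bar>i\<bar> \<le> int (L j)" using i Lmono[OF step(1)] by linarith
    moreover have "x \<notin> D j" using x(2) step(1) by blast
    ultimately have "ipow (T (Suc j)) i x = ipow (T j) i x"
      using x(1) unfolding D_def discrepancy_def by blast
    then show ?case using step.IH by simp
  qed simp
  \<comment> \<open>Any index beyond the last \<open>D k\<close> containing \<open>x\<close> gives
    the same value. The default \<open>S\<close> keeps the orbit statements true everywhere, and
    bijectivity survives because \<open>X0\<close> and its complement are both invariant.\<close>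
  define Tl where "Tl x = (if x \<in> X0 then T (SOME K. \<forall>k\<ge>K. x \<notin> D k) x else S x)" for x
  have Tl_ev: "\<forall>\<^sub>F k in sequentially. T k x = Tl x" if x: "x \<in> X0" for x
  proof -
    define K where "K = (SOME K. \<forall>k\<ge>K. x \<notin> D k)"
    have K: "\<forall>k\<ge>K. x \<notin> D k" unfolding K_def by (rule someI_ex[OF ex0[OF x]])
    have xs: "x \<in> space M" using x by (simp add: X0_def)
    have "T k x = Tl x" if "k \<ge> K" for k
      using stab[OF xs K, of 1 k] T(3)[of K] that x by (simp add: Tl_def K_def)
    then show ?thesis unfolding eventually_sequentially by blast
  qed
  have Tl_orb: "\<exists>i. Tl x = ipow S i x" for x
  proof (cases "x \<in> X0")
    case True
    then show ?thesis using Torb by (simp add: Tl_def)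
  next
    case False
    then show ?thesis by (intro exI[of _ 1]) (simp add: Tl_def)
  qed
  have Tl_X0: "Tl x \<in> X0 \<longleftrightarrow> x \<in> X0" for x
  proof
    obtain i where i: "Tl x = ipow S i x" using Tl_orb by blast
    show "x \<in> X0 \<Longrightarrow> Tl x \<in> X0" unfolding i by (rule X0_inv)
    assume "Tl x \<in> X0"
    from X0_inv[OF this, of "- i"] show "x \<in> X0" unfolding i using bijS by simp
  qed
  \<comment> \<open>Surjectivity is not automatic for a pointwise limit; it holds because
    \<open>inv (T k)\<close> is also eventually constant at \<open>y\<close>.\<close>
  have Tl_inv: "\<exists>z\<in>X0. Tl z = y \<and> (\<forall>\<^sub>F k in sequentially. inv (T k) y = z)" if y: "y \<in> X0" for y
  proof -
    obtain K where K: "\<forall>k\<ge>K. y \<notin> D k" using ex0[OF y] by blast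
    have ys: "y \<in> space M" using y by (simp add: X0_def)
    define z where "z = inv (T K) y"
    have kz: "inv (T k) y = z" if "k \<ge> K" for k
      using stab[OF ys K, of "-1" k] T(3)[of K] that by (simp add: z_def)
    then have Tz: "T k z = y" if "k \<ge> K" for k using that autD(5)[OF T(1)] by metis
    obtain i where "T K z = ipow S i z" using Torb by blast
    then have "z = ipow S (- i) y" using Tz[of K] bijS by simp
    then have z: "z \<in> X0" using X0_inv[OF y] by simp
    obtain k where "k \<ge> K" "T k z = Tl z"
      using eventually_conj[OF Tl_ev[OF z] eventually_ge_at_top[of K]]
      by (auto simp: eventually_sequentially)
    then have "Tl z = y" using Tz by simp
    then show ?thesis using z kz unfolding eventually_sequentially by blast
  qed
  have "inj Tl"
  proof (rule injI)
    fix x y assume eq: "Tl x = Tl y"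
    show "x = y"
    proof (cases "x \<in> X0")
      case True
      then have y: "y \<in> X0" using eq Tl_X0 by metis
      obtain k where "T k x = Tl x" "T k y = Tl y"
        using eventually_conj[OF Tl_ev[OF True] Tl_ev[OF y]] by (auto simp: eventually_sequentially)
      then have "T k x = T k y" using eq by simp
      then show ?thesis using bT[of k] by (simp add: bij_is_inj inj_eq)
    next
      case False
      then have "y \<notin> X0" using eq Tl_X0 by metis
      then have "S x = S y" using eq False by (simp add: Tl_def)
      then show ?thesis using bijS by (simp add: bij_is_inj inj_eq)
    qed
  qed
  moreover have "surj Tl"
    unfolding surj_def
  proof (rule allI)
    fix y
    show "\<exists>x. y = Tl x"
    proof (cases "y \<in> X0")
      case True
      then show ?thesis using Tl_inv by metis
    next
      case False
      have "inv S y \<notin> X0"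
      proof
        assume "inv S y \<in> X0"
        from X0_inv[OF this, of 1] show False using False autD(5)[OF aut] by simp
      qed
      then have "Tl (inv S y) = y" using autD(5)[OF aut] by (simp add: Tl_def)
      then show ?thesis by metis
    qed
  qed
  ultimately have bTl: "bij Tl" by (simp add: bij_def)
  have "Tl \<in> measurable M M"
  proof (rule measurableI)
    show "Tl x \<in> space M" if "x \<in> space M" for x
      using Tl_orb[of x] that by auto
    fix A assume A: "A \<in> sets M"
    have TA: "T k -` A \<in> sets M" for k by (rule aut_vimage(1)[OF T(1) A])
    have SA: "S -` A \<in> sets M" by (rule aut_vimage(1)[OF aut A])
    \<comment> \<open>On \<open>X0\<close> the sequence is eventually constant, so the preimage is
      the lower limit of the preimages under \<open>T k\<close>.\<close>
    have "Tl -` A \<inter> space M = (X0 \<inter> (\<Union>K. \<Inter>k\<in>{K..}. T k -` A)) \<union> (S -` A - X0)"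
    proof (intro set_eqI)
      fix x
      show "x \<in> Tl -` A \<inter> space M \<longleftrightarrow> x \<in> (X0 \<inter> (\<Union>K. \<Inter>k\<in>{K..}. T k -` A)) \<union> (S -` A - X0)"
      proof (cases "x \<in> X0")
        case True
        then have xs: "x \<in> space M" by (simp add: X0_def)
        obtain N where N: "\<And>k. k \<ge> N \<Longrightarrow> T k x = Tl x"
          using Tl_ev[OF True] by (auto simp: eventually_sequentially)
        have "Tl x \<in> A \<longleftrightarrow> (\<exists>K. \<forall>k\<ge>K. T k x \<in> A)"
        proof
          assume "Tl x \<in> A" then show "\<exists>K. \<forall>k\<ge>K. T k x \<in> A" using N by metis
        next
          assume "\<exists>K. \<forall>k\<ge>K. T k x \<in> A"
          then obtain K where "\<forall>k\<ge>K. T k x \<in> A" by blast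
          then have "T (max K N) x \<in> A" by simp
          then show "Tl x \<in> A" using N[of "max K N"] by simp
        qed
        then show ?thesis using True xs by auto
      next
        case False
        then have "x \<in> Tl -` A \<inter> space M \<longleftrightarrow> x \<in> S -` A"
          using sets.sets_into_space[OF SA] by (auto simp: Tl_def)
        then show ?thesis using False by blast
      qed
    qed
    also have "\<dots> \<in> sets M" using X0 TA SA by (intro sets.Un sets.Int sets.Diff sets.countable_UN' sets.countable_INT') auto
    finally show "Tl -` A \<inter> space M \<in> sets M" .
  qed
  then have aTl: "aut M Tl" using bTl Tl_orb by (intro aut_full_group[OF aut]) blast+
  have pow_ev: "\<forall>\<^sub>F k in sequentially. ipow (T k) i x = ipow Tl i x" and pow_X0: "ipow Tl i x \<in> X0"
    if x: "x \<in> X0" for i x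
  proof -
    have "(\<forall>\<^sub>F k in sequentially. ipow (T k) i x = ipow Tl i x) \<and> ipow Tl i x \<in> X0"
    proof (induction i rule: int_induct[where k = 0])
      case base
      then show ?case using x by simp
    next
      case (step1 i)
      then have y: "ipow Tl i x \<in> X0" by blast
      have "\<forall>\<^sub>F k in sequentially. ipow (T k) (i + 1) x = ipow Tl (i + 1) x"
        using conjunct1[OF step1.IH] Tl_ev[OF y]
        by eventually_elim (simp add: ipow_plus1[OF bT] ipow_plus1[OF bTl])
      then show ?case using Tl_X0 y by (simp add: ipow_plus1[OF bTl])
    next
      case (step2 i)
      then have y: "ipow Tl i x \<in> X0" by blast
      obtain z where z: "z \<in> X0" "Tl z = ipow Tl i x" "\<forall>\<^sub>F k in sequentially. inv (T k) (ipow Tl i x) = z"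
        using Tl_inv[OF y] by blast
      have zi: "ipow Tl (i - 1) x = z"
        unfolding ipow_minus1[OF bTl] z(2)[symmetric] by (rule autD(6)[OF aTl])
      have "\<forall>\<^sub>F k in sequentially. ipow (T k) (i - 1) x = ipow Tl (i - 1) x"
        using conjunct1[OF step2.IH] z(3)
        by eventually_elim (simp add: ipow_minus1[OF bT] zi)
      then show ?case using z(1) zi by simp
    qed
    then show "\<forall>\<^sub>F k in sequentially. ipow (T k) i x = ipow Tl i x" "ipow Tl i x \<in> X0" by blast+
  qed
  have pow_stab: "ipow Tl i x = ipow (T k) i x"
    if x: "x \<in> X0" "\<forall>j\<ge>k. x \<notin> D j" and i: "\<bar>i\<bar> \<le> int (L k)" for i x k
  proof -
    have xs: "x \<in> space M" using x by (simp add: X0_def)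
    obtain j where "j \<ge> k" "ipow (T j) i x = ipow Tl i x"
      using eventually_happens'[OF sequentially_bot eventually_conj[OF pow_ev[OF x(1), of i] eventually_ge_at_top[of k]]]
      by blast
    then show ?thesis using stab[OF xs x(2) i, of j] by (simp only:)
  qed
  have bounds: "(\<exists>i. Tl x = ipow S i x \<and> \<bar>i\<bar> \<le> int (L k)) \<and> (\<exists>i. S x = ipow Tl i x \<and> \<bar>i\<bar> \<le> int (L k))"
    if x: "x \<in> X0" "\<forall>j\<ge>k. x \<notin> D j" for x k
  proof
    have "Tl x = T k x" using pow_stab[OF x, of 1] T(3)[of k] by simp
    then show "\<exists>i. Tl x = ipow S i x \<and> \<bar>i\<bar> \<le> int (L k)" using T(2)[of k] by (simp add: orbit_link_def)
    obtain i where i: "S x = ipow (T k) i x" "\<bar>i\<bar> \<le> int (L k)" using T(2)[of k] by (auto simp: orbit_link_def)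
    then show "\<exists>i. S x = ipow Tl i x \<and> \<bar>i\<bar> \<le> int (L k)" using pow_stab[OF x i(2)] i by (intro exI[of _ i]) simp
  qed
  have S_orb: "\<exists>i. S x = ipow Tl i x" for x
  proof (cases "x \<in> X0")
    case True
    then obtain k where "\<forall>j\<ge>k. x \<notin> D j" using ex0 by blast
    then show ?thesis using bounds[OF True] by blast
  next
    case False
    then show ?thesis by (intro exI[of _ 1]) (simp add: Tl_def)
  qed
  have tail: "(\<Union>j. D (j + k)) \<in> sets M" "measure M (\<Union>j. D (j + k)) \<le> 2 * (1/2) ^ k" for k
  proof -
    show "(\<Union>j. D (j + k)) \<in> sets M" using D by auto
    have sD: "summable (\<lambda>j. measure M (D (j + k)))" using sumD by (subst summable_iff_shift)
    have sg: "summable (\<lambda>j. (1/2::real) ^ (j + k))" by (simp add: summable_iff_shift summable_geometric)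
    have "measure M (\<Union>j. D (j + k)) \<le> (\<Sum>j. measure M (D (j + k)))"
      using D sD by (intro finite_measure_subadditive_countably) auto
    also have "\<dots> \<le> (\<Sum>j. (1/2) ^ (j + k))" by (rule suminf_le[OF Dm sD sg])
    also have "\<dots> = (\<Sum>j. (1/2) ^ j * (1/2) ^ k)" by (simp only: power_add)
    also have "\<dots> = (\<Sum>j. (1/2) ^ j) * (1/2) ^ k"
      by (rule suminf_mult2[symmetric]) (simp add: summable_geometric)
    also have "\<dots> = 2 * (1/2) ^ k" by (simp add: suminf_geometric)
    finally show "measure M (\<Union>j. D (j + k)) \<le> 2 * (1/2) ^ k" .
  qed
  have mix: "mixes_at M Tl (n k) (C ` {..<k}) (2 * (1/2) ^ k)" for k
    unfolding mixes_at_def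
  proof (intro ballI)
    fix A B assume AB: "A \<in> C ` {..<k}" "B \<in> C ` {..<k}"
    then have s: "A \<in> sets M" "B \<in> sets M" using C_sets by auto
    let ?V = "ipow Tl (int (n k))" and ?W = "ipow (T (Suc k)) (int (n k))"
    \<comment> \<open>Outside this set the limit and \<open>T (Suc k)\<close> have the same power
      \<open>n k\<close>. The tail from \<open>Suc k\<close> on has measure at most
      \<open>(1/2) ^ k\<close>, and the mixing error of stage \<open>k\<close> contributes as much
      again.\<close>
    let ?N = "(\<Union>j. D (j + Suc k)) \<union> (space M - X0)"
    have same: "?V x = ?W x" if "x \<in> space M" "x \<notin> ?N" for x
    proof (rule pow_stab)
      show "x \<in> X0" using that by blast
      show "\<forall>j\<ge>Suc k. x \<notin> D j"
      proof (intro allI impI)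
        fix j assume "j \<ge> Suc k"
        then obtain i where "j = i + Suc k" by (metis le_add_diff_inverse2)
        then show "x \<notin> D j" using that(2) by blast
      qed
      show "\<bar>int (n k)\<bar> \<le> int (L (Suc k))" using nk(2)[of k] by simp
    qed
    have V: "B \<inter> ?V -` A \<in> sets M" and W: "B \<inter> ?W -` A \<in> sets M"
      using s aut_vimage(1)[OF aut_ipow[OF aTl] s(1)] aut_vimage(1)[OF aut_ipow[OF T(1)] s(1)] by blast+
    have Ns: "?N \<in> sets M" using tail(1)[of "Suc k"] X0 by blast
    have "measure M (space M - X0) = 0"
    proof -
      have "measure M X0 = 1" using aeX0 X0 by (simp add: AE_in_set_eq_1)
      then show ?thesis using prob_compl[OF X0] by simp
    qed
    then have "measure M ?N \<le> 2 * (1/2) ^ Suc k + 0"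
      using measure_Un_le[OF tail(1)[of "Suc k"] sets.compl_sets[OF X0]] tail(2)[of "Suc k"] by linarith
    then have mN: "measure M ?N \<le> (1/2) ^ k" by simp
    have "B \<inter> ?V -` A \<subseteq> (B \<inter> ?W -` A) \<union> ?N" "B \<inter> ?W -` A \<subseteq> (B \<inter> ?V -` A) \<union> ?N"
      using same sets.sets_into_space[OF s(2)] by auto
    from measure_le_Un[OF this(1) W Ns] measure_le_Un[OF this(2) V Ns]
    have "\<bar>measure M (B \<inter> ?V -` A) - measure M (B \<inter> ?W -` A)\<bar> \<le> (1/2) ^ k" using mN by linarith
    moreover have "\<bar>measure M (B \<inter> ?W -` A) - measure M A * measure M B\<bar> < (1/2) ^ k"
      using nk(4)[of k] AB by (auto simp: mixes_at_def)
    ultimately show "\<bar>measure M (B \<inter> ?V -` A) - measure M A * measure M B\<bar> < 2 * (1/2) ^ k" by linarith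
  qed
  have ae1: "AE x in M. \<exists>k. \<forall>j\<ge>k. x \<notin> D j"
    using aeX0 by eventually_elim (rule ex0)
  have ae2: "AE x in M. \<forall>k. (\<forall>j\<ge>k. x \<notin> D j) \<longrightarrow>
      (\<exists>i. Tl x = ipow S i x \<and> \<bar>i\<bar> \<le> int (L k)) \<and> (\<exists>i. S x = ipow Tl i x \<and> \<bar>i\<bar> \<le> int (L k))"
    using aeX0 by eventually_elim (use bounds in blast)
  have mix': "\<forall>k. \<exists>n>k. mixes_at M Tl n (C ` {..<k}) (2 * (1/2) ^ k)" using mix nk(1) by blast
  have DD: "\<forall>k. D k \<in> sets M \<and> measure M (D k) * (1 + ln (1 + real (L (Suc k)))) \<le> (1/2) ^ k"
    using D DL by blast
  show ?thesis
    by (rule exI[of _ Tl], rule exI[of _ D], rule exI[of _ L])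
      (intro conjI aTl ae1 ae2 mix' DD allI Tl_orb S_orb)
qed

text \<open>Each set is replaced by some \<open>C i\<close> within \<open>e / 8\<close>. This costs
  \<open>e / 4\<close> in the measure of the intersection and \<open>e / 4\<close> in the product,
  leaving \<open>e / 2\<close> for the mixing of the approximants, which are among the first
  \<open>k\<close> sets for large \<open>k\<close>.\<close>

lemma weak_mixing_dense:
  assumes T: "aut M T" and mix: "\<And>k. \<exists>n>k. mixes_at M T n (C ` {..<k}) (2 * (1/2) ^ k)"
    and F: "finite F" "F \<subseteq> sets M" and e: "e > 0"
  shows "\<exists>n>N. \<forall>A\<in>F. \<forall>B\<in>F. \<bar>measure M (B \<inter> ipow T (int n) -` A) - measure M A * measure M B\<bar> < e"
proof -
  have "\<forall>A\<in>F. \<exists>i. measure M (sym_diff A (C i)) < e / 8"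
    using F(2) e by (intro ballI C_dense) auto
  then obtain c where c: "\<And>A. A \<in> F \<Longrightarrow> measure M (sym_diff A (C (c A))) < e / 8" by metis
  have "(\<lambda>k. 2 * (1/2::real) ^ k) \<longlonglongrightarrow> 2 * 0" by (intro tendsto_intros LIMSEQ_realpow_zero) auto
  from order_tendstoD(2)[OF this, of "e / 2"]
  have "\<forall>\<^sub>F k in sequentially. 2 * (1/2::real) ^ k < e / 2" using e by simp
  moreover have "\<forall>\<^sub>F k in sequentially. \<forall>A\<in>F. c A < k"
    using F(1) by (intro eventually_ball_finite ballI eventually_gt_at_top)
  ultimately have "\<forall>\<^sub>F k in sequentially. 2 * (1/2::real) ^ k < e / 2 \<and> (\<forall>A\<in>F. c A < k) \<and> N \<le> k"
    using eventually_ge_at_top[of N] by (intro eventually_conj)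
  then obtain k where k: "2 * (1/2::real) ^ k < e / 2" "\<forall>A\<in>F. c A < k" "N \<le> k"
    by (auto simp: eventually_sequentially)
  obtain n where n: "n > k" "mixes_at M T n (C ` {..<k}) (2 * (1/2) ^ k)" using mix by blast
  have "\<bar>measure M (B \<inter> ipow T (int n) -` A) - measure M A * measure M B\<bar> < e" if A: "A \<in> F" and B: "B \<in> F" for A B
  proof -
    let ?A = "C (c A)" and ?B = "C (c B)" and ?V = "ipow T (int n)"
    have As: "A \<in> sets M" "B \<in> sets M" "?A \<in> sets M" "?B \<in> sets M" using A B F(2) C_sets by auto
    have dA: "sym_diff A ?A \<in> sets M" "sym_diff B ?B \<in> sets M" using As by auto
    have VA: "?V -` X \<in> sets M" "measure M (?V -` X) = measure M X" if "X \<in> sets M" for X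
      using aut_vimage[OF aut_ipow[OF T] that] by simp_all
    have W: "?V -` sym_diff A ?A \<union> sym_diff B ?B \<in> sets M" using VA(1)[OF dA(1)] dA(2) by blast
    have "measure M (?V -` sym_diff A ?A \<union> sym_diff B ?B) \<le> measure M (sym_diff A ?A) + measure M (sym_diff B ?B)"
      using measure_Un_le[OF VA(1)[OF dA(1)] dA(2)] VA(2)[OF dA(1)] by simp
    then have mW: "measure M (?V -` sym_diff A ?A \<union> sym_diff B ?B) < e / 4"
      using c[OF A] c[OF B] by linarith
    have s1: "B \<inter> ?V -` A \<in> sets M" "?B \<inter> ?V -` ?A \<in> sets M"
      by (intro sets.Int As VA(1))+
    have "B \<inter> ?V -` A \<subseteq> (?B \<inter> ?V -` ?A) \<union> (?V -` sym_diff A ?A \<union> sym_diff B ?B)"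
      "?B \<inter> ?V -` ?A \<subseteq> (B \<inter> ?V -` A) \<union> (?V -` sym_diff A ?A \<union> sym_diff B ?B)" by blast+
    from measure_le_Un[OF this(1) s1(2) W] measure_le_Un[OF this(2) s1(1) W]
    have 1: "\<bar>measure M (B \<inter> ?V -` A) - measure M (?B \<inter> ?V -` ?A)\<bar> < e / 4" using mW by linarith
    have inC: "?A \<in> C ` {..<k}" "?B \<in> C ` {..<k}" using k(2) A B by auto
    from n(2)[unfolded mixes_at_def, rule_format, OF inC] k(1)
    have 2: "\<bar>measure M (?B \<inter> ?V -` ?A) - measure M ?A * measure M ?B\<bar> < e / 2" by linarith
    have diff: "\<bar>measure M X - measure M Y\<bar> < e / 8"
      if "X \<in> sets M" "Y \<in> sets M" "sym_diff X Y \<in> sets M" "measure M (sym_diff X Y) < e / 8" for X Y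
    proof -
      have "X \<subseteq> Y \<union> sym_diff X Y" "Y \<subseteq> X \<union> sym_diff X Y" by blast+
      from measure_le_Un[OF this(1) that(2,3)] measure_le_Un[OF this(2) that(1,3)] show ?thesis
        using that(4) by linarith
    qed
    have dd: "\<bar>measure M A - measure M ?A\<bar> < e / 8" "\<bar>measure M B - measure M ?B\<bar> < e / 8"
      using diff[OF As(1,3) dA(1) c[OF A]] diff[OF As(2,4) dA(2) c[OF B]] by simp_all
    have "\<bar>measure M A * measure M B - measure M ?A * measure M ?B\<bar>
        = \<bar>measure M A * (measure M B - measure M ?B) + (measure M A - measure M ?A) * measure M ?B\<bar>"
      by (simp add: algebra_simps)
    also have "\<dots> \<le> measure M A * \<bar>measure M B - measure M ?B\<bar> + \<bar>measure M A - measure M ?A\<bar> * measure M ?B"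
      by (rule order_trans[OF abs_triangle_ineq]) (simp add: abs_mult)
    also have "\<dots> \<le> 1 * \<bar>measure M B - measure M ?B\<bar> + \<bar>measure M A - measure M ?A\<bar> * 1"
      by (intro add_mono mult_left_mono mult_right_mono) auto
    also have "\<dots> < e / 8 + e / 8" unfolding mult_1 mult_1_right by (rule add_strict_mono[OF dd(2,1)])
    finally have 3: "\<bar>measure M A * measure M B - measure M ?A * measure M ?B\<bar> < e / 4" by simp
    show ?thesis using 1 2 3 by linarith
  qed
  then show ?thesis using n(1) k(3) by (intro exI[of _ n]) auto
qed

end

section \<open>Finite entropy from a logarithmic moment\<close>

text \<open>A partition given as a range identifies equal members, in particular all empty ones, so
  summing over the indices can only give more.\<close>

lemma nn_integral_count_space_range_le:
  fixes g :: "'b \<Rightarrow> ennreal"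
  shows "(\<integral>\<^sup>+y. g y \<partial>count_space (range f)) \<le> (\<integral>\<^sup>+x. g (f x) \<partial>count_space UNIV)"
proof -
  let ?h = "inv_into UNIV f" and ?J = "inv_into UNIV f ` range f"
  have fh: "f (?h y) = y" if "y \<in> range f" for y using that by (rule f_inv_into_f)
  have "bij_betw ?h (range f) ?J" using inj_on_inv_into[of "range f" f UNIV] by (simp add: bij_betw_def)
  from nn_integral_bij_count_space[OF this, of "\<lambda>x. g (f x)"]
  have "(\<integral>\<^sup>+y. g (f (?h y)) \<partial>count_space (range f)) = (\<integral>\<^sup>+x. g (f x) \<partial>count_space ?J)" .
  moreover have "(\<integral>\<^sup>+y. g (f (?h y)) \<partial>count_space (range f)) = (\<integral>\<^sup>+y. g y \<partial>count_space (range f))"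
    by (rule nn_integral_cong) (simp only: space_count_space fh)
  moreover have "(\<integral>\<^sup>+x. g (f x) \<partial>count_space ?J) = (\<integral>\<^sup>+x. g (f x) * indicator ?J x \<partial>count_space UNIV)"
    by (rule nn_integral_count_space_indicator) simp
  moreover have "(\<integral>\<^sup>+x. g (f x) * indicator ?J x \<partial>count_space UNIV) \<le> (\<integral>\<^sup>+x. g (f x) \<partial>count_space UNIV)"
    by (rule nn_integral_mono) (simp add: indicator_def)
  ultimately show ?thesis by simp
qed

lemma nn_integral_int_inverse_square:
  "(\<integral>\<^sup>+j. ennreal (1 / (1 + real_of_int \<bar>j\<bar>)\<^sup>2) \<partial>count_space UNIV) < \<infinity>"
proof -
  \<comment> \<open>The absolute value of \<open>int_decode n\<close> is at least
    \<open>n / 2\<close>, which gives the factor 4 after squaring.\<close>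
  have le: "1 / (1 + real_of_int \<bar>int_decode n\<bar>)\<^sup>2 \<le> 4 * (1 / (real n + 1)\<^sup>2)" for n
  proof -
    have "real n + 1 \<le> 2 * (1 + real_of_int \<bar>int_decode n\<bar>)"
      by (cases "even n") (auto simp: int_decode_def sum_decode_def elim!: evenE oddE)
    then have "(real n + 1)\<^sup>2 \<le> (2 * (1 + real_of_int \<bar>int_decode n\<bar>))\<^sup>2" by (intro power_mono) auto
    then have "(real n + 1)\<^sup>2 \<le> 4 * (1 + real_of_int \<bar>int_decode n\<bar>)\<^sup>2" by (simp only: power_mult_distrib) simp
    moreover have "0 < (real n + 1)\<^sup>2" "0 < (1 + real_of_int \<bar>int_decode n\<bar>)\<^sup>2" by (simp_all add: add_nonneg_pos)
    ultimately show ?thesis by (simp add: divide_simps)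
  qed
  have s: "summable (\<lambda>n. 4 * (1 / (real n + 1)\<^sup>2))"
    using sums_summable[OF inverse_squares_sums] by (intro summable_mult) (simp add: add.commute)
  have "(\<integral>\<^sup>+j. ennreal (1 / (1 + real_of_int \<bar>j\<bar>)\<^sup>2) \<partial>count_space UNIV)
      = (\<integral>\<^sup>+n. ennreal (1 / (1 + real_of_int \<bar>int_decode n\<bar>)\<^sup>2) \<partial>count_space UNIV)"
    by (rule nn_integral_bij_count_space[OF bij_int_decode, symmetric])
  also have "\<dots> \<le> (\<integral>\<^sup>+n. ennreal (4 * (1 / (real n + 1)\<^sup>2)) \<partial>count_space UNIV)"
    by (intro nn_integral_mono ennreal_leI le)
  also have "\<dots> = (\<Sum>n. ennreal (4 * (1 / (real n + 1)\<^sup>2)))" by (rule nn_integral_count_space_nat)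
  also have "\<dots> = ennreal (\<Sum>n. 4 * (1 / (real n + 1)\<^sup>2))" by (rule suminf_ennreal2[OF _ s]) simp
  also have "\<dots> < \<infinity>" by simp
  finally show ?thesis .
qed

text \<open>Gibbs' inequality term by term, against the summable weights \<open>1 / a^2\<close>:
  apply \<open>ln t \<le> t - 1\<close> at \<open>t = 1 / (a^2 * p)\<close>.\<close>

lemma entropy_term_le:
  assumes "0 \<le> p" "(1::real) \<le> a"
  shows "- (p * ln p) \<le> 2 * (p * ln a) + 1 / a\<^sup>2"
proof (cases "p = 0")
  case False
  then have p: "p > 0" using assms by simp
  have a: "a > 0" using assms by simp
  have "ln (1 / (a\<^sup>2 * p)) \<le> 1 / (a\<^sup>2 * p) - 1" by (rule ln_le_minus_one) (use p a in simp)
  also have "ln (1 / (a\<^sup>2 * p)) = - (2 * ln a + ln p)" using p a by (simp add: ln_div ln_mult ln_realpow)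
  finally have "p * (- (2 * ln a + ln p)) \<le> p * (1 / (a\<^sup>2 * p) - 1)" using p by (intro mult_left_mono) auto
  moreover have "p * (1 / (a\<^sup>2 * p) - 1) = 1 / a\<^sup>2 - p" using p by (simp add: field_simps)
  ultimately show ?thesis using p by (simp add: algebra_simps)
qed (use assms in simp)

text \<open>Comparing with the weights \<open>1 / (1 + |m|)^2\<close> bounds the entropy by twice
  the logarithmic moment plus a convergent series.\<close>

lemma (in prob_space) finite_log_moment_entropy:
  fixes c :: "'a \<Rightarrow> int"
  assumes c: "\<And>m. {x \<in> space M. c x = m} \<in> sets M"
    and fin: "(\<integral>\<^sup>+x. ennreal (ln (1 + real_of_int \<bar>c x\<bar>)) \<partial>M) < \<infinity>"
  shows "countable_measurable_partition M (range (\<lambda>m. {x \<in> space M. c x = m}))"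
    and "shannon_entropy M (range (\<lambda>m. {x \<in> space M. c x = m})) < \<infinity>"
proof -
  let ?E = "\<lambda>m. {x \<in> space M. c x = m}"
  show "countable_measurable_partition M (range ?E)"
    unfolding countable_measurable_partition_def using c by (auto simp: disjoint_def)
  let ?a = "\<lambda>m. 1 + real_of_int \<bar>m\<bar>"
  have a1: "ln (?a m) \<ge> 0" for m by simp
  have "shannon_entropy M (range ?E) \<le> (\<integral>\<^sup>+m. ennreal (- (measure M (?E m) * ln (measure M (?E m)))) \<partial>count_space UNIV)"
    unfolding shannon_entropy_def by (rule nn_integral_count_space_range_le)
  also have "\<dots> \<le> (\<integral>\<^sup>+m. 2 * ennreal (measure M (?E m) * ln (?a m)) + ennreal (1 / (?a m)\<^sup>2) \<partial>count_space UNIV)"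
  proof (rule nn_integral_mono)
    fix m
    have "ennreal (- (measure M (?E m) * ln (measure M (?E m)))) \<le> ennreal (2 * (measure M (?E m) * ln (?a m)) + 1 / (?a m)\<^sup>2)"
      by (intro ennreal_leI entropy_term_le) auto
    also have "\<dots> = ennreal (2 * (measure M (?E m) * ln (?a m))) + ennreal (1 / (?a m)\<^sup>2)"
      by (rule ennreal_plus) (use a1 in auto)
    also have "ennreal (2 * (measure M (?E m) * ln (?a m))) = 2 * ennreal (measure M (?E m) * ln (?a m))"
      by (subst ennreal_mult) (use a1 in auto)
    finally show "ennreal (- (measure M (?E m) * ln (measure M (?E m)))) \<le> 2 * ennreal (measure M (?E m) * ln (?a m)) + ennreal (1 / (?a m)\<^sup>2)" .
  qed
  also have "\<dots> = 2 * (\<integral>\<^sup>+m. ennreal (measure M (?E m) * ln (?a m)) \<partial>count_space UNIV) + (\<integral>\<^sup>+m. ennreal (1 / (?a m)\<^sup>2) \<partial>count_space UNIV)"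
    by (simp add: nn_integral_add nn_integral_cmult)
  also have "(\<integral>\<^sup>+m. ennreal (measure M (?E m) * ln (?a m)) \<partial>count_space UNIV) = (\<integral>\<^sup>+x. ennreal (ln (?a (c x))) \<partial>M)"
  proof -
    have "(\<integral>\<^sup>+m. ennreal (measure M (?E m) * ln (?a m)) \<partial>count_space UNIV)
      = (\<integral>\<^sup>+m. (\<integral>\<^sup>+x. ennreal (ln (?a m)) * indicator (?E m) x \<partial>M) \<partial>count_space UNIV)"
    proof (rule nn_integral_cong)
      fix m
      show "ennreal (measure M (?E m) * ln (?a m)) = (\<integral>\<^sup>+x. ennreal (ln (?a m)) * indicator (?E m) x \<partial>M)"
        using c[of m] a1[of m] by (simp add: nn_integral_cmult_indicator emeasure_eq_measure ennreal_mult mult.commute)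
    qed
    also have "\<dots> = (\<integral>\<^sup>+x. (\<integral>\<^sup>+m. ennreal (ln (?a m)) * indicator (?E m) x \<partial>count_space UNIV) \<partial>M)"
      using c by (intro nn_integral_count_space_nn_integral[symmetric]) auto
    also have "\<dots> = (\<integral>\<^sup>+x. ennreal (ln (?a (c x))) \<partial>M)"
    proof (rule nn_integral_cong)
      fix x assume x: "x \<in> space M"
      have "(\<integral>\<^sup>+m. ennreal (ln (?a m)) * indicator (?E m) x \<partial>count_space UNIV)
        = (\<Sum>m\<in>{c x}. ennreal (ln (?a m)) * indicator (?E m) x)"
        by (rule nn_integral_count_space') (auto simp: indicator_def)
      then show "(\<integral>\<^sup>+m. ennreal (ln (?a m)) * indicator (?E m) x \<partial>count_space UNIV) = ennreal (ln (?a (c x)))"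
        using x by (simp add: indicator_def)
    qed
    finally show ?thesis .
  qed
  also have "2 * (\<integral>\<^sup>+x. ennreal (ln (?a (c x))) \<partial>M) + (\<integral>\<^sup>+m. ennreal (1 / (?a m)\<^sup>2) \<partial>count_space UNIV) < \<infinity>"
    using fin nn_integral_int_inverse_square by (simp add: ennreal_mult_less_top ennreal_add_less_top)
  finally show "shannon_entropy M (range ?E) < \<infinity>" .
qed

text \<open>Stands in for \<open>oe_cocycle\<close> with powers of bijections of the whole type; for
  the maps of the theorem the two agree on \<open>space M\<close>.\<close>

definition coc :: "('a \<Rightarrow> 'a) \<Rightarrow> ('a \<Rightarrow> 'a) \<Rightarrow> 'a \<Rightarrow> int \<Rightarrow> int" where
  "coc S T x n = (if \<exists>!m. ipow T m x = ipow S n x then THE m. ipow T m x = ipow S n x else 0)"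

text \<open>Since \<open>1 + |a + b|\<close> is at most the product of \<open>1 + |a|\<close> and
  \<open>1 + |b|\<close>, logarithmic moments pass through the cocycle identity.\<close>

lemma ln_abs_add_le:
  "ln (1 + real_of_int \<bar>a + b\<bar>) \<le> ln (1 + real_of_int \<bar>a\<bar>) + ln (1 + real_of_int \<bar>b\<bar>)"
proof -
  have "real_of_int \<bar>a + b\<bar> \<le> real_of_int \<bar>a\<bar> + real_of_int \<bar>b\<bar>" by linarith
  moreover have "0 \<le> real_of_int \<bar>a\<bar> * real_of_int \<bar>b\<bar>" by simp
  ultimately have "1 + real_of_int \<bar>a + b\<bar> \<le> (1 + real_of_int \<bar>a\<bar>) * (1 + real_of_int \<bar>b\<bar>)"
    unfolding distrib_left distrib_right by linarith
  then have "ln (1 + real_of_int \<bar>a + b\<bar>) \<le> ln ((1 + real_of_int \<bar>a\<bar>) * (1 + real_of_int \<bar>b\<bar>))"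
    by (rule ln_mono) (rule add_pos_nonneg, simp_all)
  also have "\<dots> = ln (1 + real_of_int \<bar>a\<bar>) + ln (1 + real_of_int \<bar>b\<bar>)"
    by (rule ln_mult_pos) (rule add_pos_nonneg, simp, simp)+
  finally show ?thesis .
qed

lemma ipow_orbit:
  assumes S: "bij S" and T: "bij T" and orb: "\<And>x. \<exists>i. S x = ipow T i x"
  shows "\<exists>m. ipow S n x = ipow T m x"
proof (induction n rule: int_induct[where k = 0])
  case base
  then show ?case by (intro exI[of _ 0]) simp
next
  case (step1 n)
  then obtain m where m: "ipow S n x = ipow T m x" by blast
  obtain i where "S (ipow T m x) = ipow T i (ipow T m x)" using orb by blast
  then show ?case using m by (intro exI[of _ "i + m"]) (simp add: ipow_plus1[OF S] ipow_add[OF T])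
next
  case (step2 n)
  then obtain m where m: "ipow S n x = ipow T m x" by blast
  let ?z = "inv S (ipow S n x)"
  obtain i where "S ?z = ipow T i ?z" using orb by blast
  then have "ipow T m x = ipow T i ?z" using S m by (simp add: bij_is_surj surj_f_inv_f)
  then have "ipow T (- i) (ipow T m x) = ?z" using T by simp
  then have "?z = ipow T (- i + m) x" by (simp only: ipow_add[OF T])
  then show ?case by (intro exI[of _ "- i + m"]) (simp add: ipow_minus1[OF S])
qed

text \<open>If \<open>D k\<close> is the last of these sets containing \<open>x\<close>, the cocycle
  at time 1 is bounded by \<open>L (Suc k)\<close>; so its logarithmic moment is at most a constant
  plus the sum of \<open>measure M (D k) * ln (1 + L (Suc k))\<close>. The cocycle identity and the
  invariance of the measure carry finiteness from time 1 to every time.\<close>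

lemma (in sep_prob) finite_entropy_coc:
  fixes D :: "nat \<Rightarrow> 'a set" and L :: "nat \<Rightarrow> nat"
  assumes S: "aut M S" and T: "aut M T" and free: "AE x in M. \<forall>m. m \<noteq> 0 \<longrightarrow> ipow T m x \<noteq> x"
    and orb: "\<And>x. \<exists>i. S x = ipow T i x"
    and D: "\<And>k. D k \<in> sets M" "\<And>k. measure M (D k) * (1 + ln (1 + real (L (Suc k)))) \<le> (1/2) ^ k"
    and ev: "AE x in M. \<exists>k. \<forall>j\<ge>k. x \<notin> D j"
    and bd: "AE x in M. \<forall>k. (\<forall>j\<ge>k. x \<notin> D j) \<longrightarrow> (\<exists>i. S x = ipow T i x \<and> \<bar>i\<bar> \<le> int (L k))"
  shows "countable_measurable_partition M (range (\<lambda>m. {x \<in> space M. coc S T x n = m})) \<and>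
    shannon_entropy M (range (\<lambda>m. {x \<in> space M. coc S T x n = m})) < \<infinity>"
proof -
  note bS = autD(1)[OF S] and bT = autD(1)[OF T]
  define Fr where "Fr = {x \<in> space M. \<forall>m. m \<noteq> 0 \<longrightarrow> ipow T m x \<noteq> x}"
  have mv: "{x \<in> space M. ipow T m x \<noteq> x} \<in> sets M" for m
    by (rule neq_set_measurable[OF autD(2)[OF aut_ipow[OF T]] measurable_ident_sets[OF refl]])
  have Fr: "Fr \<in> sets M"
  proof -
    have "Fr = space M - (\<Union>m\<in>UNIV - {0}. space M - {x \<in> space M. ipow T m x \<noteq> x})" by (auto simp: Fr_def)
    also have "\<dots> \<in> sets M" using mv by (intro sets.Diff sets.countable_UN') auto
    finally show ?thesis .
  qed
  have aeFr: "AE x in M. x \<in> Fr" using free AE_space by eventually_elim (simp add: Fr_def)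
  have unique: "m = m'" if "x \<in> Fr" "ipow T m x = ipow T m' x" for x m m'
  proof (rule ccontr)
    assume "m \<noteq> m'"
    have "ipow T (- m' + m) x = x" unfolding ipow_add[OF bT] that(2) using bT by simp
    then show False using that(1) \<open>m \<noteq> m'\<close> by (simp add: Fr_def)
  qed
  have coc_eq: "coc S T x n = m" if x: "x \<in> Fr" "ipow T m x = ipow S n x" for x n m
  proof -
    have ex1: "\<exists>!m. ipow T m x = ipow S n x"
      using x(2) by (rule ex1I) (rule unique[OF x(1)], simp add: x(2))
    then have "coc S T x n = (THE m. ipow T m x = ipow S n x)" unfolding coc_def by (rule if_P)
    also have "\<dots> = m" by (rule the1_equality[OF ex1 x(2)])
    finally show ?thesis .
  qed
  have coc_prop: "ipow T (coc S T x n) x = ipow S n x" if "x \<in> Fr" for x n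
  proof -
    obtain m where "ipow S n x = ipow T m x" using ipow_orbit[OF bS bT orb] by blast
    then show ?thesis using coc_eq[OF that, of m n] by simp
  qed
  \<comment> \<open>At a periodic point of \<open>T\<close> the exponent is not unique and the
    default 0 is taken. This null set has to be described exactly, since measurability of the level
    sets is claimed in a space that may not be complete.\<close>
  have nFr: "coc S T x n = 0" if x: "x \<in> space M" "x \<notin> Fr" for x n
  proof -
    obtain m where m: "m \<noteq> 0" "ipow T m x = x" using x by (auto simp: Fr_def)
    obtain k where k: "ipow T k x = ipow S n x" using ipow_orbit[OF bS bT orb, of n x] by metis
    have "ipow T (k + m) x = ipow S n x" unfolding ipow_add[OF bT] m(2) k ..
    then have "\<not> (\<exists>!m. ipow T m x = ipow S n x)" using k m(1) by (metis add_cancel_right_right)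
    then show ?thesis unfolding coc_def by (rule if_not_P)
  qed
  have cm: "{x \<in> space M. coc S T x n = m} \<in> sets M" for n m
  proof -
    have "{x \<in> space M. coc S T x n = m} = (Fr \<inter> {x \<in> space M. ipow T m x = ipow S n x}) \<union> (if m = 0 then space M - Fr else {})"
    proof (intro set_eqI)
      fix x
      have "coc S T x n = m \<longleftrightarrow> ipow T m x = ipow S n x" if "x \<in> Fr" using coc_eq[OF that] coc_prop[OF that] by blast
      moreover have "x \<in> space M" if "x \<in> Fr" using that by (simp add: Fr_def)
      moreover have "coc S T x n = 0" if "x \<in> space M - Fr" using that nFr by simp
      ultimately show "x \<in> {x \<in> space M. coc S T x n = m} \<longleftrightarrow>
        x \<in> (Fr \<inter> {x \<in> space M. ipow T m x = ipow S n x}) \<union> (if m = 0 then space M - Fr else {})"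
        by (cases "x \<in> Fr") auto
    qed
    also have "\<dots> \<in> sets M"
      using Fr eq_set_measurable[OF autD(2)[OF aut_ipow[OF T, of m]] autD(2)[OF aut_ipow[OF S, of n]]] by auto
    finally show ?thesis .
  qed
  define g where "g n x = ennreal (ln (1 + real_of_int \<bar>coc S T x n\<bar>))" for n x
  have g_meas: "g n \<in> borel_measurable M" for n
  proof -
    have "(\<lambda>x. coc S T x n) \<in> measurable M (count_space UNIV)"
      using cm[of n] by (simp add: measurable_count_space_eq2_countable vimage_def Int_def conj_commute)
    from measurable_compose[OF this, of "\<lambda>m. ennreal (ln (1 + real_of_int \<bar>m\<bar>))" borel]
    show ?thesis by (simp add: g_def[abs_def])
  qed
  have g1: "(\<integral>\<^sup>+x. g 1 x \<partial>M) < \<infinity>"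
  proof -
    let ?l = "\<lambda>k. ennreal (ln (1 + real (L k)))"
    have lmono: "g 1 x \<le> ?l k" if "x \<in> Fr" "S x = ipow T i x" "\<bar>i\<bar> \<le> int (L k)" for x i k
    proof -
      have c: "coc S T x 1 = i" by (rule coc_eq[OF that(1)]) (simp add: that(2))
      have "real_of_int \<bar>i\<bar> \<le> real (L k)" using that(3) by linarith
      then have "ln (1 + real_of_int \<bar>i\<bar>) \<le> ln (1 + real (L k))"
        by (intro ln_mono add_left_mono add_pos_nonneg) simp_all
      then show ?thesis unfolding g_def c by (rule ennreal_leI)
    qed
    have "AE x in M. g 1 x \<le> ?l 0 + (\<Sum>k. ?l (Suc k) * indicator (D k) x)"
      using aeFr ev bd
    proof eventually_elim
      case (elim x)
      \<comment> \<open>By minimality, \<open>K = Suc k\<close> forces \<open>x\<close> into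
        \<open>D k\<close>, so the single term \<open>k\<close> of the series already bounds the
        cocycle; the summand \<open>?l 0\<close> covers \<open>K = 0\<close>.\<close>
      define K where "K = (LEAST k. \<forall>j\<ge>k. x \<notin> D j)"
      have K: "\<forall>j\<ge>K. x \<notin> D j" unfolding K_def by (rule LeastI_ex[OF elim(2)])
      obtain i where i: "S x = ipow T i x" "\<bar>i\<bar> \<le> int (L K)" using elim(3) K by blast
      have gl: "g 1 x \<le> ?l K" by (rule lmono[OF elim(1) i])
      show ?case
      proof (cases K)
        case 0
        then show ?thesis using gl by (simp add: add_increasing2)
      next
        case (Suc k)
        have "\<not> (\<forall>j\<ge>k. x \<notin> D j)" using not_less_Least[of k "\<lambda>k. \<forall>j\<ge>k. x \<notin> D j"] Suc by (simp add: K_def)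
        then obtain j where j: "j \<ge> k" "x \<in> D j" by blast
        then have "j = k" using K Suc by (metis le_antisym not_less_eq_eq)
        then have "?l K = (\<Sum>k\<in>{k}. ?l (Suc k) * indicator (D k) x)" using j Suc by simp
        also have "\<dots> \<le> (\<Sum>k. ?l (Suc k) * indicator (D k) x)"
          by (rule sum_le_suminf) auto
        finally show ?thesis using gl by (meson add_increasing order_trans zero_le)
      qed
    qed
    then have "(\<integral>\<^sup>+x. g 1 x \<partial>M) \<le> (\<integral>\<^sup>+x. ?l 0 + (\<Sum>k. ?l (Suc k) * indicator (D k) x) \<partial>M)"
      by (rule nn_integral_mono_AE)
    also have "\<dots> = (\<integral>\<^sup>+x. ?l 0 \<partial>M) + (\<integral>\<^sup>+x. (\<Sum>k. ?l (Suc k) * indicator (D k) x) \<partial>M)"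
      using D(1) by (intro nn_integral_add) auto
    also have "(\<integral>\<^sup>+x. (\<Sum>k. ?l (Suc k) * indicator (D k) x) \<partial>M) = (\<Sum>k. \<integral>\<^sup>+x. ?l (Suc k) * indicator (D k) x \<partial>M)"
      using D(1) by (intro nn_integral_suminf) auto
    also have "\<dots> \<le> (\<Sum>k. ennreal ((1/2) ^ k))"
    proof (intro suminf_le allI)
      fix k
      have "(\<integral>\<^sup>+x. ?l (Suc k) * indicator (D k) x \<partial>M) = ?l (Suc k) * emeasure M (D k)"
        by (rule nn_integral_cmult_indicator[OF D(1)])
      also have "\<dots> = ennreal (measure M (D k) * ln (1 + real (L (Suc k))))"
        by (simp add: emeasure_eq_measure ennreal_mult mult.commute)
      also have "\<dots> \<le> ennreal ((1/2) ^ k)"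
      proof (rule ennreal_leI)
        have "measure M (D k) * ln (1 + real (L (Suc k))) \<le> measure M (D k) * (1 + ln (1 + real (L (Suc k))))"
          by (intro mult_left_mono) auto
        then show "measure M (D k) * ln (1 + real (L (Suc k))) \<le> (1/2) ^ k" using D(2)[of k] by linarith
      qed
      finally show "(\<integral>\<^sup>+x. ?l (Suc k) * indicator (D k) x \<partial>M) \<le> ennreal ((1/2) ^ k)" .
    qed auto
    also have "(\<Sum>k. ennreal ((1/2) ^ k)) = ennreal (\<Sum>k. (1/2) ^ k)"
      by (rule suminf_ennreal2) (simp_all add: summable_geometric)
    also have "(\<integral>\<^sup>+x. ?l 0 \<partial>M) + ennreal (\<Sum>k. (1/2) ^ k) < \<infinity>"
      by (simp add: emeasure_space_1 ennreal_add_less_top)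
    finally show ?thesis by (simp add: add_left_mono)
  qed
  have gS: "(\<integral>\<^sup>+x. g 1 (ipow S n x) \<partial>M) = (\<integral>\<^sup>+x. g 1 x \<partial>M)" for n
    by (rule aut_nn_integral[OF aut_ipow[OF S] g_meas])
  have meas1: "(\<lambda>x. g 1 (ipow S n x)) \<in> borel_measurable M" for n
    by (rule measurable_compose[OF autD(2)[OF aut_ipow[OF S]] g_meas])
  have sum_fin: "(\<integral>\<^sup>+x. g n' x \<partial>M) < \<infinity>"
    if "AE x in M. g n' x \<le> g n x + g 1 (ipow S m x)" "(\<integral>\<^sup>+x. g n x \<partial>M) < \<infinity>" for n n' m
  proof -
    have "(\<integral>\<^sup>+x. g n' x \<partial>M) \<le> (\<integral>\<^sup>+x. g n x + g 1 (ipow S m x) \<partial>M)" using that(1) by (rule nn_integral_mono_AE)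
    also have "\<dots> = (\<integral>\<^sup>+x. g n x \<partial>M) + (\<integral>\<^sup>+x. g 1 (ipow S m x) \<partial>M)"
      using g_meas meas1 by (rule nn_integral_add)
    also have "\<dots> < \<infinity>" using that(2) g1 unfolding gS by (simp add: ennreal_add_less_top)
    finally show ?thesis .
  qed
  \<comment> \<open>The increment \<open>i\<close> is a time 1 value of the cocycle, with a minus
    sign when the step in \<open>n\<close> goes backwards; only its absolute value enters.\<close>
  have g_add: "g n' x \<le> g n x + g 1 y" if "coc S T x n' = coc S T x n + i" "\<bar>i\<bar> = \<bar>coc S T y 1\<bar>" for n n' x y i
  proof -
    have "ln (1 + real_of_int \<bar>coc S T x n'\<bar>) \<le> ln (1 + real_of_int \<bar>coc S T x n\<bar>) + ln (1 + real_of_int \<bar>coc S T y 1\<bar>)"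
      using ln_abs_add_le[of "coc S T x n" i] that by simp
    then have "g n' x \<le> ennreal (ln (1 + real_of_int \<bar>coc S T x n\<bar>) + ln (1 + real_of_int \<bar>coc S T y 1\<bar>))"
      unfolding g_def by (rule ennreal_leI)
    also have "\<dots> = g n x + g 1 y" unfolding g_def by (rule ennreal_plus) simp_all
    finally show ?thesis .
  qed
  have aeS: "AE x in M. ipow S n x \<in> Fr" for n by (rule aut_AE[OF aut_ipow[OF S] aeFr])
  have "(\<integral>\<^sup>+x. g n x \<partial>M) < \<infinity>"
  proof (induction n rule: int_induct[where k = 0])
    case base
    have "AE x in M. g 0 x = 0"
      using aeFr
    proof eventually_elim
      case (elim x)
      have "coc S T x 0 = 0" by (rule coc_eq[OF elim]) simp
      then show ?case by (simp add: g_def)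
    qed
    then have "(\<integral>\<^sup>+x. g 0 x \<partial>M) = (\<integral>\<^sup>+x. 0 \<partial>M)" by (rule nn_integral_cong_AE)
    then show ?case by simp
  next
    case (step1 n)
    have "AE x in M. g (n + 1) x \<le> g n x + g 1 (ipow S n x)"
      using aeFr aeS[of n]
    proof eventually_elim
      case (elim x)
      let ?c = "coc S T (ipow S n x) 1"
      have "ipow T (?c + coc S T x n) x = ipow S (n + 1) x"
        unfolding ipow_add[OF bT] coc_prop[OF elim(1)] coc_prop[OF elim(2)] by (simp add: ipow_plus1[OF bS])
      then have "coc S T x (n + 1) = coc S T x n + ?c" using coc_eq[OF elim(1)] by (simp add: add.commute)
      then show ?case by (rule g_add) simp
    qed
    then show ?case using step1.IH by (rule sum_fin)
  next
    case (step2 n)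
    have "AE x in M. g (n - 1) x \<le> g n x + g 1 (ipow S (n - 1) x)"
      using aeFr aeS[of "n - 1"]
    proof eventually_elim
      case (elim x)
      let ?y = "ipow S (n - 1) x"
      let ?c = "coc S T ?y 1"
      have "ipow T ?c ?y = ipow S n x" using coc_prop[OF elim(2), of 1] ipow_plus1[OF bS, of "n - 1" x] by simp
      then have "?y = ipow T (- ?c) (ipow T (coc S T x n) x)"
        unfolding coc_prop[OF elim(1)] using bT by (metis ipow_cancel(2))
      then have "ipow T (- ?c + coc S T x n) x = ?y" unfolding ipow_add[OF bT] by (rule sym)
      then have "coc S T x (n - 1) = coc S T x n + - ?c" using coc_eq[OF elim(1)] by (simp add: add.commute)
      then show ?case by (rule g_add) simp
    qed
    then show ?case using step2.IH by (rule sum_fin)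
  qed
  then show ?thesis using finite_log_moment_entropy[OF cm, of n] unfolding g_def by blast
qed

section \<open>Back to transformations of the space, and the theorem\<close>

lemma zpow_eq_ipow:
  assumes T': "aut M T'" and eq: "\<And>x. x \<in> space M \<Longrightarrow> T x = T' x" and x: "x \<in> space M"
  shows "zpow M T n x = ipow T' n x"
proof -
  have inv_eq: "inv_into (space M) T y = inv T' y" if y: "y \<in> space M" for y
  proof (rule inv_into_f_eq)
    show "inj_on T (space M)"
      using bij_is_inj[OF autD(1)[OF T']] eq by (auto simp: inj_on_def)
    show z: "inv T' y \<in> space M" using aut_space[OF aut_inv[OF T']] y by blast
    show "T (inv T' y) = y" using eq[OF z] autD(5)[OF T'] by simp
  qed
  have pos: "(T ^^ k) x = (T' ^^ k) x" for k
    using eq x aut_space[OF aut_funpow[OF T']] by (induction k) auto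
  have neg: "(inv_into (space M) T ^^ k) x = (inv T' ^^ k) x" for k
    using inv_eq x aut_space[OF aut_funpow[OF aut_inv[OF T']]] by (induction k) auto
  show ?thesis using pos neg by (simp add: zpow_def ipow_def)
qed

text \<open>Extending by the identity outside \<open>space M\<close> turns a bijection of the space
  into a bijection of the type with an explicit inverse.\<close>

lemma pmp_imp_aut:
  assumes "pmp_transformation M S"
  shows "aut M (\<lambda>x. if x \<in> space M then S x else x)"
proof -
  let ?S = "\<lambda>x. if x \<in> space M then S x else x"
  note S = assms[unfolded pmp_transformation_def]
  have b: "bij_betw S (space M) (space M)" using S by blast
  let ?I = "\<lambda>x. if x \<in> space M then inv_into (space M) S x else x"
  have 1: "?I (?S x) = x" for x
    using bij_betw_inv_into_left[OF b] bij_betwE[OF b] by auto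
  have 2: "?S (?I x) = x" for x
    using bij_betw_inv_into_right[OF b] bij_betwE[OF bij_betw_inv_into[OF b]] by auto
  have bij: "bij ?S" by (rule o_bij[of ?I]) (auto simp: fun_eq_iff 1 2 simp del: if_split)
  have inv: "inv ?S = ?I" by (rule inv_equality[OF 1 2])
  have m: "?S \<in> measurable M M" using S by (subst measurable_cong[of M ?S S]) auto
  have i: "?I \<in> measurable M M"
    using S by (subst measurable_cong[of M ?I "inv_into (space M) S"]) auto
  have "distr M M ?S = distr M M S" by (rule distr_cong) auto
  then have "distr M M ?S = M" using S by simp
  then show ?thesis unfolding aut_def inv using bij m i by blast
qed

lemma aut_imp_pmp:
  assumes "prob_space M" "aut M T"
  shows "pmp_transformation M T"
proof -
  note T = autD[OF assms(2)]
  have "T ` space M = space M"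
  proof
    show "T ` space M \<subseteq> space M" using aut_space[OF assms(2)] by blast
    show "space M \<subseteq> T ` space M"
    proof
      fix y assume "y \<in> space M"
      then show "y \<in> T ` space M" using T(5) aut_space[OF aut_inv[OF assms(2)], of y]
        by (intro image_eqI[of _ _ "inv T y"]) simp_all
    qed
  qed
  then have b: "bij_betw T (space M) (space M)"
    using bij_is_inj[OF T(1)] by (auto simp: bij_betw_def inj_on_def inj_def)
  have "zpow M T (-1) x = ipow T (-1) x" if "x \<in> space M" for x
    by (rule zpow_eq_ipow[OF assms(2) refl that])
  then have "inv_into (space M) T x = inv T x" if "x \<in> space M" for x using that by (simp add: zpow_def)
  then have "inv_into (space M) T \<in> measurable M M"
    using T(3) by (subst measurable_cong[of M _ "inv T"]) auto
  then show ?thesis using assms(1) T b by (simp add: pmp_transformation_def)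
qed

text \<open>The lower limit is taken as \<open>|n|\<close> tends to infinity, so arbitrarily large
  positive times suffice: if it were positive, the sum would stay above some \<open>e > 0\<close>
  for all large \<open>|n|\<close>.\<close>

lemma weak_mixingI:
  assumes "prob_space M" and T: "aut M T"
    and mix: "\<And>F e N. finite F \<Longrightarrow> F \<subseteq> sets M \<Longrightarrow> e > 0 \<Longrightarrow>
      \<exists>n>N. \<forall>A\<in>F. \<forall>B\<in>F. \<bar>measure M (B \<inter> ipow T (int n) -` A) - measure M A * measure M B\<bar> < e"
  shows "weak_mixing M T"
  unfolding weak_mixing_def
proof (intro allI impI)
  fix F assume F: "finite F \<and> F \<subseteq> sets M"
  define f where "f n = (\<Sum>A\<in>F. \<Sum>B\<in>F. \<bar>measure M (A \<inter> zpow M T n ` B) - measure M A * measure M B\<bar>)" for n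
  let ?F = "filtercomap abs at_top :: int filter"
  have "0 \<le> Liminf ?F (\<lambda>n. ereal (f n))"
    by (intro Liminf_bounded always_eventually allI) (simp add: f_def sum_nonneg)
  moreover have "\<not> 0 < Liminf ?F (\<lambda>n. ereal (f n))"
  proof
    assume "0 < Liminf ?F (\<lambda>n. ereal (f n))"
    then obtain e where e: "0 < ereal e" "ereal e < Liminf ?F (\<lambda>n. ereal (f n))"
      using ereal_dense2[of 0 "Liminf ?F (\<lambda>n. ereal (f n))"] by auto
    then have "\<forall>\<^sub>F n in ?F. ereal e < ereal (f n)" by (intro less_LiminfD)
    then obtain P where P: "eventually P at_top" "\<And>n. P \<bar>n\<bar> \<Longrightarrow> e < f n"
      unfolding eventually_filtercomap by auto
    then obtain N where N: "\<And>n. n \<ge> N \<Longrightarrow> P n" by (auto simp: eventually_at_top_linorder)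
    \<comment> \<open>The double sum has \<open>card F * card F\<close> terms; the added 1 avoids a
      division by zero when \<open>F\<close> is empty.\<close>
    define d where "d = e / (real (card F) * real (card F) + 1)"
    have d: "d > 0" unfolding d_def using e(1) by (intro divide_pos_pos add_nonneg_pos) auto
    obtain n where n: "n > nat N"
      "\<And>A B. A \<in> F \<Longrightarrow> B \<in> F \<Longrightarrow> \<bar>measure M (B \<inter> ipow T (int n) -` A) - measure M A * measure M B\<bar> < d"
      using mix[of F d "nat N"] F d by blast
    have "f (int n) \<le> (\<Sum>A\<in>F. \<Sum>B\<in>F. d)"
      unfolding f_def
    proof (intro sum_mono)
      fix A B assume AB: "A \<in> F" "B \<in> F"
      then have s: "A \<in> sets M" "B \<in> sets M" using F by auto
      have "zpow M T (int n) ` B = ipow T (int n) ` B"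
        using zpow_eq_ipow[OF T refl] sets.sets_into_space[OF s(2)] by (intro image_cong) auto
      \<comment> \<open>Translates between the image form in \<open>weak_mixing\<close> and the
        preimage form of the hypothesis: the two sets correspond under a measure preserving power of
        \<open>T\<close>.\<close>
      then have "A \<inter> zpow M T (int n) ` B = ipow T (int n) ` (B \<inter> ipow T (int n) -` A)" by auto
      moreover have "B \<inter> ipow T (int n) -` A \<in> sets M" using s aut_vimage(1)[OF aut_ipow[OF T]] by blast
      ultimately show "\<bar>measure M (A \<inter> zpow M T (int n) ` B) - measure M A * measure M B\<bar> \<le> d"
        using n(2)[OF AB] aut_image(3)[OF aut_ipow[OF T]] by simp
    qed
    also have "\<dots> = real (card F) * real (card F) * d" by simp
    also have "\<dots> \<le> (real (card F) * real (card F) + 1) * d" using d by (intro mult_right_mono) auto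
    also have "\<dots> = e"
    proof -
      have "0 \<le> real (card F) * real (card F)" by simp
      then have "real (card F) * real (card F) + 1 \<noteq> 0" by linarith
      then show ?thesis by (simp add: d_def)
    qed
    finally have "f (int n) \<le> e" .
    moreover have "P \<bar>int n\<bar>" using n(1) by (intro N) auto
    ultimately show False using P(2)[of "int n"] by simp
  qed
  ultimately show "Liminf ?F (\<lambda>n. ereal (\<Sum>A\<in>F. \<Sum>B\<in>F. \<bar>measure M (A \<inter> zpow M T n ` B) - measure M A * measure M B\<bar>)) = 0"
    unfolding f_def by simp
qed

theorem mainTheorem1:
  fixes M :: "'a measure" and S :: "'a \<Rightarrow> 'a"
  assumes "standard_prob_space M"
    and "atomless M"
    and "pmp_transformation M S"
    and "ergodic M S"
  shows "\<exists>T. pmp_transformation M T \<and> weak_mixing M T \<and>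
             (AE x in M. int_orbit M T x = int_orbit M S x) \<and>
             shannon_orbit_equivalence M S T"
proof -
  obtain C where C: "sep_prob M C" using sep_prob_standard[OF assms(1)] by blast
  interpret sep_prob M C by fact
  \<comment> \<open>The construction runs with this extension of \<open>S\<close> to a bijection of
    the whole type and is translated back through \<open>zS\<close> and \<open>zT\<close>.\<close>
  define S' where "S' x = (if x \<in> space M then S x else x)" for x
  have S': "aut M S'" using pmp_imp_aut[OF assms(3)] by (simp add: S'_def[abs_def])
  have SS': "S x = S' x" if "x \<in> space M" for x using that by (simp add: S'_def)
  have "ergodic M S'"
    unfolding ergodic_def
  proof (intro ballI impI)
    fix A assume A: "A \<in> sets M" "S' ` A = A"
    have "S ` A = S' ` A" using sets.sets_into_space[OF A(1)] SS' by (intro image_cong) auto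
    then show "measure M A = 0 \<or> measure M A = 1" using A assms(4) by (simp add: ergodic_def)
  qed
  then interpret S: erg_aut M C S' by unfold_locales (use S' assms(2) in auto)
  obtain T D L where main: "aut M T \<and> (\<forall>x. \<exists>i. T x = ipow S' i x) \<and> (\<forall>x. \<exists>i. S' x = ipow T i x) \<and>
    (\<forall>k. D k \<in> sets M \<and> measure M (D k) * (1 + ln (1 + real (L (Suc k)))) \<le> (1/2) ^ k) \<and>
    (AE x in M. \<exists>k. \<forall>j\<ge>k. x \<notin> D j) \<and>
    (AE x in M. \<forall>k. (\<forall>j\<ge>k. x \<notin> D j) \<longrightarrow>
      (\<exists>i. T x = ipow S' i x \<and> \<bar>i\<bar> \<le> int (L k)) \<and> (\<exists>i. S' x = ipow T i x \<and> \<bar>i\<bar> \<le> int (L k))) \<and>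
    (\<forall>k. \<exists>n>k. mixes_at M T n (C ` {..<k}) (2 * (1/2) ^ k))"
    using S.limit_exists by (elim exE)
  then have T: "aut M T" and TS: "\<And>x. \<exists>i. T x = ipow S' i x" and ST: "\<And>x. \<exists>i. S' x = ipow T i x"
    and D: "\<And>k. D k \<in> sets M" "\<And>k. measure M (D k) * (1 + ln (1 + real (L (Suc k)))) \<le> (1/2) ^ k"
    and ev: "AE x in M. \<exists>k. \<forall>j\<ge>k. x \<notin> D j"
    and mix: "\<And>k. \<exists>n>k. mixes_at M T n (C ` {..<k}) (2 * (1/2) ^ k)"
    by blast+
  from main have bd: "AE x in M. \<forall>k. (\<forall>j\<ge>k. x \<notin> D j) \<longrightarrow>
      (\<exists>i. T x = ipow S' i x \<and> \<bar>i\<bar> \<le> int (L k)) \<and> (\<exists>i. S' x = ipow T i x \<and> \<bar>i\<bar> \<le> int (L k))"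
    by blast
  have bd1: "AE x in M. \<forall>k. (\<forall>j\<ge>k. x \<notin> D j) \<longrightarrow> (\<exists>i. S' x = ipow T i x \<and> \<bar>i\<bar> \<le> int (L k))"
    using bd by eventually_elim blast
  have bd2: "AE x in M. \<forall>k. (\<forall>j\<ge>k. x \<notin> D j) \<longrightarrow> (\<exists>i. T x = ipow S' i x \<and> \<bar>i\<bar> \<le> int (L k))"
    using bd by eventually_elim blast
  note bS = autD(1)[OF S'] and bT = autD(1)[OF T]
  have zS: "zpow M S n x = ipow S' n x" and zT: "zpow M T n x = ipow T n x" if "x \<in> space M" for n x
    using zpow_eq_ipow[OF S' SS' that] zpow_eq_ipow[OF T refl that] by simp_all
  \<comment> \<open>A \<open>T\<close>-invariant set is a union of \<open>T\<close>-orbits, and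
    \<open>S'\<close> moves points within these, so ergodicity of \<open>S'\<close> applies to
    it.\<close>
  have "ergodic M T"
    unfolding ergodic_def
  proof (intro ballI impI)
    fix A assume A: "A \<in> sets M" "T ` A = A"
    have Tinv: "T x \<in> A \<longleftrightarrow> x \<in> A" for x using A(2) bij_image_eq_iff[OF bT] by blast
    have "ipow T i x \<in> A \<longleftrightarrow> x \<in> A" for i x
    proof (induction i rule: int_induct[where k = 0])
      case (step1 i)
      then show ?case by (simp add: ipow_plus1[OF bT] Tinv)
    next
      case (step2 i)
      have "T (ipow T (i - 1) x) = ipow T i x" using ipow_plus1[OF bT, of "i - 1" x] by simp
      then show ?case using step2.IH Tinv[of "ipow T (i - 1) x"] by simp
    qed simp
    then have "S' x \<in> A \<longleftrightarrow> x \<in> A" for x using ST[of x] by metis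
    then show "measure M A = 0 \<or> measure M A = 1" by (intro S.invariant_01[OF A(1)])
  qed
  then interpret T: erg_aut M C T by unfold_locales (use T assms(2) in auto)
  \<comment> \<open>Ergodicity on an atomless space gives freeness of both maps, so that the
    exponents defining the two cocycles are unique almost everywhere.\<close>
  have freeS: "AE x in M. \<forall>m. m \<noteq> 0 \<longrightarrow> ipow S' m x \<noteq> x"
    unfolding AE_all_countable using S.free by (intro allI) (auto intro: AE_I2 elim: AE_mp)
  have freeT: "AE x in M. \<forall>m. m \<noteq> 0 \<longrightarrow> ipow T m x \<noteq> x"
    unfolding AE_all_countable using T.free by (intro allI) (auto intro: AE_I2 elim: AE_mp)
  have coc1: "oe_cocycle M S T x n = coc S' T x n" if "x \<in> space M" for x n
    by (simp add: oe_cocycle_def coc_def zS[OF that] zT[OF that])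
  have coc2: "oe_cocycle M T S x n = coc T S' x n" if "x \<in> space M" for x n
    by (simp add: oe_cocycle_def coc_def zS[OF that] zT[OF that])
  have orbits: "int_orbit M T x = int_orbit M S x" if "x \<in> space M" for x
    unfolding int_orbit_def zS[OF that] zT[OF that]
    using ipow_orbit[OF bT bS TS, of _ x] ipow_orbit[OF bS bT ST, of _ x] by (intro equalityI image_subsetI) (metis rangeI)+
  have ent1: "finite_entropy_cocycle M (oe_cocycle M S T)"
    unfolding finite_entropy_cocycle_def cocycle_partition_def
  proof
    fix n
    have eq: "{x \<in> space M. oe_cocycle M S T x n = m} = {x \<in> space M. coc S' T x n = m}" for m using coc1 by auto
    show "countable_measurable_partition M (range (\<lambda>m. {x \<in> space M. oe_cocycle M S T x n = m})) \<and>
      shannon_entropy M (range (\<lambda>m. {x \<in> space M. oe_cocycle M S T x n = m})) < \<infinity>"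
      unfolding eq by (rule finite_entropy_coc[OF S' T freeT ST D ev bd1])
  qed
  have ent2: "finite_entropy_cocycle M (oe_cocycle M T S)"
    unfolding finite_entropy_cocycle_def cocycle_partition_def
  proof
    fix n
    have eq: "{x \<in> space M. oe_cocycle M T S x n = m} = {x \<in> space M. coc T S' x n = m}" for m using coc2 by auto
    show "countable_measurable_partition M (range (\<lambda>m. {x \<in> space M. oe_cocycle M T S x n = m})) \<and>
      shannon_entropy M (range (\<lambda>m. {x \<in> space M. oe_cocycle M T S x n = m})) < \<infinity>"
      unfolding eq by (rule finite_entropy_coc[OF T S' freeS TS D ev bd2])
  qed
  have "essentially_free M S"
    unfolding essentially_free_def using freeS AE_space by eventually_elim (simp add: zS)
  moreover have "essentially_free M T"
    unfolding essentially_free_def using freeT AE_space by eventually_elim (simp add: zT)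
  moreover have orb: "AE x in M. int_orbit M T x = int_orbit M S x" using orbits by (intro AE_I2)
  ultimately have "shannon_orbit_equivalence M S T"
    using ent1 ent2 by (simp add: shannon_orbit_equivalence_def orbit_equivalence_def)
  moreover have "weak_mixing M T"
    using weak_mixingI[OF prob_space_axioms T] S.weak_mixing_dense[OF T mix] by blast
  ultimately show ?thesis using aut_imp_pmp[OF prob_space_axioms T] orb by blast
qed

end
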